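(* For every $L>0$ there is a constant $C>0$ depending only on $L$ such that the following holds. Let $d,T\ge 1$ be integers. Let $f:\mathbb{R}^d\to\mathbb{R}$ be $L$-smooth and bounded below by $f^*>-\infty$, and let the stochastic gradient oracle be unbiased and have coordinate-wise affine variance noise with parameters $\boldsymbol{\sigma}_0,\boldsymbol{\sigma}_1$ (all as specified in the context). Let $\{x_s\}_{s\in[T]}$ be generated by the Adam algorithm with parameters satisfying $$0\le\beta_1<\beta_2<1,\qquad \eta=C_0\sqrt{1-\beta_2},\qquad \epsilon=\epsilon_0\sqrt{1-\beta_2}$$ for some constants $C_0,\epsilon_0>0$. Then for every $\delta\in(0,1)$, with probability at least $1-\delta$, $$\frac1T\sum_{s=1}^T\|\nabla f(x_s)\|^2\le C\cdot\frac{G}{TC_0}\left(\epsilon_0+\sqrt{\frac{\|\boldsymbol{\sigma}_0\|^2+(1+\|\boldsymbol{\sigma}_1\|_\infty^2)G}{1-\beta_2}}\right),$$ where $\mathcal{F}(T)$ (a polynomial in $T$) and $G$ are the explicit quantities defined in the context; they satisfy $$\mathcal{F}(T)\le C\left\{1+\frac{\|\boldsymbol{\sigma}_0\|_\infty^2 T+(1+\|\boldsymbol{\sigma}_1\|_\infty^2)\left(\|\nabla f(x_1)\|^2T+\frac{dC_0^2}{1-\beta_1/\beta_2}T^3\right)}{\epsilon_0^2(1-\beta_2)}\right\}$$ and $$G\le C\left\{f(x_1)-f^*+\frac{C_0(C_0+\epsilon_0+\|\boldsymbol{\sigma}_0\|_\infty)}{\beta_2(1-\beta_1)^2(1-\b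eta_1/\beta_2)}\,d\log\left(\frac{\mathcal{F}(T)+dT}{\delta\beta_2^T}\right)+\frac{C_0^2(1+\|\boldsymbol{\sigma}_1\|_\infty^2)}{\beta_2^2(1-\beta_1)^4(1-\beta_1/\beta_2)^2}\,d^2\log^2\left(\frac{\mathcal{F}(T)+dT}{\delta\beta_2^T}\right)\right\}.$$
   Context: Notation: $[n]=\{1,\dots,n\}$; $\|\cdot\|$, $\|\cdot\|_\infty$ are the $\ell_2$- and $\ell_\infty$-norms; $v_i$ is the $i$-th coordinate of $v\in\mathbb{R}^d$. $L$-smooth: $f$ is differentiable and $\|\nabla f(x)-\nabla f(y)\|\le L\|x-y\|$ for all $x,y$ (hence $f(y)-f(x)-\langle\nabla f(x),y-x\rangle\le\frac L2\|x-y\|^2$). Bounded below: $f(x)\ge f^*$ for all $x\in\mathbb{R}^d$. Oracle: a query at $x\in\mathbb{R}^d$ returns a random vector $g(x)\in\mathbb{R}^d$. Unbiased: $\mathbb{E}[g(x)\mid x]=\nabla f(x)$. Coordinate-wise affine variance noise: for each $i\in[d]$ and all $x$, $(g(x)_i-\nabla f(x)_i)^2\le\sigma_{0,i}^2+\sigma_{1,i}^2\,(\nabla f(x)_i)^2$ almost surely, where $\boldsymbol{\sigma}_0=(\sigma_{0,i})_i$, $\boldsymbol{\sigma}_1=(\sigma_{1,i})_i$ are vectors of positive reals. Each iteration makes a fresh query, so that, with $g_s=g(x_s)$, $\mathbb{E}[g_s\mid g_1,\dots,g_{s-1}]=\nabla f(x_s)$. Adam algorithm: given deterministic $x_1\in\mathbb{R}^d$,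 $\beta_1,\beta_2\in[0,1)$, $\epsilon,\eta>0$, $m_0=v_0=0$; for $s=1,\dots,T$ draw $g_s=(g_{s,i})_i=g(x_s)$ and for $i\in[d]$ set $m_{s,i}=\beta_1m_{s-1,i}+(1-\beta_1)g_{s,i}$, $v_{s,i}=\beta_2v_{s-1,i}+(1-\beta_2)g_{s,i}^2$, $\eta_s=\eta\sqrt{1-\beta_2^s}/(1-\beta_1^s)$, $\epsilon_s=\epsilon\sqrt{1-\beta_2^s}$, $x_{s+1,i}=x_{s,i}-\frac{\eta_s}{\sqrt{v_{s,i}}+\epsilon_s}m_{s,i}$. Explicit quantities: $\Sigma_{\max}=\max\{1,\sqrt{(1+\beta_2)/\beta_2}-1\}$, $$\mathcal{F}(T)=1+\frac{2}{\epsilon^2}\left[\left(\|\boldsymbol{\sigma}_0\|_\infty^2+2(1+\|\boldsymbol{\sigma}_1\|_\infty^2)\|\nabla f(x_1)\|^2\right)T+\frac{2(1+\|\boldsymbol{\sigma}_1\|_\infty^2)dL^2C_0^2}{1-\beta_1/\beta_2}T^3\right],$$ $$\begin{aligned}G=\;&8L(f(x_1)-f^* )+\frac{256L^2C_0^2\beta_1^2d^2}{(1-\beta_1)^3(1-\beta_1/\beta_2)}+\frac{4L^2C_0^2\beta_1^2d}{(1-\beta_1)^2(1-\beta_1/\beta_2)}+\frac{48LC_0\|\boldsymbol{\sigma}_0\|_\infty}{1-\beta_1}d\log\left(\frac{dT}{\delta}\right)\\&+\frac{8LC_0\beta_1^2}{(1-\beta_1)^2(1-\beta_1/\beta_2)}\left[\frac{4\|\boldsymbol{\sigma}_0\|_\infty}{\beta_2}+\frac{\epsilon_0+\sqrt2\|\boldsymbol{\sigma}_0\|_\infty}{\sqrt{\beta_2}}+\frac{LC_0}{2}(1+4\Sigma_{\max}^2)\right]d\log\left(\frac{\mathcal{F}(T)}{\beta_2^T}\right)\\&+8\left(\frac{3L^2C_0^2}{(1-\beta_1)^2}+\frac{8L\|\boldsymbol{\sigma}_0\|_\infty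 C_0}{1-\beta_1}\right)d\log\left(\frac{\mathcal{F}(T)}{\beta_2^T}\right)+\frac{2304L^2C_0^2\|\boldsymbol{\sigma}_1\|_\infty^2}{(1-\beta_1)^2}d^2\log^2\left(\frac{dT}{\delta}\right)\\&+256\left[\frac{16L^2C_0^2\|\boldsymbol{\sigma}_1\|_\infty^2}{(1-\beta_1)^2}+\frac{9L^2C_0^2\beta_1^4(1+\|\boldsymbol{\sigma}_1\|_\infty^2)}{\beta_2^2(1-\beta_1)^4(1-\beta_1/\beta_2)^2}\right]d^2\log^2\left(\frac{\mathcal{F}(T)}{\beta_2^T}\right).\end{aligned}$$ *)

theory Defs
  imports "HOL-Probability.Probability"
begin

section \<open>The space of real vectors with coordinates indexed by 1, ..., d\<close>

text \<open>
  The dimension is a natural number and not a type, because the constant in the theorem must be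
  chosen before, hence independently of, the dimension. Vectors are the functions in
  \<open>{1..d} \<rightarrow>\<^sub>E UNIV\<close>, which is the underlying set of the product measurable space below.
\<close>

definition Rd :: "nat \<Rightarrow> (nat \<Rightarrow> real) measure" where
  "Rd d = PiM {1..d} (\<lambda>_. borel)"

lemma space_Rd: "space (Rd d) = {1..d} \<rightarrow>\<^sub>E UNIV"
  by (simp add: Rd_def space_PiM)

definition l2norm :: "nat \<Rightarrow> (nat \<Rightarrow> real) \<Rightarrow> real" where
  "l2norm d v = L2_set v {1..d}"

definition linfnorm :: "nat \<Rightarrow> (nat \<Rightarrow> real) \<Rightarrow> real" where
  "linfnorm d v = Max ((\<lambda>i. \<bar>v i\<bar>) ` {1..d})"

section \<open>Gradients and smoothness\<close>

text \<open>Frechet differentiability at \<open>x\<close> with gradient \<open>p\<close>.\<close>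

definition has_gradient ::
    "nat \<Rightarrow> ((nat \<Rightarrow> real) \<Rightarrow> real) \<Rightarrow> (nat \<Rightarrow> real) \<Rightarrow> (nat \<Rightarrow> real) \<Rightarrow> bool" where
  "has_gradient d f p x \<longleftrightarrow> p \<in> space (Rd d) \<and>
     (\<forall>e>0. \<exists>r>0. \<forall>y\<in>space (Rd d). l2norm d (\<lambda>i. y i - x i) < r \<longrightarrow>
        \<bar>f y - f x - (\<Sum>i=1..d. p i * (y i - x i))\<bar> \<le> e * l2norm d (\<lambda>i. y i - x i))"

definition gradient :: "nat \<Rightarrow> ((nat \<Rightarrow> real) \<Rightarrow> real) \<Rightarrow> (nat \<Rightarrow> real) \<Rightarrow> (nat \<Rightarrow> real)" where
  "gradient d f x = (THE p. has_gradient d f p x)"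

lemma has_gradient_unique:
  assumes p: "has_gradient d f p x" and q: "has_gradient d f q x" and x: "x \<in> space (Rd d)"
  shows "p = q"
proof (rule ccontr)
  assume "p \<noteq> q"
  then obtain j where j: "p j \<noteq> q j" by blast
  have jd: "j \<in> {1..d}"
    using j p q PiE_arb[of _ "{1..d}" _ j] unfolding has_gradient_def space_Rd by metis
  define e where "e = \<bar>p j - q j\<bar> / 4"
  have e: "e > 0" using j by (simp add: e_def)
  obtain r where r: "r > 0" "\<And>y. y \<in> space (Rd d) \<Longrightarrow> l2norm d (\<lambda>i. y i - x i) < r \<Longrightarrow>
      \<bar>f y - f x - (\<Sum>i=1..d. p i * (y i - x i))\<bar> \<le> e * l2norm d (\<lambda>i. y i - x i)"
    using p e unfolding has_gradient_def by blast
  obtain r' where r': "r' > 0" "\<And>y. y \<in> space (Rd d) \<Longrightarrow> l2norm d (\<lambda>i. y i - x i) < r' \<Longrightarrow>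
      \<bar>f y - f x - (\<Sum>i=1..d. q i * (y i - x i))\<bar> \<le> e * l2norm d (\<lambda>i. y i - x i)"
    using q e unfolding has_gradient_def by blast
  define t where "t = min r r' / 2"
  have t: "t > 0" "t < r" "t < r'" using r(1) r'(1) by (auto simp: t_def)
  define y where "y = x(j := x j + t)"
  have y: "y \<in> space (Rd d)"
    using x jd by (auto simp: y_def space_Rd PiE_iff extensional_def)
  have diff: "(y i - x i) = (if i = j then t else 0)" for i by (simp add: y_def)
  have nrm: "l2norm d (\<lambda>i. y i - x i) = t"
    using jd t by (simp add: l2norm_def L2_set_def diff if_distrib[of "\<lambda>u. u\<^sup>2"] cong: if_cong)
  have s: "(\<Sum>i=1..d. z i * (y i - x i)) = z j * t" for z :: "nat \<Rightarrow> real"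
    using jd by (simp add: diff if_distrib[of "\<lambda>u. _ * u"] cong: if_cong)
  have a: "\<bar>f y - f x - p j * t\<bar> \<le> e * t" "\<bar>f y - f x - q j * t\<bar> \<le> e * t"
    using r(2)[OF y] r'(2)[OF y] t by (simp_all only: nrm s)
  have "\<bar>p j - q j\<bar> * t = \<bar>p j * t - q j * t\<bar>"
    using t by (simp add: abs_mult flip: left_diff_distrib)
  also have "\<dots> \<le> 2 * (e * t)" using a by linarith
  finally have "\<bar>p j - q j\<bar> \<le> 2 * e" using t by simp
  then show False using e by (simp add: e_def)
qed

lemma gradient_eq: "has_gradient d f p x \<Longrightarrow> x \<in> space (Rd d) \<Longrightarrow> gradient d f x = p"
  unfolding gradient_def by (blast intro: has_gradient_unique)

definition L_smooth :: "nat \<Rightarrow> real \<Rightarrow> ((nat \<Rightarrow> real) \<Rightarrow> real) \<Rightarrow> bool" where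
  "L_smooth d L f \<longleftrightarrow>
     (\<forall>x\<in>space (Rd d). \<exists>p. has_gradient d f p x) \<and>
     (\<forall>x\<in>space (Rd d). \<forall>y\<in>space (Rd d).
        l2norm d (\<lambda>i. gradient d f x i - gradient d f y i) \<le> L * l2norm d (\<lambda>i. x i - y i))"

section \<open>Stochastic gradient oracles\<close>

text \<open>
  An oracle is a Markov kernel \<open>K\<close>: the measure \<open>K x\<close> is the law of the random answer to a query
  at \<open>x\<close>.
\<close>

definition gradient_oracle :: "nat \<Rightarrow> ((nat \<Rightarrow> real) \<Rightarrow> (nat \<Rightarrow> real) measure) \<Rightarrow> bool" where
  "gradient_oracle d K \<longleftrightarrow> K \<in> Rd d \<rightarrow>\<^sub>M prob_algebra (Rd d)"

definition unbiased_oracle ::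
    "nat \<Rightarrow> ((nat \<Rightarrow> real) \<Rightarrow> real) \<Rightarrow> ((nat \<Rightarrow> real) \<Rightarrow> (nat \<Rightarrow> real) measure) \<Rightarrow> bool" where
  "unbiased_oracle d f K \<longleftrightarrow>
     (\<forall>x\<in>space (Rd d). \<forall>i\<in>{1..d}. has_bochner_integral (K x) (\<lambda>g. g i) (gradient d f x i))"

definition affine_variance_noise ::
    "nat \<Rightarrow> ((nat \<Rightarrow> real) \<Rightarrow> real) \<Rightarrow> (nat \<Rightarrow> real) \<Rightarrow> (nat \<Rightarrow> real) \<Rightarrow>
     ((nat \<Rightarrow> real) \<Rightarrow> (nat \<Rightarrow> real) measure) \<Rightarrow> bool" where
  "affine_variance_noise d f \<sigma>0 \<sigma>1 K \<longleftrightarrow>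
     (\<forall>x\<in>space (Rd d). \<forall>i\<in>{1..d}. AE g in K x.
        (g i - gradient d f x i)\<^sup>2 \<le> (\<sigma>0 i)\<^sup>2 + (\<sigma>1 i)\<^sup>2 * (gradient d f x i)\<^sup>2)"

section \<open>Adam\<close>

text \<open>The argument \<open>g\<close> is the sequence of oracle answers; \<open>g s i\<close> is used for \<open>s \<ge> 1\<close> only.\<close>

primrec adam_m :: "real \<Rightarrow> (nat \<Rightarrow> nat \<Rightarrow> real) \<Rightarrow> nat \<Rightarrow> nat \<Rightarrow> real" where
  "adam_m \<beta>1 g 0 i = 0"
| "adam_m \<beta>1 g (Suc s) i = \<beta>1 * adam_m \<beta>1 g s i + (1 - \<beta>1) * g (Suc s) i"

primrec adam_v :: "real \<Rightarrow> (nat \<Rightarrow> nat \<Rightarrow> real) \<Rightarrow> nat \<Rightarrow> nat \<Rightarrow> real" where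
  "adam_v \<beta>2 g 0 i = 0"
| "adam_v \<beta>2 g (Suc s) i = \<beta>2 * adam_v \<beta>2 g s i + (1 - \<beta>2) * (g (Suc s) i)\<^sup>2"

definition adam_eta :: "real \<Rightarrow> real \<Rightarrow> real \<Rightarrow> nat \<Rightarrow> real" where
  "adam_eta \<eta> \<beta>1 \<beta>2 s = \<eta> * sqrt (1 - \<beta>2 ^ s) / (1 - \<beta>1 ^ s)"

definition adam_eps :: "real \<Rightarrow> real \<Rightarrow> nat \<Rightarrow> real" where
  "adam_eps \<epsilon> \<beta>2 s = \<epsilon> * sqrt (1 - \<beta>2 ^ s)"

text \<open>The iterates start at index 1; the value at index 0 is a dummy.\<close>

primrec adam_x :: "nat \<Rightarrow> real \<Rightarrow> real \<Rightarrow> real \<Rightarrow> real \<Rightarrow> (nat \<Rightarrow> real) \<Rightarrow>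
    (nat \<Rightarrow> nat \<Rightarrow> real) \<Rightarrow> nat \<Rightarrow> (nat \<Rightarrow> real)" where
  "adam_x d \<beta>1 \<beta>2 \<eta> \<epsilon> x1 g 0 = x1"
| "adam_x d \<beta>1 \<beta>2 \<eta> \<epsilon> x1 g (Suc s) =
     (if s = 0 then x1
      else (\<lambda>i\<in>{1..d}. adam_x d \<beta>1 \<beta>2 \<eta> \<epsilon> x1 g s i
              - adam_eta \<eta> \<beta>1 \<beta>2 s / (sqrt (adam_v \<beta>2 g s i) + adam_eps \<epsilon> \<beta>2 s)
                * adam_m \<beta>1 g s i))"

text \<open>
  The law of the answers \<open>g\<^sub>1, \<dots>, g\<^sub>T\<close> when each iteration makes a fresh query:
  given the first \<open>n\<close> answers, the next one has law \<open>K x\<^sub>n\<^sub>+\<^sub>1\<close>. Coordinates of the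
  Ionescu-Tulcea construction are numbered from 0, so a sample point \<open>\<omega>\<close> holds the
  answer \<open>g\<^sub>s\<close> in \<open>\<omega> (s - 1)\<close>. All random quantities in a run are functions of these answers,
  and the law does not refer to any ambient probability space.
\<close>

definition answers :: "(nat \<Rightarrow> nat \<Rightarrow> real) \<Rightarrow> nat \<Rightarrow> nat \<Rightarrow> real" where
  "answers \<omega> s = \<omega> (s - 1)"

definition adam_kernel :: "nat \<Rightarrow> real \<Rightarrow> real \<Rightarrow> real \<Rightarrow> real \<Rightarrow> (nat \<Rightarrow> real) \<Rightarrow>
    ((nat \<Rightarrow> real) \<Rightarrow> (nat \<Rightarrow> real) measure) \<Rightarrow>
    nat \<Rightarrow> (nat \<Rightarrow> nat \<Rightarrow> real) \<Rightarrow> (nat \<Rightarrow> real) measure" where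
  "adam_kernel d \<beta>1 \<beta>2 \<eta> \<epsilon> x1 K n \<omega> = K (adam_x d \<beta>1 \<beta>2 \<eta> \<epsilon> x1 (answers \<omega>) (Suc n))"

definition adam_law :: "nat \<Rightarrow> real \<Rightarrow> real \<Rightarrow> real \<Rightarrow> real \<Rightarrow> (nat \<Rightarrow> real) \<Rightarrow>
    ((nat \<Rightarrow> real) \<Rightarrow> (nat \<Rightarrow> real) measure) \<Rightarrow> nat \<Rightarrow> (nat \<Rightarrow> nat \<Rightarrow> real) measure" where
  "adam_law d \<beta>1 \<beta>2 \<eta> \<epsilon> x1 K T =
     Ionescu_Tulcea.C (adam_kernel d \<beta>1 \<beta>2 \<eta> \<epsilon> x1 K) (\<lambda>_. Rd d) 0 T (\<lambda>_. undefined)"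

lemma adam_x_in_space: "x1 \<in> space (Rd d) \<Longrightarrow> adam_x d \<beta>1 \<beta>2 \<eta> \<epsilon> x1 g s \<in> space (Rd d)"
  by (cases s) (auto simp: space_Rd)

lemma measurable_answers:
  assumes "s \<in> {1..n}" "i \<in> {1..d}"
  shows "(\<lambda>\<omega>. answers \<omega> s i) \<in> borel_measurable (PiM {0..<n} (\<lambda>_. Rd d))"
proof -
  have "(\<lambda>\<omega>. \<omega> (s - 1)) \<in> PiM {0..<n} (\<lambda>_. Rd d) \<rightarrow>\<^sub>M Rd d"
    by (rule measurable_component_singleton) (use assms in auto)
  moreover have "(\<lambda>v. v i) \<in> Rd d \<rightarrow>\<^sub>M (borel :: real measure)"
    unfolding Rd_def by (rule measurable_component_singleton) (use assms in auto)
  ultimately show ?thesis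
    unfolding answers_def by (rule measurable_compose)
qed

lemma measurable_adam_m:
  assumes "s \<le> n" "i \<in> {1..d}"
  shows "(\<lambda>\<omega>. adam_m \<beta>1 (answers \<omega>) s i) \<in> borel_measurable (PiM {0..<n} (\<lambda>_. Rd d))"
  using assms(1)
proof (induction s)
  case (Suc s)
  then show ?case using measurable_answers[of "Suc s" n i d] assms(2) by simp
qed simp

lemma measurable_adam_v:
  assumes "s \<le> n" "i \<in> {1..d}"
  shows "(\<lambda>\<omega>. adam_v \<beta>2 (answers \<omega>) s i) \<in> borel_measurable (PiM {0..<n} (\<lambda>_. Rd d))"
  using assms(1)
proof (induction s)
  case (Suc s)
  then show ?case using measurable_answers[of "Suc s" n i d] assms(2) by simp
qed simp

lemma measurable_adam_x:
  assumes "s \<le> Suc n" and x1: "x1 \<in> space (Rd d)"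
  shows "(\<lambda>\<omega>. adam_x d \<beta>1 \<beta>2 \<eta> \<epsilon> x1 (answers \<omega>) s) \<in> PiM {0..<n} (\<lambda>_. Rd d) \<rightarrow>\<^sub>M Rd d"
  using assms(1)
proof (induction s)
  case 0
  then show ?case using x1 by simp
next
  case (Suc s)
  show ?case
  proof (cases "s = 0")
    case True
    then show ?thesis using x1 by simp
  next
    case False
    have IH: "(\<lambda>\<omega>. adam_x d \<beta>1 \<beta>2 \<eta> \<epsilon> x1 (answers \<omega>) s i)
        \<in> borel_measurable (PiM {0..<n} (\<lambda>_. Rd d))" if "i \<in> {1..d}" for i
    proof -
      have "(\<lambda>v. v i) \<in> Rd d \<rightarrow>\<^sub>M (borel :: real measure)"
        unfolding Rd_def by (rule measurable_component_singleton) (use that in auto)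
      with Suc show ?thesis by (auto intro: measurable_compose)
    qed
    have "(\<lambda>\<omega>. \<lambda>i\<in>{1..d}. adam_x d \<beta>1 \<beta>2 \<eta> \<epsilon> x1 (answers \<omega>) s i
              - adam_eta \<eta> \<beta>1 \<beta>2 s / (sqrt (adam_v \<beta>2 (answers \<omega>) s i) + adam_eps \<epsilon> \<beta>2 s)
                * adam_m \<beta>1 (answers \<omega>) s i) \<in> PiM {0..<n} (\<lambda>_. Rd d) \<rightarrow>\<^sub>M PiM {1..d} (\<lambda>_. borel)"
    proof (rule measurable_restrict)
      fix i assume i: "i \<in> {1..d}"
      have [measurable]:
        "(\<lambda>\<omega>. adam_x d \<beta>1 \<beta>2 \<eta> \<epsilon> x1 (answers \<omega>) s i) \<in> borel_measurable (PiM {0..<n} (\<lambda>_. Rd d))"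
        "(\<lambda>\<omega>. adam_v \<beta>2 (answers \<omega>) s i) \<in> borel_measurable (PiM {0..<n} (\<lambda>_. Rd d))"
        "(\<lambda>\<omega>. adam_m \<beta>1 (answers \<omega>) s i) \<in> borel_measurable (PiM {0..<n} (\<lambda>_. Rd d))"
        using IH i Suc.prems measurable_adam_v measurable_adam_m by auto
      show "(\<lambda>\<omega>. adam_x d \<beta>1 \<beta>2 \<eta> \<epsilon> x1 (answers \<omega>) s i
              - adam_eta \<eta> \<beta>1 \<beta>2 s / (sqrt (adam_v \<beta>2 (answers \<omega>) s i) + adam_eps \<epsilon> \<beta>2 s)
                * adam_m \<beta>1 (answers \<omega>) s i) \<in> borel_measurable (PiM {0..<n} (\<lambda>_. Rd d))"
        by measurable
    qed
    then show ?thesis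
      using False unfolding adam_x.simps(2) by (simp only: if_False Rd_def)
  qed
qed

lemma Ionescu_Tulcea_adam_kernel:
  assumes K: "gradient_oracle d K" and x1: "x1 \<in> space (Rd d)"
  shows "Ionescu_Tulcea (adam_kernel d \<beta>1 \<beta>2 \<eta> \<epsilon> x1 K) (\<lambda>_. Rd d)"
proof (rule Ionescu_Tulcea.intro)
  fix n
  show "adam_kernel d \<beta>1 \<beta>2 \<eta> \<epsilon> x1 K n
      \<in> PiM {0..<n} (\<lambda>_. Rd d) \<rightarrow>\<^sub>M subprob_algebra (Rd d)"
    using measurable_compose[OF measurable_adam_x[OF le_refl x1]
        measurable_prob_algebraD[OF K[unfolded gradient_oracle_def]]]
    unfolding adam_kernel_def by blast
next
  fix n \<omega>
  show "prob_space (adam_kernel d \<beta>1 \<beta>2 \<eta> \<epsilon> x1 K n \<omega>)"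
    using measurable_space[OF K[unfolded gradient_oracle_def] adam_x_in_space[OF x1]]
    unfolding adam_kernel_def space_prob_algebra by blast
qed

lemma prob_space_adam_law:
  assumes "gradient_oracle d K" and "x1 \<in> space (Rd d)"
  shows "prob_space (adam_law d \<beta>1 \<beta>2 \<eta> \<epsilon> x1 K T)"
    and "sets (adam_law d \<beta>1 \<beta>2 \<eta> \<epsilon> x1 K T) = sets (PiM {0..<T} (\<lambda>_. Rd d))"
proof -
  interpret Ionescu_Tulcea "adam_kernel d \<beta>1 \<beta>2 \<eta> \<epsilon> x1 K" "\<lambda>_. Rd d"
    using assms by (rule Ionescu_Tulcea_adam_kernel)
  show "prob_space (adam_law d \<beta>1 \<beta>2 \<eta> \<epsilon> x1 K T)"
    unfolding adam_law_def by (rule prob_space_C) (simp add: space_PiM)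
  show "sets (adam_law d \<beta>1 \<beta>2 \<eta> \<epsilon> x1 K T) = sets (PiM {0..<T} (\<lambda>_. Rd d))"
    unfolding adam_law_def using sets_C[of "\<lambda>_. undefined" 0 T] by (simp add: space_PiM)
qed

section \<open>The explicit quantities of the bound\<close>

definition Sigma_max :: "real \<Rightarrow> real" where
  "Sigma_max \<beta>2 = max 1 (sqrt ((1 + \<beta>2) / \<beta>2) - 1)"

text \<open>
  In the next two definitions \<open>s0\<close> and \<open>s1\<close> stand for the maximum norms of the two noise
  vectors, \<open>g1\<close> for the norm of the gradient at the initial point, \<open>\<Delta>\<close> for the initial
  gap \<open>f x\<^sub>1 - f\<^sup>*\<close>, and \<open>F\<close> for the value of \<open>adam_F\<close>.
\<close>

definition adam_F :: "nat \<Rightarrow> nat \<Rightarrow> real \<Rightarrow> real \<Rightarrow> real \<Rightarrow> real \<Rightarrow> real \<Rightarrow> real \<Rightarrow> real \<Rightarrow> real \<Rightarrow> real" where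
  "adam_F d T L C0 \<epsilon> \<beta>1 \<beta>2 s0 s1 g1 =
     1 + 2 / \<epsilon>\<^sup>2 * ((s0\<^sup>2 + 2 * (1 + s1\<^sup>2) * g1\<^sup>2) * real T
       + 2 * (1 + s1\<^sup>2) * real d * L\<^sup>2 * C0\<^sup>2 / (1 - \<beta>1 / \<beta>2) * real T ^ 3)"

definition adam_G :: "nat \<Rightarrow> nat \<Rightarrow> real \<Rightarrow> real \<Rightarrow> real \<Rightarrow> real \<Rightarrow> real \<Rightarrow> real \<Rightarrow> real \<Rightarrow> real \<Rightarrow> real \<Rightarrow> real
    \<Rightarrow> real" where
  "adam_G d T L C0 \<epsilon>0 \<beta>1 \<beta>2 s0 s1 \<Delta> F \<delta> =
     8 * L * \<Delta>
     + 256 * L\<^sup>2 * C0\<^sup>2 * \<beta>1\<^sup>2 * (real d)\<^sup>2 / ((1 - \<beta>1) ^ 3 * (1 - \<beta>1 / \<beta>2))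
     + 4 * L\<^sup>2 * C0\<^sup>2 * \<beta>1\<^sup>2 * real d / ((1 - \<beta>1)\<^sup>2 * (1 - \<beta>1 / \<beta>2))
     + 48 * L * C0 * s0 / (1 - \<beta>1) * real d * ln (real d * real T / \<delta>)
     + 8 * L * C0 * \<beta>1\<^sup>2 / ((1 - \<beta>1)\<^sup>2 * (1 - \<beta>1 / \<beta>2))
       * (4 * s0 / \<beta>2 + (\<epsilon>0 + sqrt 2 * s0) / sqrt \<beta>2 + L * C0 / 2 * (1 + 4 * (Sigma_max \<beta>2)\<^sup>2))
       * real d * ln (F / \<beta>2 ^ T)
     + 8 * (3 * L\<^sup>2 * C0\<^sup>2 / (1 - \<beta>1)\<^sup>2 + 8 * L * s0 * C0 / (1 - \<beta>1))
       * real d * ln (F / \<beta>2 ^ T)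
     + 2304 * L\<^sup>2 * C0\<^sup>2 * s1\<^sup>2 / (1 - \<beta>1)\<^sup>2 * (real d)\<^sup>2 * (ln (real d * real T / \<delta>))\<^sup>2
     + 256 * (16 * L\<^sup>2 * C0\<^sup>2 * s1\<^sup>2 / (1 - \<beta>1)\<^sup>2
              + 9 * L\<^sup>2 * C0\<^sup>2 * \<beta>1 ^ 4 * (1 + s1\<^sup>2)
                / (\<beta>2\<^sup>2 * (1 - \<beta>1) ^ 4 * (1 - \<beta>1 / \<beta>2)\<^sup>2))
       * (real d)\<^sup>2 * (ln (F / \<beta>2 ^ T))\<^sup>2"

end

theory Submission
  imports Defs
begin

text \<open>
  Write \<open>\<kappa> = \<beta>1 / (1 - \<beta>1)\<close>, and let \<open>h\<close>, \<open>b\<close>, \<open>m\<close> be the step size, the denominator and the momentum.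
  The proof follows the value of \<open>f\<close> along the look-ahead points \<open>y\<^sub>s = x\<^sub>s + \<kappa> (x\<^sub>s - x\<^sub>s\<^sub>-\<^sub>1)\<close>. There the momentum
  cancels up to a small error: \<open>y\<^sub>s\<^sub>+\<^sub>1 - y\<^sub>s\<close> is \<open>- h g / b\<close> for the fresh answer \<open>g\<close>, plus a multiple of \<open>m\<close>
  whose coefficient is only the change of the quotient \<open>h / b\<close> (\<open>lookahead_Suc_diff\<close>). Smoothness turns this
  into a descent inequality (\<open>lookahead_descent\<close>).

  The denominator \<open>b\<close> depends on the fresh answer, so the product of the gradient with \<open>g / b\<close> has no
  usable conditional mean. Let \<open>W\<close> be the size that the noise can have at the current point. In
  \<open>b\<close>, the square of the answer is replaced by the square of the gradient plus \<open>W\<^sup>2\<close>. The resulting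
  proxy \<open>a\<close> is known before the query, and \<open>\<bar>a - b\<bar> \<le> 2 sqrt (1 - \<beta>2) W\<close> (\<open>proxy_near_denom\<close>).
  Young's inequality charges the exchange of \<open>b\<close> for \<open>a\<close> partly to the
  descent terms \<open>h \<parallel>\<nabla>f\<parallel>\<^sup>2 / a\<close>, and partly to sums of \<open>(1 - \<beta>2) g\<^sup>2 / b\<^sup>2\<close> and of
  its analogue for the momentum. These sums are logarithmic, because \<open>b\<^sup>2\<close> accumulates
  the very squares in the numerators (\<open>sum_grad_ratio_le\<close>, \<open>sum_mom_ratio_le\<close>).

  The coefficients in these estimates depend on a bound \<open>D\<close> for the squared gradient norms, but they
  grow only like \<open>sqrt D\<close>. Conversely, a bound for the value of \<open>f\<close> at the look-ahead point bounds
  the next gradient. With \<open>D = 16 G\<close> the circle closes: if all gradients so far are below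
  the level \<open>D\<close>, then so is the next one (\<open>excess_closes\<close>, \<open>gradients_stay_below\<close>). Then the
  descent terms add up to at most a multiple of \<open>G / L\<close>, and dividing by the smallest possible
  weight \<open>h / a\<close> gives the bound (\<open>gradient_sum_le\<close>). The factor 16 goes into the constant \<open>C\<close>.

  Probability enters only through the sum of the noise terms, which is a martingale with predictably bounded
  increments \<open>X\<^sub>s\<close>, \<open>\<bar>X\<^sub>s\<bar> \<le> R\<^sub>s\<close>. By Hoeffding's lemma, \<open>exp (\<Sum> \<lambda> X\<^sub>s - \<lambda>\<^sup>2 R\<^sub>s\<^sup>2 / 2)\<close> has mean at most 1, and Markov's
  inequality bounds \<open>\<Sum> X\<^sub>s\<close> with probability \<open>1 - \<delta>\<close> (\<open>prob_good_runs\<close>, \<open>good_run\<close>). The sum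
  of the \<open>R\<^sub>s\<^sup>2\<close> is again charged to the descent terms (\<open>sum_noise_le\<close>). The martingale is stopped when a gradient
  exceeds the level \<open>D\<close>. Therefore one event at the final time suffices for the whole induction.
\<close>

section \<open>Exponential averages\<close>

text \<open>
  The square roots are the Euclidean norms of the vectors with entries \<open>sqrt A\<close>, \<open>x\<close>, \<open>0\<close> and
  \<open>sqrt A\<close>, \<open>y\<close>, \<open>w\<close>, so this is the triangle inequality.
\<close>

lemma abs_sqrt_diff_le:
  fixes A x y w :: real
  assumes "0 \<le> A" "\<bar>x - y\<bar> \<le> w"
  shows "\<bar>sqrt (A + x\<^sup>2) - sqrt (A + (y\<^sup>2 + w\<^sup>2))\<bar> \<le> 2 * w"
proof -
  have tri: "sqrt (A + u\<^sup>2) \<le> sqrt (A + v\<^sup>2) + \<bar>u - v\<bar>" if "0 \<le> A" for A u v :: real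
    using real_sqrt_sum_squares_triangle_ineq[of "sqrt A" 0 v "u - v"] that by simp
  have 1: "sqrt (A + x\<^sup>2) \<le> sqrt (A + y\<^sup>2) + w"
    using tri[OF assms(1), of x y] assms(2) by linarith
  have 2: "sqrt (A + y\<^sup>2) \<le> sqrt (A + x\<^sup>2) + w"
    using tri[OF assms(1), of y x] assms(2) by linarith
  have 3: "sqrt (A + y\<^sup>2) \<le> sqrt (A + (y\<^sup>2 + w\<^sup>2))" by simp
  have 4: "sqrt (A + (y\<^sup>2 + w\<^sup>2)) \<le> sqrt (A + y\<^sup>2) + w"
    using tri[of "A + y\<^sup>2" w 0] assms by (simp add: add.assoc)
  show ?thesis using 1 2 3 4 assms(2) by linarith
qed

lemma adam_v_nonneg: "0 \<le> \<beta> \<Longrightarrow> \<beta> < 1 \<Longrightarrow> 0 \<le> adam_v \<beta> g s i"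
  by (induction s) auto

lemma adam_v_le:
  assumes "0 \<le> \<beta>" "\<beta> < 1" "\<And>j. j \<in> {1..s} \<Longrightarrow> (g j i)\<^sup>2 \<le> B"
  shows "adam_v \<beta> g s i \<le> (1 - \<beta> ^ s) * B"
  using assms(3)
proof (induction s)
  case (Suc s)
  have "adam_v \<beta> g (Suc s) i \<le> \<beta> * ((1 - \<beta> ^ s) * B) + (1 - \<beta>) * B"
    using Suc assms by (auto intro!: add_mono mult_left_mono)
  then show ?case by (simp add: algebra_simps)
qed simp

text \<open>
  Jensen's inequality: the momentum averages the answers with total weight \<open>1 - \<beta> ^ s\<close>, and the
  average of their squares with the same weights satisfies the recursion of \<open>adam_v\<close> with
  decay \<open>\<beta>\<close>. The right-hand side therefore uses \<open>adam_v\<close> at the decay rate of the momentum.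
\<close>

lemma adam_m_sq_le:
  assumes "0 \<le> \<beta>" "\<beta> < 1"
  shows "(adam_m \<beta> g s i)\<^sup>2 \<le> (1 - \<beta> ^ s) * adam_v \<beta> g s i"
proof (induction s)
  case (Suc s)
  define m v u p where "m = adam_m \<beta> g s i" and "v = adam_v \<beta> g s i" and "u = g (Suc s) i"
    and "p = 1 - \<beta> ^ s"
  have p: "0 \<le> p" using assms by (simp add: p_def power_le_one)
  have v: "0 \<le> v" unfolding v_def by (rule adam_v_nonneg[OF assms])
  have m: "m\<^sup>2 \<le> p * v" using Suc by (simp add: m_def p_def v_def)
  have cross: "2 * m * u \<le> v + p * u\<^sup>2"
  proof (cases "p = 0")
    case True then show ?thesis using m v by simp
  next
    case False
    then have pp: "p > 0" using p by simp
    have "p * (2 * m * u) \<le> m\<^sup>2 + (p * u)\<^sup>2"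
      using sum_squares_bound[of m "p * u"] by (simp add: mult_ac)
    also have "\<dots> \<le> p * (v + p * u\<^sup>2)" using m by (simp add: algebra_simps power2_eq_square)
    finally show ?thesis using pp by simp
  qed
  have "(\<beta> * m + (1 - \<beta>) * u)\<^sup>2 = \<beta>\<^sup>2 * m\<^sup>2 + \<beta> * (1 - \<beta>) * (2 * m * u) + (1 - \<beta>)\<^sup>2 * u\<^sup>2"
    by (simp add: power2_eq_square algebra_simps)
  also have "\<dots> \<le> \<beta>\<^sup>2 * (p * v) + \<beta> * (1 - \<beta>) * (v + p * u\<^sup>2) + (1 - \<beta>)\<^sup>2 * u\<^sup>2"
    using m cross assms by (intro add_mono mult_left_mono) auto
  also have "\<dots> = (\<beta> * p + (1 - \<beta>)) * (\<beta> * v + (1 - \<beta>) * u\<^sup>2)"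
    by (simp add: power2_eq_square algebra_simps)
  also have "\<beta> * p + (1 - \<beta>) = 1 - \<beta> ^ Suc s" by (simp add: p_def algebra_simps)
  finally show ?case by (simp add: m_def v_def u_def)
qed simp

section \<open>Step sizes and denominators\<close>

locale adam_parameters =
  fixes \<beta>1 \<beta>2 C0 \<epsilon>0 :: real
  assumes beta1: "0 \<le> \<beta>1" and beta12: "\<beta>1 < \<beta>2" and beta2: "\<beta>2 < 1"
    and C0: "0 < C0" and eps0: "0 < \<epsilon>0"
begin

abbreviation "\<eta> \<equiv> C0 * sqrt (1 - \<beta>2)"
abbreviation "\<epsilon> \<equiv> \<epsilon>0 * sqrt (1 - \<beta>2)"
abbreviation "\<rho> \<equiv> \<beta>1 / \<beta>2"

definition stepsize :: "nat \<Rightarrow> real" where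
  "stepsize s = adam_eta \<eta> \<beta>1 \<beta>2 s"

definition denom :: "(nat \<Rightarrow> nat \<Rightarrow> real) \<Rightarrow> nat \<Rightarrow> nat \<Rightarrow> real" where
  "denom g s i = sqrt (adam_v \<beta>2 g s i) + adam_eps \<epsilon> \<beta>2 s"

text \<open>
  All error terms are reduced to the next two quantities. In \<open>mom_ratio\<close>, the mean of squares with
  decay \<open>\<beta>1\<close> stands for the squared momentum that it dominates.
\<close>

definition grad_ratio :: "(nat \<Rightarrow> nat \<Rightarrow> real) \<Rightarrow> nat \<Rightarrow> nat \<Rightarrow> real" where
  "grad_ratio g s i = (1 - \<beta>2) * (g s i)\<^sup>2 / (denom g s i)\<^sup>2"

definition mom_ratio :: "(nat \<Rightarrow> nat \<Rightarrow> real) \<Rightarrow> nat \<Rightarrow> nat \<Rightarrow> real" where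
  "mom_ratio g s i = (1 - \<beta>2) * adam_v \<beta>1 g s i / (denom g s i)\<^sup>2"

lemma beta2_pos: "0 < \<beta>2" and beta1_less_1: "\<beta>1 < 1"
  using beta1 beta12 beta2 by auto

lemma rho: "0 \<le> \<rho>" "\<rho> < 1"
  using beta1 beta12 beta2_pos by (auto simp: field_simps)

lemma eta_pos: "0 < \<eta>" and eps_pos: "0 < \<epsilon>"
  using C0 eps0 beta2 by auto

lemma pow_less_1: "\<beta>1 ^ Suc s < 1" "\<beta>2 ^ Suc s < 1"
  using beta1 beta1_less_1 beta2_pos beta2 power_less_one_iff[of \<beta>1 "Suc s"] power_less_one_iff[of \<beta>2 "Suc s"]
  by (auto simp del: power_Suc)

lemma pow_bounds: "0 \<le> \<beta>1 ^ s" "\<beta>1 ^ s \<le> 1" "0 \<le> \<beta>2 ^ s" "\<beta>2 ^ s \<le> 1"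
  using beta1 beta1_less_1 beta2_pos beta2 by (auto intro: power_le_one)

lemma stepsize_0 [simp]: "stepsize 0 = 0"
  by (simp add: stepsize_def adam_eta_def)

lemma stepsize_pos: "0 < stepsize (Suc s)"
  using pow_less_1[of s] C0 beta2 unfolding stepsize_def adam_eta_def
  by (intro divide_pos_pos mult_pos_pos) (auto simp del: power_Suc)

lemma stepsize_nonneg: "0 \<le> stepsize s"
  using stepsize_pos by (cases s) (auto intro: less_imp_le)

lemma stepsize_le_pow: "stepsize s * (1 - \<beta>1 ^ s) \<le> \<eta>"
proof (cases s)
  case (Suc n)
  then have "stepsize s * (1 - \<beta>1 ^ s) = \<eta> * sqrt (1 - \<beta>2 ^ s)"
    using pow_less_1[of n] by (simp add: stepsize_def adam_eta_def)
  also have "\<dots> \<le> \<eta> * 1"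
    using pow_bounds[of s] eta_pos by (intro mult_left_mono) auto
  finally show ?thesis by simp
qed (use eta_pos in simp)

lemma stepsize_le: "stepsize s \<le> \<eta> / (1 - \<beta>1)"
proof (cases s)
  case (Suc n)
  have "stepsize s * (1 - \<beta>1) \<le> stepsize s * (1 - \<beta>1 ^ s)"
    using stepsize_nonneg[of s] beta1 beta1_less_1 power_decreasing[of 1 s \<beta>1] Suc
    by (intro mult_left_mono) auto
  then have "stepsize s * (1 - \<beta>1) \<le> \<eta>" using stepsize_le_pow[of s] by linarith
  then show ?thesis using beta1_less_1 by (simp add: pos_le_divide_eq)
qed (use eta_pos beta1_less_1 in simp)

lemma stepsize_ge: "\<eta> * sqrt (1 - \<beta>2 ^ s) \<le> stepsize s"
proof (cases s)
  case (Suc n)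
  have "1 * (\<eta> * sqrt (1 - \<beta>2 ^ s)) \<le> (1 / (1 - \<beta>1 ^ s)) * (\<eta> * sqrt (1 - \<beta>2 ^ s))"
    using pow_less_1[of n] pow_bounds[of s] Suc C0 beta2
    by (intro mult_right_mono) (auto simp: field_simps)
  then show ?thesis by (simp add: stepsize_def adam_eta_def)
qed simp

lemma adam_eps_bounds: "0 \<le> adam_eps \<epsilon> \<beta>2 s" "adam_eps \<epsilon> \<beta>2 s \<le> \<epsilon>"
proof -
  show "0 \<le> adam_eps \<epsilon> \<beta>2 s" using eps_pos pow_bounds[of s] by (simp add: adam_eps_def)
  have "\<epsilon> * sqrt (1 - \<beta>2 ^ s) \<le> \<epsilon> * 1"
    using eps_pos pow_bounds[of s] by (intro mult_left_mono) auto
  then show "adam_eps \<epsilon> \<beta>2 s \<le> \<epsilon>" by (simp add: adam_eps_def)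
qed

lemma adam_eps_pos: "0 < adam_eps \<epsilon> \<beta>2 (Suc s)"
  using eps0 beta2 pow_less_1[of s] unfolding adam_eps_def
  by (intro mult_pos_pos) (auto simp del: power_Suc)

lemma adam_eps_mono: "adam_eps \<epsilon> \<beta>2 s \<le> adam_eps \<epsilon> \<beta>2 (Suc s)"
  using eps_pos beta2 beta2_pos power_decreasing[of s "Suc s" \<beta>2] unfolding adam_eps_def
  by (intro mult_left_mono) auto

lemma v_nonneg: "0 \<le> adam_v \<beta>2 g s i" and q_nonneg: "0 \<le> adam_v \<beta>1 g s i"
  using adam_v_nonneg beta1 beta1_less_1 beta2 beta2_pos by auto

lemma denom_pos: "0 < denom g (Suc s) i"
  unfolding denom_def using adam_eps_pos[of s] v_nonneg[of g "Suc s" i]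
  by (metis add.commute add_pos_nonneg real_sqrt_ge_zero)

lemma denom_nonneg: "0 \<le> denom g s i"
  unfolding denom_def using adam_eps_bounds[of s] v_nonneg[of g s i] by simp

lemma denom_decay: "sqrt \<beta>2 * denom g s i \<le> denom g (Suc s) i"
proof -
  have "sqrt \<beta>2 * sqrt (adam_v \<beta>2 g s i) \<le> sqrt (adam_v \<beta>2 g (Suc s) i)"
    using beta2 by (simp flip: real_sqrt_mult)
  moreover have "sqrt \<beta>2 * adam_eps \<epsilon> \<beta>2 s \<le> 1 * adam_eps \<epsilon> \<beta>2 s"
    using adam_eps_bounds[of s] beta2 beta2_pos by (intro mult_right_mono) auto
  ultimately show ?thesis using adam_eps_mono[of s] by (simp add: denom_def algebra_simps)
qed

lemma denom_sq_decay: "\<beta>2 * (denom g s i)\<^sup>2 \<le> (denom g (Suc s) i)\<^sup>2"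
  using power_mono[OF denom_decay[of g s i], of 2] beta2_pos denom_nonneg[of g s i]
  by (simp add: power_mult_distrib)

text \<open>
  From the first step on, the bias correction of \<open>\<epsilon>\<close> is at least \<open>sqrt (1 - \<beta>2)\<close>. Hence both summands of the denominator
  contain this factor, and it cancels in \<open>grad_ratio\<close>.
\<close>

lemma denom_sq_ge:
  "(1 - \<beta>2) * (adam_v \<beta>2 g (Suc s) i / (1 - \<beta>2) + \<epsilon>\<^sup>2) \<le> (denom g (Suc s) i)\<^sup>2"
proof -
  have "\<beta>2 ^ Suc s \<le> \<beta>2" using beta2 beta2_pos power_decreasing[of 1 "Suc s" \<beta>2] by simp
  then have e: "\<epsilon>\<^sup>2 * (1 - \<beta>2) \<le> (adam_eps \<epsilon> \<beta>2 (Suc s))\<^sup>2"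
    unfolding adam_eps_def power_mult_distrib[of _ "sqrt (1 - \<beta>2 ^ Suc s)"]
    using pow_bounds[of "Suc s"] by (intro mult_left_mono) auto
  have "adam_v \<beta>2 g (Suc s) i + (adam_eps \<epsilon> \<beta>2 (Suc s))\<^sup>2 \<le> (denom g (Suc s) i)\<^sup>2"
    unfolding denom_def power2_sum using v_nonneg[of g "Suc s" i] adam_eps_bounds[of "Suc s"]
    by (simp del: adam_v.simps)
  moreover have "(1 - \<beta>2) * (adam_v \<beta>2 g (Suc s) i / (1 - \<beta>2)) = adam_v \<beta>2 g (Suc s) i"
    using beta2 by (simp del: adam_v.simps)
  ultimately show ?thesis using e by (simp only: distrib_left mult.commute[of "\<epsilon>\<^sup>2"])
qed

lemma grad_ratio_nonneg: "0 \<le> grad_ratio g s i" and mom_ratio_nonneg: "0 \<le> mom_ratio g s i"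
  using q_nonneg[of g s i] beta2 by (auto simp: grad_ratio_def mom_ratio_def)

text \<open>
  The numerator decays at rate \<open>\<beta>1\<close> and the squared denominator at most at rate \<open>\<beta>2\<close>, so the
  quotient contracts at rate \<open>\<rho>\<close> and is fed by the fresh answers only.
\<close>

lemma mom_ratio_Suc: "mom_ratio g (Suc s) i \<le> \<rho> * mom_ratio g s i + (1 - \<beta>1) * grad_ratio g (Suc s) i"
proof -
  let ?q = "adam_v \<beta>1 g s i" and ?b = "denom g s i" and ?b' = "denom g (Suc s) i"
  have "\<beta>1 * ?q / ?b'\<^sup>2 \<le> \<rho> * (?q / ?b\<^sup>2)"
  proof (cases s)
    case (Suc n)
    have b: "0 < ?b" unfolding Suc by (rule denom_pos)
    have "\<beta>1 * ?q / ?b'\<^sup>2 \<le> \<beta>1 * ?q / (\<beta>2 * ?b\<^sup>2)"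
      using denom_sq_decay[of g s i] b beta2_pos beta1 q_nonneg[of g s i] denom_pos[of g s i]
      by (intro divide_left_mono mult_pos_pos zero_less_power) auto
    then show ?thesis by simp
  qed simp
  then have "(1 - \<beta>2) * (\<beta>1 * ?q / ?b'\<^sup>2) \<le> (1 - \<beta>2) * (\<rho> * (?q / ?b\<^sup>2))"
    using beta2 by (intro mult_left_mono) auto
  moreover have "mom_ratio g (Suc s) i
      = (1 - \<beta>2) * (\<beta>1 * ?q / ?b'\<^sup>2) + (1 - \<beta>1) * grad_ratio g (Suc s) i"
    by (simp add: mom_ratio_def grad_ratio_def add_divide_distrib distrib_left mult_ac)
  moreover have "(1 - \<beta>2) * (\<rho> * (?q / ?b\<^sup>2)) = \<rho> * mom_ratio g s i"
    by (simp add: mom_ratio_def mult_ac)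
  ultimately show ?thesis by linarith
qed

lemma sum_mom_ratio_le:
  "(\<Sum>s\<le>t. mom_ratio g s i) \<le> (1 - \<beta>1) / (1 - \<rho>) * (\<Sum>s<t. grad_ratio g (Suc s) i)"
proof -
  have "(\<Sum>s\<le>t. mom_ratio g s i) = mom_ratio g 0 i + (\<Sum>s<t. mom_ratio g (Suc s) i)"
    by (simp add: sum.atMost_shift)
  also have "\<dots> \<le> 0 + (\<Sum>s<t. \<rho> * mom_ratio g s i + (1 - \<beta>1) * grad_ratio g (Suc s) i)"
    by (intro add_mono sum_mono mom_ratio_Suc) (simp add: mom_ratio_def)
  also have "\<dots> = \<rho> * (\<Sum>s<t. mom_ratio g s i) + (1 - \<beta>1) * (\<Sum>s<t. grad_ratio g (Suc s) i)"
    by (simp add: sum.distrib sum_distrib_left)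
  also have "\<rho> * (\<Sum>s<t. mom_ratio g s i) \<le> \<rho> * (\<Sum>s\<le>t. mom_ratio g s i)"
    using rho mom_ratio_nonneg by (intro mult_left_mono sum_mono2) auto
  finally have "(1 - \<rho>) * (\<Sum>s\<le>t. mom_ratio g s i) \<le> (1 - \<beta>1) * (\<Sum>s<t. grad_ratio g (Suc s) i)"
    by (simp add: algebra_simps)
  then show ?thesis using rho by (simp add: field_simps)
qed

text \<open>
  Let \<open>w s\<close> be \<open>adam_v\<close> without the factor \<open>1 - \<beta>2\<close>. Each ratio is at most the relative
  increase of \<open>w + \<epsilon>\<^sup>2\<close> beyond its decay by \<open>\<beta>2\<close>, hence at most a difference of logarithms. These
  telescope, and each step contributes \<open>- ln \<beta>2\<close> for the decay.
\<close>

lemma sum_grad_ratio_le: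
  "(\<Sum>s<t. grad_ratio g (Suc s) i) \<le> ln ((1 + (\<Sum>s<t. (g (Suc s) i)\<^sup>2) / \<epsilon>\<^sup>2) / \<beta>2 ^ t)"
proof -
  define w where "w s = adam_v \<beta>2 g s i / (1 - \<beta>2)" for s
  have w0: "w 0 = 0" and wS: "w (Suc s) = \<beta>2 * w s + (g (Suc s) i)\<^sup>2" for s
    using beta2 by (simp_all add: w_def field_simps)
  have wn: "0 \<le> w s" for s using v_nonneg beta2 by (simp add: w_def)
  have e2: "0 < \<epsilon>\<^sup>2" using eps_pos by (intro zero_less_power)
  have pos: "0 < w s + \<epsilon>\<^sup>2" for s using wn[of s] e2 by linarith
  have step: "grad_ratio g (Suc s) i \<le> ln (w (Suc s) + \<epsilon>\<^sup>2) - ln (w s + \<epsilon>\<^sup>2) - ln \<beta>2" for s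
  proof -
    have "grad_ratio g (Suc s) i \<le> (1 - \<beta>2) * (g (Suc s) i)\<^sup>2 / ((1 - \<beta>2) * (w (Suc s) + \<epsilon>\<^sup>2))"
      unfolding grad_ratio_def using denom_sq_ge[of g s i] pos[of "Suc s"] beta2
      by (intro divide_left_mono mult_pos_pos zero_less_power denom_pos)
         (auto simp: w_def simp del: adam_v.simps)
    also have "\<dots> = (g (Suc s) i)\<^sup>2 / (w (Suc s) + \<epsilon>\<^sup>2)" using beta2 by simp
    also have "\<dots> \<le> 1 - \<beta>2 * (w s + \<epsilon>\<^sup>2) / (w (Suc s) + \<epsilon>\<^sup>2)"
    proof -
      have "(g (Suc s) i)\<^sup>2 \<le> (w (Suc s) + \<epsilon>\<^sup>2) - \<beta>2 * (w s + \<epsilon>\<^sup>2)"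
        using beta2 e2 mult_right_mono[of \<beta>2 1 "\<epsilon>\<^sup>2"] by (simp add: wS algebra_simps)
      then have "(g (Suc s) i)\<^sup>2 / (w (Suc s) + \<epsilon>\<^sup>2)
          \<le> ((w (Suc s) + \<epsilon>\<^sup>2) - \<beta>2 * (w s + \<epsilon>\<^sup>2)) / (w (Suc s) + \<epsilon>\<^sup>2)"
        using pos[of "Suc s"] by (intro divide_right_mono) auto
      then show ?thesis
        using order.strict_implies_not_eq[OF pos[of "Suc s"]] by (simp only: diff_divide_distrib) simp
    qed
    also have "\<dots> \<le> - ln (\<beta>2 * (w s + \<epsilon>\<^sup>2) / (w (Suc s) + \<epsilon>\<^sup>2))"
      using ln_le_minus_one[of "\<beta>2 * (w s + \<epsilon>\<^sup>2) / (w (Suc s) + \<epsilon>\<^sup>2)"] pos beta2_pos by simp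
    also have "\<dots> = ln (w (Suc s) + \<epsilon>\<^sup>2) - ln (w s + \<epsilon>\<^sup>2) - ln \<beta>2"
      using pos[of s] pos[of "Suc s"] beta2_pos
      by (subst ln_div) (auto simp: ln_mult_pos)
    finally show ?thesis .
  qed
  have "(\<Sum>s<t. grad_ratio g (Suc s) i) \<le> ln (w t + \<epsilon>\<^sup>2) - ln (\<epsilon>\<^sup>2) - t * ln \<beta>2"
  proof (induction t)
    case (Suc t) then show ?case using step[of t] by (simp add: algebra_simps)
  qed (simp add: w0)
  also have "w t \<le> (\<Sum>s<t. (g (Suc s) i)\<^sup>2)"
  proof (induction t)
    case (Suc t)
    have "\<beta>2 * w t \<le> w t" using wn[of t] beta2 mult_right_mono[of \<beta>2 1 "w t"] by simp
    then show ?case using Suc by (simp add: wS)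
  qed (simp add: w0)
  then have "ln (w t + \<epsilon>\<^sup>2) \<le> ln ((\<Sum>s<t. (g (Suc s) i)\<^sup>2) + \<epsilon>\<^sup>2)"
    using pos[of t] by simp
  also have "ln ((\<Sum>s<t. (g (Suc s) i)\<^sup>2) + \<epsilon>\<^sup>2) - ln (\<epsilon>\<^sup>2) - t * ln \<beta>2
      = ln ((1 + (\<Sum>s<t. (g (Suc s) i)\<^sup>2) / \<epsilon>\<^sup>2) / \<beta>2 ^ t)"
  proof -
    have S: "0 \<le> (\<Sum>s<t. (g (Suc s) i)\<^sup>2)" by (intro sum_nonneg) auto
    have eq: "1 + (\<Sum>s<t. (g (Suc s) i)\<^sup>2) / \<epsilon>\<^sup>2 = ((\<Sum>s<t. (g (Suc s) i)\<^sup>2) + \<epsilon>\<^sup>2) / \<epsilon>\<^sup>2"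
      using order.strict_implies_not_eq[OF e2] by (simp only: add_divide_distrib) simp
    have lnq: "ln (a / b / c ^ t) = ln a - ln b - t * ln c" if "0 < a" "0 < b" "0 < c" for a b c :: real
      using that by (simp add: ln_div ln_realpow ln_mult_pos)
    show ?thesis unfolding eq
      using lnq[OF add_nonneg_pos[OF S e2] e2 beta2_pos] by simp
  qed
  finally show ?thesis by simp
qed

lemma stepsize_mom_sq: "stepsize s * (adam_m \<beta>1 g s i)\<^sup>2 \<le> \<eta> * adam_v \<beta>1 g s i"
proof -
  have "stepsize s * (adam_m \<beta>1 g s i)\<^sup>2 \<le> stepsize s * ((1 - \<beta>1 ^ s) * adam_v \<beta>1 g s i)"
    using adam_m_sq_le[OF beta1 beta1_less_1] stepsize_nonneg by (intro mult_left_mono)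
  also have "\<dots> \<le> \<eta> * adam_v \<beta>1 g s i"
    using mult_right_mono[OF stepsize_le_pow[of s] q_nonneg[of g s i]] by (simp add: mult_ac)
  finally show ?thesis .
qed

lemma stepsize_Suc_mom_sq: "stepsize (Suc s) * (adam_m \<beta>1 g s i)\<^sup>2 \<le> \<eta> * adam_v \<beta>1 g s i"
proof -
  have "stepsize (Suc s) * (1 - \<beta>1 ^ s) \<le> stepsize (Suc s) * (1 - \<beta>1 ^ Suc s)"
    using stepsize_nonneg[of "Suc s"] power_decreasing[of s "Suc s" \<beta>1] beta1 beta1_less_1
    by (intro mult_left_mono) auto
  then have *: "stepsize (Suc s) * (1 - \<beta>1 ^ s) \<le> \<eta>" using stepsize_le_pow[of "Suc s"] by linarith
  have "stepsize (Suc s) * (adam_m \<beta>1 g s i)\<^sup>2 \<le> stepsize (Suc s) * ((1 - \<beta>1 ^ s) * adam_v \<beta>1 g s i)"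
    using adam_m_sq_le[OF beta1 beta1_less_1] stepsize_nonneg by (intro mult_left_mono)
  also have "\<dots> \<le> \<eta> * adam_v \<beta>1 g s i"
    using mult_right_mono[OF * q_nonneg[of g s i]] by (simp add: mult_ac)
  finally show ?thesis .
qed

lemma displacement_sq_le:
  "(stepsize s * adam_m \<beta>1 g s i / denom g s i)\<^sup>2 \<le> C0\<^sup>2 / (1 - \<beta>1) * mom_ratio g s i"
proof -
  have "(stepsize s * adam_m \<beta>1 g s i)\<^sup>2 = stepsize s * (stepsize s * (adam_m \<beta>1 g s i)\<^sup>2)"
    by (simp add: power2_eq_square)
  also have "\<dots> \<le> (\<eta> / (1 - \<beta>1)) * (\<eta> * adam_v \<beta>1 g s i)"
    by (rule mult_mono[OF stepsize_le stepsize_mom_sq])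
       (use stepsize_nonneg[of s] eta_pos beta1_less_1 in auto)
  also have "\<dots> = C0\<^sup>2 / (1 - \<beta>1) * ((1 - \<beta>2) * adam_v \<beta>1 g s i)"
    using beta2 by (simp add: power2_eq_square)
  finally have "(stepsize s * adam_m \<beta>1 g s i)\<^sup>2 / (denom g s i)\<^sup>2
      \<le> C0\<^sup>2 / (1 - \<beta>1) * ((1 - \<beta>2) * adam_v \<beta>1 g s i) / (denom g s i)\<^sup>2"
    by (rule divide_right_mono) simp
  then show ?thesis by (simp add: mom_ratio_def power_divide mult_ac)
qed

lemma q_le_v: "(1 - \<beta>2) * adam_v \<beta>1 g s i \<le> (1 - \<beta>1) * adam_v \<beta>2 g s i"
proof (induction s)
  case (Suc s)
  have "(1 - \<beta>2) * adam_v \<beta>1 g (Suc s) i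
      = \<beta>1 * ((1 - \<beta>2) * adam_v \<beta>1 g s i) + (1 - \<beta>2) * (1 - \<beta>1) * (g (Suc s) i)\<^sup>2"
    by (simp add: algebra_simps)
  also have "\<dots> \<le> \<beta>2 * ((1 - \<beta>1) * adam_v \<beta>2 g s i) + (1 - \<beta>2) * (1 - \<beta>1) * (g (Suc s) i)\<^sup>2"
    using Suc beta1 beta1_less_1 beta12 beta2 q_nonneg[of g s i] v_nonneg[of g s i]
    by (intro add_mono order_refl mult_mono[of \<beta>1 \<beta>2]) auto
  finally show ?case by (simp add: algebra_simps)
qed simp

lemma mom_ratio_le: "mom_ratio g s i \<le> 1 - \<beta>1"
proof (cases s)
  case (Suc n)
  have b: "0 < (denom g s i)\<^sup>2" unfolding Suc using denom_pos by (intro zero_less_power)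
  have "adam_v \<beta>2 g s i \<le> (denom g s i)\<^sup>2"
    unfolding denom_def power2_sum using v_nonneg[of g s i] adam_eps_bounds[of s] by simp
  then have "(1 - \<beta>2) * adam_v \<beta>1 g s i \<le> (1 - \<beta>1) * (denom g s i)\<^sup>2"
    using q_le_v[of g s i] beta1_less_1 mult_left_mono[of "adam_v \<beta>2 g s i" "(denom g s i)\<^sup>2" "1 - \<beta>1"]
    by linarith
  then show ?thesis using b by (simp add: mom_ratio_def pos_divide_le_eq)
qed (use beta1_less_1 in \<open>simp add: mom_ratio_def\<close>)

lemma displacement_le: "(stepsize s * adam_m \<beta>1 g s i / denom g s i)\<^sup>2 \<le> C0\<^sup>2"
proof -
  have "C0\<^sup>2 / (1 - \<beta>1) * mom_ratio g s i \<le> C0\<^sup>2 / (1 - \<beta>1) * (1 - \<beta>1)"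
    using mom_ratio_le beta1_less_1 by (intro mult_left_mono) auto
  then show ?thesis using displacement_sq_le[of s g i] beta1_less_1 by simp
qed

lemma mom_over_denom_le: "sqrt (1 - \<beta>2) * \<bar>adam_m \<beta>1 g s i / denom g s i\<bar> \<le> sqrt (1 - \<beta>1)"
proof -
  have "(1 - \<beta>1 ^ s) * adam_v \<beta>1 g s i \<le> 1 * adam_v \<beta>1 g s i"
    using pow_bounds[of s] q_nonneg by (intro mult_right_mono) auto
  then have "(adam_m \<beta>1 g s i)\<^sup>2 \<le> adam_v \<beta>1 g s i"
    using adam_m_sq_le[OF beta1 beta1_less_1, of g s i] by linarith
  then have "(1 - \<beta>2) * (adam_m \<beta>1 g s i / denom g s i)\<^sup>2 \<le> mom_ratio g s i"
    unfolding mom_ratio_def power_divide times_divide_eq_right[symmetric]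
    using beta2 by (intro mult_left_mono divide_right_mono) auto
  then have "(sqrt (1 - \<beta>2) * \<bar>adam_m \<beta>1 g s i / denom g s i\<bar>)\<^sup>2 \<le> 1 - \<beta>1"
    using mom_ratio_le[of g s i] beta2
    by (simp only: power_mult_distrib power2_abs real_sqrt_pow2[of "1 - \<beta>2"] diff_ge_0_iff_ge)
  then show ?thesis by (rule real_le_rsqrt)
qed

text \<open>
  The step size is a product of an increasing factor with values in \<open>[0, 1]\<close> and a decreasing factor with
  values in \<open>[0, 1 / (1 - \<beta>1)]\<close>. The variations of both telescope.
\<close>

lemma stepsize_variation:
  "(\<Sum>s<t. \<bar>stepsize (Suc (Suc s)) - stepsize (Suc s)\<bar>) \<le> 2 * \<eta> / (1 - \<beta>1)"
proof -
  define p where "p s = sqrt (1 - \<beta>2 ^ Suc s)" for s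
  define r where "r s = 1 / (1 - \<beta>1 ^ Suc s)" for s
  have p: "0 \<le> p s" "p s \<le> 1" "p s \<le> p (Suc s)" for s
    using pow_bounds[of "Suc s"] power_decreasing[of "Suc s" "Suc (Suc s)" \<beta>2] beta2 beta2_pos
    by (auto simp: p_def simp del: power_Suc)
  have r: "0 \<le> r s" "r (Suc s) \<le> r s" for s
    using pow_less_1[of s] pow_less_1[of "Suc s"] beta1 beta1_less_1
      power_decreasing[of "Suc s" "Suc (Suc s)" \<beta>1]
    by (auto simp: r_def simp del: power_Suc intro!: divide_left_mono mult_pos_pos)
  have r1: "r s \<le> 1 / (1 - \<beta>1)" for s
  proof (induction s)
    case (Suc s) then show ?case using r(2)[of s] by linarith
  qed (simp add: r_def)
  have h: "stepsize (Suc s) = \<eta> * (p s * r s)" for s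
    by (simp add: stepsize_def adam_eta_def p_def r_def)
  have step: "\<bar>stepsize (Suc (Suc s)) - stepsize (Suc s)\<bar>
      \<le> \<eta> * ((p (Suc s) - p s) / (1 - \<beta>1) + (r s - r (Suc s)))" for s
  proof -
    have "p (Suc s) * r (Suc s) - p s * r s = (p (Suc s) - p s) * r s - p (Suc s) * (r s - r (Suc s))"
      by (simp add: algebra_simps)
    moreover have "0 \<le> (p (Suc s) - p s) * r s" "0 \<le> p (Suc s) * (r s - r (Suc s))"
      using p r by auto
    moreover have "(p (Suc s) - p s) * r s \<le> (p (Suc s) - p s) * (1 / (1 - \<beta>1))"
      using p r1 by (intro mult_left_mono) auto
    moreover have "p (Suc s) * (r s - r (Suc s)) \<le> 1 * (r s - r (Suc s))"
      using p r by (intro mult_right_mono) auto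
    ultimately have "\<bar>p (Suc s) * r (Suc s) - p s * r s\<bar>
        \<le> (p (Suc s) - p s) / (1 - \<beta>1) + (r s - r (Suc s))"
      by (simp add: abs_le_iff)
    then have "\<eta> * \<bar>p (Suc s) * r (Suc s) - p s * r s\<bar>
        \<le> \<eta> * ((p (Suc s) - p s) / (1 - \<beta>1) + (r s - r (Suc s)))"
      using eta_pos by (intro mult_left_mono) auto
    then show ?thesis
      using C0 beta2 by (simp add: h abs_mult flip: right_diff_distrib)
  qed
  have "(\<Sum>s<t. \<bar>stepsize (Suc (Suc s)) - stepsize (Suc s)\<bar>)
      \<le> \<eta> * ((p t - p 0) / (1 - \<beta>1) + (r 0 - r t))"
  proof (induction t)
    case (Suc t) 
    have "\<eta> * ((p t - p 0) / (1 - \<beta>1) + (r 0 - r t)) + \<eta> * ((p (Suc t) - p t) / (1 - \<beta>1) + (r t - r (Suc t)))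
       = \<eta> * ((p (Suc t) - p 0) / (1 - \<beta>1) + (r 0 - r (Suc t)))"
      by (simp add: algebra_simps diff_divide_distrib)
    then show ?case using Suc step[of t] by simp
  qed simp
  also have "\<dots> \<le> \<eta> * (1 / (1 - \<beta>1) + 1 / (1 - \<beta>1))"
  proof -
    have "(p t - p 0) / (1 - \<beta>1) \<le> 1 / (1 - \<beta>1)"
      using p(2)[of t] p(1)[of 0] beta1_less_1 by (intro divide_right_mono) auto
    moreover have "r 0 - r t \<le> 1 / (1 - \<beta>1)" using r1[of 0] r(1)[of t] by linarith
    ultimately show ?thesis using eta_pos by (intro mult_left_mono) auto
  qed
  finally show ?thesis by (simp add: mult.commute)
qed

lemma Sigma_max_bounds:
  "1 \<le> Sigma_max \<beta>2" "sqrt ((1 + \<beta>2) / \<beta>2) - 1 \<le> Sigma_max \<beta>2"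
  by (auto simp: Sigma_max_def)

text \<open>
  From one step to the next the denominator shrinks at most by the factor \<open>sqrt \<beta>2\<close>, and the step
  size grows at most by the factor \<open>sqrt (1 + \<beta>2)\<close>. This is the origin of \<open>Sigma_max\<close>.
\<close>

lemma step_ratio_change_le:
  "\<bar>(stepsize s / denom g s i - stepsize (Suc s) / denom g (Suc s) i) * adam_m \<beta>1 g s i\<bar>
    \<le> Sigma_max \<beta>2 * \<bar>stepsize s * adam_m \<beta>1 g s i / denom g s i\<bar>"
proof (cases s)
  case (Suc n)
  let ?b = "denom g s i" and ?b' = "denom g (Suc s) i" and ?h = "stepsize s" and ?h' = "stepsize (Suc s)"
  have b: "0 < ?b" "0 < ?b'" unfolding Suc by (rule denom_pos)+
  have h: "0 < ?h" "0 < ?h'" unfolding Suc by (rule stepsize_pos)+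
  have "?h' \<le> sqrt (1 + \<beta>2) * ?h"
  proof -
    have le: "1 - \<beta>2 ^ Suc s \<le> (1 + \<beta>2) * (1 - \<beta>2 ^ s)"
      using power_decreasing[of 1 s \<beta>2] Suc beta2 beta2_pos by (simp add: algebra_simps)
    have "sqrt (1 - \<beta>2 ^ Suc s) \<le> sqrt (1 + \<beta>2) * sqrt (1 - \<beta>2 ^ s)"
      unfolding real_sqrt_mult[symmetric] using le by simp
    then have "\<eta> * sqrt (1 - \<beta>2 ^ Suc s) \<le> \<eta> * (sqrt (1 + \<beta>2) * sqrt (1 - \<beta>2 ^ s))"
      using eta_pos by (intro mult_left_mono) auto
    moreover have "1 - \<beta>1 ^ s \<le> 1 - \<beta>1 ^ Suc s"
      using power_decreasing[of s "Suc s" \<beta>1] beta1 beta1_less_1 by simp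
    ultimately have "?h' \<le> \<eta> * (sqrt (1 + \<beta>2) * sqrt (1 - \<beta>2 ^ s)) / (1 - \<beta>1 ^ s)"
      unfolding stepsize_def adam_eta_def
      using pow_less_1[of n] pow_bounds[of s] eta_pos beta2_pos Suc
      by (intro frac_le) (auto simp del: power_Suc)
    then show ?thesis by (simp add: stepsize_def adam_eta_def mult_ac)
  qed
  then have "?h' / ?b' \<le> (sqrt (1 + \<beta>2) * ?h) / (sqrt \<beta>2 * ?b)"
    using denom_decay[of g s i] b h beta2_pos by (intro frac_le) auto
  also have "\<dots> = sqrt ((1 + \<beta>2) / \<beta>2) * (?h / ?b)" by (simp add: real_sqrt_divide)
  also have "\<dots> \<le> (Sigma_max \<beta>2 + 1) * (?h / ?b)"
    using Sigma_max_bounds b h by (intro mult_right_mono) auto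
  finally have up: "?h' / ?b' \<le> (Sigma_max \<beta>2 + 1) * (?h / ?b)" .
  have hb: "0 \<le> ?h / ?b" "0 \<le> ?h' / ?b'" using b h by auto
  have "1 * (?h / ?b) \<le> Sigma_max \<beta>2 * (?h / ?b)"
    using Sigma_max_bounds hb by (intro mult_right_mono) auto
  then have "\<bar>?h / ?b - ?h' / ?b'\<bar> \<le> Sigma_max \<beta>2 * (?h / ?b)"
    using up hb unfolding distrib_right by linarith
  then have "\<bar>?h / ?b - ?h' / ?b'\<bar> * \<bar>adam_m \<beta>1 g s i\<bar> \<le> Sigma_max \<beta>2 * (?h / ?b) * \<bar>adam_m \<beta>1 g s i\<bar>"
    by (intro mult_right_mono) auto
  then show ?thesis using hb b h by (simp add: abs_mult)
qed simp

end

section \<open>Smooth functions\<close>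

abbreviation inner_d :: "nat \<Rightarrow> (nat \<Rightarrow> real) \<Rightarrow> (nat \<Rightarrow> real) \<Rightarrow> real" where
  "inner_d d u v \<equiv> (\<Sum>i=1..d. u i * v i)"

lemma l2norm_nonneg: "0 \<le> l2norm d v"
  by (simp add: l2norm_def L2_set_nonneg)

lemma l2norm_sq: "(l2norm d v)\<^sup>2 = (\<Sum>i=1..d. (v i)\<^sup>2)"
  by (simp add: l2norm_def L2_set_def sum_nonneg)

lemma l2norm_cong: "(\<And>i. i \<in> {1..d} \<Longrightarrow> u i = v i) \<Longrightarrow> l2norm d u = l2norm d v"
  unfolding l2norm_def by (rule L2_set_cong) auto

lemma l2norm_scale: "l2norm d (\<lambda>i. c * v i) = \<bar>c\<bar> * l2norm d v"
proof -
  have "(l2norm d (\<lambda>i. c * v i))\<^sup>2 = (\<bar>c\<bar> * l2norm d v)\<^sup>2"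
    by (simp add: l2norm_sq power_mult_distrib sum_distrib_left)
  then show ?thesis using l2norm_nonneg by (simp add: power2_eq_iff_nonneg)
qed

lemma inner_d_le: "\<bar>inner_d d u v\<bar> \<le> l2norm d u * l2norm d v"
proof -
  have "\<bar>inner_d d u v\<bar> \<le> (\<Sum>i=1..d. \<bar>u i\<bar> * \<bar>v i\<bar>)"
    using sum_abs[of "\<lambda>i. u i * v i" "{1..d}"] by (simp add: abs_mult)
  also have "\<dots> \<le> l2norm d u * l2norm d v"
    unfolding l2norm_def by (rule L2_set_mult_ineq)
  finally show ?thesis .
qed

lemma component_le_l2norm: "i \<in> {1..d} \<Longrightarrow> \<bar>v i\<bar> \<le> l2norm d v"
  using member_le_L2_set[of "{1..d}" i "\<lambda>i. \<bar>v i\<bar>"] by (simp add: l2norm_def L2_set_def)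

lemma has_gradient_gradient:
  "L_smooth d L f \<Longrightarrow> x \<in> space (Rd d) \<Longrightarrow> has_gradient d f (gradient d f x) x"
  unfolding L_smooth_def using gradient_eq by metis

text \<open>
  Vectors are undefined outside of \<open>{1..d}\<close>, and the restriction keeps the line in the space \<open>Rd d\<close>.
\<close>

definition line_at :: "nat \<Rightarrow> (nat \<Rightarrow> real) \<Rightarrow> (nat \<Rightarrow> real) \<Rightarrow> real \<Rightarrow> (nat \<Rightarrow> real)" where
  "line_at d x v t = (\<lambda>i\<in>{1..d}. x i + t * v i)"

lemma line_at_space: "line_at d x v t \<in> space (Rd d)"
  by (simp add: line_at_def space_Rd)

lemma line_at_derivative:
  assumes "L_smooth d L f" 
  shows "((\<lambda>t. f (line_at d x v t)) has_real_derivative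
    inner_d d (gradient d f (line_at d x v t)) v) (at t)"
proof -
  let ?p = "gradient d f (line_at d x v t)"
  have diff: "line_at d x v u i - line_at d x v t i = (u - t) * v i" if "i \<in> {1..d}" for u i
    using that by (simp add: line_at_def algebra_simps)
  have nrm: "l2norm d (\<lambda>i. line_at d x v u i - line_at d x v t i) = \<bar>u - t\<bar> * l2norm d v" for u
    using l2norm_cong[of d "\<lambda>i. line_at d x v u i - line_at d x v t i" "\<lambda>i. (u - t) * v i"] diff
    by (simp add: l2norm_scale)
  have inn: "inner_d d ?p (\<lambda>i. line_at d x v u i - line_at d x v t i) = (u - t) * inner_d d ?p v" for u
    unfolding sum_distrib_left by (rule sum.cong) (simp_all add: diff)
  have gr: "has_gradient d f ?p (line_at d x v t)"
    using assms line_at_space by (rule has_gradient_gradient)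
  show ?thesis unfolding has_field_derivative_def
  proof (rule has_derivativeI[OF bounded_linear_mult_right], rule LIM_I)
    fix e :: real assume e: "0 < e"
    define N where "N = l2norm d v + 1"
    have N: "0 < N" "l2norm d v < N" using l2norm_nonneg[of d v] by (auto simp: N_def)
    obtain r where r: "0 < r" "\<And>y. y \<in> space (Rd d) \<Longrightarrow>
        l2norm d (\<lambda>i. y i - line_at d x v t i) < r \<Longrightarrow>
        \<bar>f y - f (line_at d x v t) - inner_d d ?p (\<lambda>i. y i - line_at d x v t i)\<bar>
          \<le> e / N * l2norm d (\<lambda>i. y i - line_at d x v t i)"
      using gr e N unfolding has_gradient_def by (meson divide_pos_pos)
    show "\<exists>s>0. \<forall>u. u \<noteq> t \<and> norm (u - t) < s \<longrightarrow>
        norm ((f (line_at d x v u) - f (line_at d x v t) - inner_d d ?p v * (u - t)) /\<^sub>R norm (u - t) - 0) < e"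
    proof (intro exI[of _ "r / N"] conjI allI impI)
      show "0 < r / N" using r N by simp
      fix u assume u: "u \<noteq> t \<and> norm (u - t) < r / N"
      then have ut: "0 < \<bar>u - t\<bar>" by simp
      have "\<bar>u - t\<bar> * l2norm d v \<le> \<bar>u - t\<bar> * N" using N by (intro mult_left_mono) auto
      also have "\<dots> < r" using u N by (simp add: field_simps)
      finally have "\<bar>f (line_at d x v u) - f (line_at d x v t) - (u - t) * inner_d d ?p v\<bar>
          \<le> e / N * (\<bar>u - t\<bar> * l2norm d v)"
        using r(2)[OF line_at_space, of x v u] unfolding nrm inn by blast
      also have "\<dots> < e / N * (\<bar>u - t\<bar> * N)"
        using N e ut by (intro mult_strict_left_mono) auto
      also have "\<dots> = e * \<bar>u - t\<bar>" using N by simp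
      finally have lt: "\<bar>f (line_at d x v u) - f (line_at d x v t) - inner_d d ?p v * (u - t)\<bar> < e * \<bar>u - t\<bar>"
        by (simp only: mult.commute[of "inner_d d ?p v"])
      have eq: "norm (D /\<^sub>R norm (u - t) - 0) = \<bar>D\<bar> / \<bar>u - t\<bar>" for D :: real
        by (simp add: divide_inverse abs_mult mult.commute)
      show "norm ((f (line_at d x v u) - f (line_at d x v t) - inner_d d ?p v * (u - t)) /\<^sub>R norm (u - t) - 0) < e"
        unfolding eq using lt ut by (simp only: pos_divide_less_eq)
    qed
  qed
qed

text \<open>
  The difference between \<open>f\<close> on the line and the quadratic upper model has a nonpositive derivative,
  because the gradient is Lipschitz.
\<close>

lemma descent_lemma_line:
  assumes smooth: "L_smooth d L f" and L: "0 \<le> L" and x: "x \<in> space (Rd d)"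
  shows "f (line_at d x v 1) \<le> f x + inner_d d (gradient d f x) v + L / 2 * (l2norm d v)\<^sup>2"
proof -
  let ?p = "line_at d x v" and ?G = "gradient d f"
  have p0: "?p 0 = x" using PiE_restrict[OF x[unfolded space_Rd]] by (simp add: line_at_def)
  define \<phi> where "\<phi> t = f (?p t) - t * inner_d d (?G x) v - L / 2 * t\<^sup>2 * (l2norm d v)\<^sup>2" for t
  have "\<phi> 1 \<le> \<phi> 0"
  proof (rule DERIV_nonpos_imp_nonincreasing[of 0 1 \<phi>])
    fix t :: real assume t: "0 \<le> t" "t \<le> 1"
    have lin: "((\<lambda>t. t * c) has_real_derivative c) (at t)"
      and quad: "((\<lambda>t. L / 2 * t\<^sup>2 * c) has_real_derivative L * t * c) (at t)" for c :: real
      by (auto intro!: derivative_eq_intros)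
    have "(\<phi> has_real_derivative
        inner_d d (?G (?p t)) v - inner_d d (?G x) v - L * t * (l2norm d v)\<^sup>2) (at t)"
      unfolding \<phi>_def by (rule DERIV_diff[OF DERIV_diff[OF line_at_derivative[OF smooth] lin] quad])
    moreover have "inner_d d (?G (?p t)) v - inner_d d (?G x) v \<le> L * t * (l2norm d v)\<^sup>2"
    proof -
      have "inner_d d (?G (?p t)) v - inner_d d (?G x) v = inner_d d (\<lambda>i. ?G (?p t) i - ?G x i) v"
        by (simp add: sum_subtractf left_diff_distrib)
      also have "\<dots> \<le> l2norm d (\<lambda>i. ?G (?p t) i - ?G x i) * l2norm d v"
        using inner_d_le[where d = d and u = "\<lambda>i. ?G (?p t) i - ?G x i" and v = v] by linarith
      also have "\<dots> \<le> (L * l2norm d (\<lambda>i. ?p t i - x i)) * l2norm d v"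
        using smooth line_at_space x l2norm_nonneg unfolding L_smooth_def
        by (intro mult_right_mono) auto
      also have "l2norm d (\<lambda>i. ?p t i - x i) = t * l2norm d v"
        using l2norm_cong[of d "\<lambda>i. ?p t i - x i" "\<lambda>i. t * v i"] t
        by (simp add: l2norm_scale line_at_def)
      finally show ?thesis by (simp add: power2_eq_square mult_ac)
    qed
    ultimately show "\<exists>y. (\<phi> has_real_derivative y) (at t) \<and> y \<le> 0"
      by (intro exI[of _ "inner_d d (?G (?p t)) v - inner_d d (?G x) v - L * t * (l2norm d v)\<^sup>2"] conjI)
         (assumption, linarith)
  qed simp
  then show ?thesis unfolding \<phi>_def p0 by simp
qed

lemma line_at_difference:
  assumes "y \<in> space (Rd d)" shows "line_at d x (\<lambda>i. y i - x i) 1 = y"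
proof -
  have "line_at d x (\<lambda>i. y i - x i) 1 = restrict y {1..d}"
    unfolding line_at_def by (rule restrict_ext) simp
  also have "\<dots> = y" using assms unfolding space_Rd by (rule PiE_restrict)
  finally show ?thesis .
qed

lemma descent_lemma:
  assumes "L_smooth d L f" "0 \<le> L" "x \<in> space (Rd d)" "y \<in> space (Rd d)"
  shows "f y \<le> f x + inner_d d (gradient d f x) (\<lambda>i. y i - x i)
    + L / 2 * (l2norm d (\<lambda>i. y i - x i))\<^sup>2"
  using descent_lemma_line[OF assms(1-3), of "\<lambda>i. y i - x i"]
  unfolding line_at_difference[OF assms(4)] .

text \<open>
  A gradient step of length \<open>1 / L\<close> lowers the value by at least \<open>\<parallel>\<nabla>f\<parallel>\<^sup>2 / (2 L)\<close>, and the new value is still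
  at least \<open>fstar\<close>.
\<close>

lemma gradient_sq_le_gap:
  assumes smooth: "L_smooth d L f" and L: "0 < L" and x: "x \<in> space (Rd d)"
    and below: "\<And>y. y \<in> space (Rd d) \<Longrightarrow> fstar \<le> f y"
  shows "(l2norm d (gradient d f x))\<^sup>2 \<le> 2 * L * (f x - fstar)"
proof -
  let ?g = "gradient d f x"
  have "fstar \<le> f (line_at d x (\<lambda>i. - (1 / L) * ?g i) 1)"
    by (rule below[OF line_at_space])
  also have "\<dots> \<le> f x + inner_d d ?g (\<lambda>i. - (1 / L) * ?g i) + L / 2 * (l2norm d (\<lambda>i. - (1 / L) * ?g i))\<^sup>2"
    using L by (intro descent_lemma_line[OF smooth _ x]) simp
  also have "inner_d d ?g (\<lambda>i. - (1 / L) * ?g i) = - (1 / L) * (l2norm d ?g)\<^sup>2"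
    unfolding l2norm_sq sum_distrib_left by (rule sum.cong) (simp_all add: power2_eq_square)
  also have "l2norm d (\<lambda>i. - (1 / L) * ?g i) = 1 / L * l2norm d ?g"
    unfolding l2norm_scale using L by simp
  finally have "(l2norm d ?g)\<^sup>2 / L \<le> 2 * (f x - fstar)"
    using L by (simp add: power_mult_distrib power2_eq_square field_simps)
  then have "(l2norm d ?g)\<^sup>2 \<le> 2 * (f x - fstar) * L" using L by (simp only: pos_divide_le_eq)
  then show ?thesis by (simp only: mult.commute mult.left_commute mult.assoc)
qed

section \<open>One coordinate of one step\<close>

text \<open>
  Young's inequality for the exchange of two denominators. The constant \<open>1 / 8\<close> is chosen because the exchange
  is done three times below, and most of the descent term has to survive.
\<close>

lemma young_reciprocal:
  fixes a b h p u :: real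
  assumes "0 \<le> h" "0 < a" "0 < b"
  shows "h * p * u * (1 / a - 1 / b) \<le> h * p\<^sup>2 / (8 * a) + 2 * h * u\<^sup>2 * (b - a)\<^sup>2 / (a * b\<^sup>2)"
proof -
  have "p * (u * (b - a) / b) \<le> p\<^sup>2 / 8 + 2 * (u * (b - a) / b)\<^sup>2"
    using sum_squares_bound[of "p / 2" "2 * (u * (b - a) / b)"] by (simp add: power_divide power_mult_distrib)
  then have "h / a * (p * (u * (b - a) / b)) \<le> h / a * (p\<^sup>2 / 8 + 2 * (u * (b - a) / b)\<^sup>2)"
    using assms by (intro mult_left_mono) auto
  moreover have "h * p * u * (1 / a - 1 / b) = h / a * (p * (u * (b - a) / b))"
    using assms by (simp add: field_simps)
  moreover have "h / a * (p\<^sup>2 / 8 + 2 * (u * (b - a) / b)\<^sup>2)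
      = h * p\<^sup>2 / (8 * a) + 2 * h * u\<^sup>2 * (b - a)\<^sup>2 / (a * b\<^sup>2)"
    by (simp add: power_divide power_mult_distrib distrib_left mult_ac)
  ultimately show ?thesis by simp
qed

context adam_parameters
begin

abbreviation "\<kappa> \<equiv> \<beta>1 / (1 - \<beta>1)"

text \<open>
  The denominator of step \<open>s + 1\<close>, with the square of the unknown answer replaced by what is
  known before the query: \<open>p\<close> stands for the gradient and \<open>W\<close> for the size of the noise.
\<close>

definition proxy :: "(nat \<Rightarrow> nat \<Rightarrow> real) \<Rightarrow> nat \<Rightarrow> nat \<Rightarrow> real \<Rightarrow> real \<Rightarrow> real" where
  "proxy g s i p W = sqrt (\<beta>2 * adam_v \<beta>2 g s i + (1 - \<beta>2) * (p\<^sup>2 + W\<^sup>2)) + adam_eps \<epsilon> \<beta>2 (Suc s)"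

lemma proxy_pos: "0 < proxy g s i p W"
proof -
  have "0 \<le> \<beta>2 * adam_v \<beta>2 g s i + (1 - \<beta>2) * (p\<^sup>2 + W\<^sup>2)"
    using beta2 beta2_pos v_nonneg[of g s i] by auto
  then show ?thesis unfolding proxy_def using adam_eps_pos[of s]
    by (metis add.commute add_pos_nonneg real_sqrt_ge_zero)
qed

lemma proxy_ge_noise: "sqrt (1 - \<beta>2) * W \<le> proxy g s i p W"
proof -
  have "sqrt (1 - \<beta>2) * W \<le> sqrt ((1 - \<beta>2) * W\<^sup>2)" using beta2 by (simp add: real_sqrt_mult)
  also have "\<dots> \<le> sqrt (\<beta>2 * adam_v \<beta>2 g s i + (1 - \<beta>2) * (p\<^sup>2 + W\<^sup>2))"
    using beta2 beta2_pos v_nonneg[of g s i] by (simp add: distrib_left)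
  finally show ?thesis unfolding proxy_def using adam_eps_bounds[of "Suc s"] by linarith
qed

lemma proxy_ge_denom: "sqrt \<beta>2 * denom g s i \<le> proxy g s i p W"
proof -
  have "sqrt \<beta>2 * sqrt (adam_v \<beta>2 g s i) \<le> sqrt (\<beta>2 * adam_v \<beta>2 g s i + (1 - \<beta>2) * (p\<^sup>2 + W\<^sup>2))"
    using beta2 by (simp flip: real_sqrt_mult)
  moreover have "sqrt \<beta>2 * adam_eps \<epsilon> \<beta>2 s \<le> 1 * adam_eps \<epsilon> \<beta>2 s"
    using adam_eps_bounds[of s] beta2 beta2_pos by (intro mult_right_mono) auto
  ultimately show ?thesis using adam_eps_mono[of s] by (simp add: denom_def proxy_def algebra_simps)
qed

lemma proxy_near_denom:
  assumes "\<bar>g (Suc s) i - p\<bar> \<le> W"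
  shows "\<bar>denom g (Suc s) i - proxy g s i p W\<bar> \<le> 2 * (sqrt (1 - \<beta>2) * W)"
proof -
  let ?w = "sqrt (1 - \<beta>2)"
  have "\<bar>?w * g (Suc s) i - ?w * p\<bar> = ?w * \<bar>g (Suc s) i - p\<bar>"
    using beta2 by (simp add: abs_mult flip: right_diff_distrib)
  also have "\<dots> \<le> ?w * W" using assms beta2 by (intro mult_left_mono) auto
  finally have "\<bar>sqrt (\<beta>2 * adam_v \<beta>2 g s i + (?w * g (Suc s) i)\<^sup>2)
      - sqrt (\<beta>2 * adam_v \<beta>2 g s i + ((?w * p)\<^sup>2 + (?w * W)\<^sup>2))\<bar> \<le> 2 * (?w * W)"
    using beta2_pos v_nonneg[of g s i] by (intro abs_sqrt_diff_le) auto
  then show ?thesis using beta2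
    by (simp add: denom_def proxy_def power_mult_distrib distrib_left)
qed

lemma proxy_near_previous_denom:
  assumes "0 \<le> c" "adam_v \<beta>2 g s i \<le> c\<^sup>2" "p\<^sup>2 + W\<^sup>2 \<le> c\<^sup>2"
  shows "\<bar>denom g s i - proxy g s i p W\<bar> \<le> sqrt (1 - \<beta>2) * (c + \<epsilon>0)"
proof -
  let ?w = "sqrt (1 - \<beta>2)" and ?V = "adam_v \<beta>2 g s i" and ?U = "p\<^sup>2 + W\<^sup>2"
  let ?R = "sqrt (\<beta>2 * ?V + (1 - \<beta>2) * ?U)"
  have V: "0 \<le> ?V" "sqrt ?V \<le> c" using v_nonneg assms real_le_lsqrt by auto
  have U: "0 \<le> ?U" "sqrt ?U \<le> c" using assms real_le_lsqrt by (auto simp: real_le_lsqrt)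
  have "?R \<le> sqrt (\<beta>2 * ?V) + sqrt ((1 - \<beta>2) * ?U)"
    using V U beta2 beta2_pos by (intro sqrt_add_le_add_sqrt) auto
  also have "\<dots> = sqrt \<beta>2 * sqrt ?V + ?w * sqrt ?U" by (simp add: real_sqrt_mult)
  also have "\<dots> \<le> 1 * sqrt ?V + ?w * c"
    using V U beta2 beta2_pos by (intro add_mono mult_right_mono mult_left_mono) auto
  finally have up: "?R \<le> sqrt ?V + ?w * c" by simp
  have w: "1 - \<beta>2 \<le> ?w" using beta2 beta2_pos by (intro real_le_rsqrt) (simp add: power2_eq_square mult_left_le)
  have b: "\<beta>2 \<le> sqrt \<beta>2" using beta2 beta2_pos by (intro real_le_rsqrt) (simp add: power2_eq_square mult_left_le)
  have "sqrt ?V \<le> \<beta>2 * sqrt ?V + (1 - \<beta>2) * sqrt ?V" by (simp add: algebra_simps)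
  also have "\<dots> \<le> sqrt \<beta>2 * sqrt ?V + ?w * c"
    using V w b beta2 beta2_pos by (intro add_mono mult_mono) auto
  also have "sqrt \<beta>2 * sqrt ?V \<le> ?R"
    using U beta2 by (simp flip: real_sqrt_mult)
  finally have dn: "sqrt ?V \<le> ?R + ?w * c" by simp
  have e: "0 \<le> adam_eps \<epsilon> \<beta>2 s" "adam_eps \<epsilon> \<beta>2 s \<le> adam_eps \<epsilon> \<beta>2 (Suc s)" "adam_eps \<epsilon> \<beta>2 (Suc s) \<le> \<epsilon>"
    using adam_eps_bounds adam_eps_mono by auto
  have "?w * (c + \<epsilon>0) = ?w * c + \<epsilon>" by (simp add: algebra_simps)
  then show ?thesis unfolding denom_def proxy_def
    using up dn e by linarith
qed

text \<open>
  The squared distance between proxy and denominator has two factors \<open>sqrt (1 - \<beta>2) W\<close>. The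
  proxy is at least as large as one of them and absorbs it, so \<open>W\<close> enters linearly.
\<close>

lemma fresh_gradient_term:
  fixes p W :: real
  assumes W: "0 \<le> W" and noise: "\<bar>g (Suc s) i - p\<bar> \<le> W"
  shows "- (stepsize (Suc s) * p * g (Suc s) i / denom g (Suc s) i)
    \<le> - (7/8 * (stepsize (Suc s) * p\<^sup>2 / proxy g s i p W))
      - stepsize (Suc s) * p * (g (Suc s) i - p) / proxy g s i p W
      + 8 * C0 / (1 - \<beta>1) * W * grad_ratio g (Suc s) i"
proof -
  let ?h = "stepsize (Suc s)" and ?a = "proxy g s i p W" and ?b = "denom g (Suc s) i" and ?u = "g (Suc s) i"
  let ?w = "sqrt (1 - \<beta>2)"
  have a: "0 < ?a" and b: "0 < ?b" by (rule proxy_pos, rule denom_pos)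
  have h: "0 \<le> ?h" by (rule stepsize_nonneg)
  have "2 * ?h * ?u\<^sup>2 * (?b - ?a)\<^sup>2 / (?a * ?b\<^sup>2) \<le> 2 * ?h * ?u\<^sup>2 * (2 * (?w * W))\<^sup>2 / (?a * ?b\<^sup>2)"
    using proxy_near_denom[of g s i p W, OF noise] a b h W beta2
    by (intro divide_right_mono mult_left_mono abs_le_square_iff[THEN iffD1]) auto
  also have "\<dots> = 8 * (?w * W / ?a) * ?h * (?w * W * (?u\<^sup>2 / ?b\<^sup>2))"
    by (simp add: power2_eq_square)
  also have "\<dots> \<le> 8 * 1 * (\<eta> / (1 - \<beta>1)) * (?w * W * (?u\<^sup>2 / ?b\<^sup>2))"
    using proxy_ge_noise[of W g s i p] stepsize_le[of "Suc s"] a h W beta2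
    by (intro mult_right_mono mult_mono) (auto simp: pos_divide_le_eq)
  also have "\<dots> = 8 * C0 / (1 - \<beta>1) * W * (?w\<^sup>2 * ?u\<^sup>2 / ?b\<^sup>2)" by (simp add: power2_eq_square)
  also have "\<dots> = 8 * C0 / (1 - \<beta>1) * W * grad_ratio g (Suc s) i" using beta2 by (simp add: grad_ratio_def)
  finally have 1: "?h * p * ?u * (1 / ?a - 1 / ?b)
      \<le> ?h * p\<^sup>2 / (8 * ?a) + 8 * C0 / (1 - \<beta>1) * W * grad_ratio g (Suc s) i"
    using young_reciprocal[OF h a b, of p ?u] by linarith
  have "- (?h * p * ?u / ?b) = - (?h * p\<^sup>2 / ?a) - ?h * p * (?u - p) / ?a + ?h * p * ?u * (1 / ?a - 1 / ?b)"
    by (simp add: power2_eq_square right_diff_distrib diff_divide_distrib)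
  then show ?thesis using 1 by simp
qed

lemma new_momentum_term:
  fixes p W :: real
  assumes W: "0 \<le> W" and noise: "\<bar>g (Suc s) i - p\<bar> \<le> W"
  shows "stepsize (Suc s) * p * (\<kappa> * adam_m \<beta>1 g s i) * (1 / proxy g s i p W - 1 / denom g (Suc s) i)
    \<le> stepsize (Suc s) * p\<^sup>2 / (8 * proxy g s i p W)
      + 8 * \<kappa>\<^sup>2 * C0 / \<beta>2 * W * mom_ratio g s i"
proof -
  let ?h = "stepsize (Suc s)" and ?a = "proxy g s i p W" and ?b = "denom g (Suc s) i"
  let ?w = "sqrt (1 - \<beta>2)" and ?m = "adam_m \<beta>1 g s i" and ?q = "adam_v \<beta>1 g s i"
  have a: "0 < ?a" and b: "0 < ?b" by (rule proxy_pos, rule denom_pos)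
  have h: "0 \<le> ?h" by (rule stepsize_nonneg)
  have "2 * ?h * (\<kappa> * ?m)\<^sup>2 * (?b - ?a)\<^sup>2 / (?a * ?b\<^sup>2)
      \<le> 2 * ?h * (\<kappa> * ?m)\<^sup>2 * (2 * (?w * W))\<^sup>2 / (?a * ?b\<^sup>2)"
    using proxy_near_denom[of g s i p W, OF noise] a b h W beta2
    by (intro divide_right_mono mult_left_mono abs_le_square_iff[THEN iffD1]) auto
  also have "\<dots> = 8 * \<kappa>\<^sup>2 * (?w * W / ?a) * (?h * ?m\<^sup>2) * (?w * W / ?b\<^sup>2)"
  proof -
    have "2 * h * (k * m)\<^sup>2 * (2 * w)\<^sup>2 / (a * b\<^sup>2) = 8 * k\<^sup>2 * (w / a) * (h * m\<^sup>2) * (w / b\<^sup>2)"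
      for h k m w a b :: real by (simp add: power2_eq_square)
    then show ?thesis .
  qed
  also have "\<dots> \<le> 8 * \<kappa>\<^sup>2 * 1 * (\<eta> * ?q) * (?w * W / ?b\<^sup>2)"
    using proxy_ge_noise[of W g s i p] a h W beta2
    by (intro mult_right_mono[OF mult_mono[OF mult_left_mono stepsize_Suc_mom_sq]])
       (auto simp: pos_divide_le_eq)
  also have "\<dots> = 8 * \<kappa>\<^sup>2 * C0 * W * (?w\<^sup>2 * ?q / ?b\<^sup>2)"
    unfolding power2_eq_square[of ?w] by (simp only: mult_ac times_divide_eq_left times_divide_eq_right mult_1)
  also have "?w\<^sup>2 * ?q / ?b\<^sup>2 \<le> mom_ratio g s i / \<beta>2"
  proof (cases s)
    case (Suc n)
    have b0: "0 < denom g s i" unfolding Suc by (rule denom_pos)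
    have "(1 - \<beta>2) * ?q / ?b\<^sup>2 \<le> (1 - \<beta>2) * ?q / (\<beta>2 * (denom g s i)\<^sup>2)"
      using denom_sq_decay[of g s i] b b0 beta2 beta2_pos q_nonneg[of g s i]
      by (intro divide_left_mono mult_pos_pos zero_less_power) auto
    then show ?thesis using beta2 by (simp add: mom_ratio_def mult_ac)
  qed (simp add: mom_ratio_def)
  then have "8 * \<kappa>\<^sup>2 * C0 * W * (?w\<^sup>2 * ?q / ?b\<^sup>2) \<le> 8 * \<kappa>\<^sup>2 * C0 * W * (mom_ratio g s i / \<beta>2)"
    using C0 W by (intro mult_left_mono) auto
  finally show ?thesis
    using young_reciprocal[OF h a b, of p "\<kappa> * ?m"] by simp
qed

text \<open>
  The distance of the proxy to the previous denominator is not small in terms of the noise, so it is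
  measured by a bound \<open>c\<close> for all answers. Again the proxy absorbs one factor of the distance, now because it is
  at least \<open>sqrt \<beta>2\<close> times the previous denominator.
\<close>

lemma old_momentum_term:
  fixes p W :: real
  assumes c: "0 \<le> c" "adam_v \<beta>2 g s i \<le> c\<^sup>2" "p\<^sup>2 + W\<^sup>2 \<le> c\<^sup>2"
  shows "stepsize (Suc s) * p * (\<kappa> * adam_m \<beta>1 g s i) * (1 / denom g s i - 1 / proxy g s i p W)
    \<le> stepsize (Suc s) * p\<^sup>2 / (8 * proxy g s i p W)
      + 2 * \<kappa>\<^sup>2 * C0 * (c + \<epsilon>0) / sqrt \<beta>2 * mom_ratio g s i"
proof (cases s)
  case 0
  then show ?thesis
    using proxy_pos[of g s i p W] stepsize_nonneg[of "Suc s"] by (simp add: mom_ratio_def)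
next
  case (Suc n)
  let ?h = "stepsize (Suc s)" and ?a = "proxy g s i p W" and ?b = "denom g s i"
  let ?w = "sqrt (1 - \<beta>2)" and ?m = "adam_m \<beta>1 g s i" and ?q = "adam_v \<beta>1 g s i"
  have a: "0 < ?a" by (rule proxy_pos)
  have b: "0 < ?b" unfolding Suc by (rule denom_pos)
  have h: "0 \<le> ?h" by (rule stepsize_nonneg)
  have "\<bar>?b - ?a\<bar> / ?a \<le> 1 / sqrt \<beta>2"
  proof -
    have "?b \<le> ?a / sqrt \<beta>2"
      using proxy_ge_denom[of g s i p W] beta2_pos by (simp add: pos_le_divide_eq mult.commute)
    moreover have "?a \<le> ?a / sqrt \<beta>2"
      using a beta2 beta2_pos by (simp add: pos_le_divide_eq)
    ultimately have "\<bar>?b - ?a\<bar> \<le> ?a / sqrt \<beta>2" using a b by linarith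
    then show ?thesis using a by (simp add: pos_divide_le_eq)
  qed
  then have "\<bar>?b - ?a\<bar> / ?a * \<bar>?b - ?a\<bar> \<le> 1 / sqrt \<beta>2 * (?w * (c + \<epsilon>0))"
    using proxy_near_previous_denom[OF c] a beta2_pos by (intro mult_mono) auto
  then have D: "(?b - ?a)\<^sup>2 / ?a \<le> ?w * (c + \<epsilon>0) / sqrt \<beta>2"
    by (simp add: power2_eq_square flip: abs_mult)
  have "2 * ?h * (\<kappa> * ?m)\<^sup>2 * (?b - ?a)\<^sup>2 / (?a * ?b\<^sup>2)
      = 2 * \<kappa>\<^sup>2 * (?h * ?m\<^sup>2) * ((?b - ?a)\<^sup>2 / ?a) / ?b\<^sup>2"
  proof -
    have "2 * h * (k * m)\<^sup>2 * D / (a * b\<^sup>2) = 2 * k\<^sup>2 * (h * m\<^sup>2) * (D / a) / b\<^sup>2"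
      for h k m a b D :: real by (simp add: power_mult_distrib)
    then show ?thesis .
  qed
  also have "\<dots> \<le> 2 * \<kappa>\<^sup>2 * (\<eta> * ?q) * (?w * (c + \<epsilon>0) / sqrt \<beta>2) / ?b\<^sup>2"
    using a C0 beta2 q_nonneg[of g s i]
    by (intro divide_right_mono[OF mult_mono[OF mult_left_mono[OF stepsize_Suc_mom_sq] D]]) auto
  also have "\<dots> = 2 * \<kappa>\<^sup>2 * C0 * (c + \<epsilon>0) / sqrt \<beta>2 * (?w\<^sup>2 * ?q / ?b\<^sup>2)"
    unfolding power2_eq_square[of ?w] by (simp only: mult_ac times_divide_eq_left times_divide_eq_right mult_1)
  also have "\<dots> = 2 * \<kappa>\<^sup>2 * C0 * (c + \<epsilon>0) / sqrt \<beta>2 * mom_ratio g s i"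
    using beta2 by (simp add: mom_ratio_def)
  finally have 1: "2 * ?h * (\<kappa> * ?m)\<^sup>2 * (?b - ?a)\<^sup>2 / (?a * ?b\<^sup>2)
      \<le> 2 * \<kappa>\<^sup>2 * C0 * (c + \<epsilon>0) / sqrt \<beta>2 * mom_ratio g s i" .
  have "?h * p * (\<kappa> * ?m) * (1 / ?b - 1 / ?a) = ?h * (- p) * (\<kappa> * ?m) * (1 / ?a - 1 / ?b)"
  proof -
    have "h * p * u * (x - y) = h * (- p) * u * (y - x)" for h u x y :: real
      by (simp add: algebra_simps)
    then show ?thesis .
  qed
  also have "\<dots> \<le> ?h * (- p)\<^sup>2 / (8 * ?a) + 2 * ?h * (\<kappa> * ?m)\<^sup>2 * (?b - ?a)\<^sup>2 / (?a * ?b\<^sup>2)"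
    by (rule young_reciprocal[OF h a b])
  finally show ?thesis using 1 by simp
qed

definition lookahead_step :: "(nat \<Rightarrow> nat \<Rightarrow> real) \<Rightarrow> nat \<Rightarrow> nat \<Rightarrow> real" where
  "lookahead_step g s i = - (stepsize (Suc s) * g (Suc s) i / denom g (Suc s) i)
     + \<kappa> * ((stepsize s / denom g s i - stepsize (Suc s) / denom g (Suc s) i) * adam_m \<beta>1 g s i)"

text \<open>
  The change of the quotient of step size and denominator is split into three parts: the step size changes
  over the old denominator, the old denominator changes to the proxy, and the proxy to the new
  denominator. The last two parts use the new step size.
\<close>

lemma coordinate_descent:
  fixes p W :: real
  assumes W: "0 \<le> W" and noise: "\<bar>g (Suc s) i - p\<bar> \<le> W"
    and c: "0 \<le> c" "adam_v \<beta>2 g s i \<le> c\<^sup>2" "p\<^sup>2 + W\<^sup>2 \<le> c\<^sup>2"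
  shows "p * lookahead_step g s i
    \<le> - (5/8 * (stepsize (Suc s) * p\<^sup>2 / proxy g s i p W))
      - stepsize (Suc s) * p * (g (Suc s) i - p) / proxy g s i p W
      + 8 * C0 / (1 - \<beta>1) * W * grad_ratio g (Suc s) i
      + (8 * \<kappa>\<^sup>2 * C0 / \<beta>2 * W + 2 * \<kappa>\<^sup>2 * C0 * (c + \<epsilon>0) / sqrt \<beta>2) * mom_ratio g s i
      + \<kappa> * (\<bar>p\<bar> * \<bar>stepsize (Suc s) - stepsize s\<bar> * \<bar>adam_m \<beta>1 g s i / denom g s i\<bar>)"
proof -
  let ?h = "stepsize (Suc s)" and ?a = "proxy g s i p W" and ?b = "denom g s i" and ?b' = "denom g (Suc s) i"
  let ?m = "adam_m \<beta>1 g s i"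
  have k: "0 \<le> \<kappa>" using beta1 beta1_less_1 by simp
  have "\<kappa> * (p * (stepsize s - ?h) * (?m / ?b)) \<le> \<kappa> * \<bar>p * (stepsize s - ?h) * (?m / ?b)\<bar>"
    by (rule mult_left_mono[OF abs_ge_self k])
  then have tv: "\<kappa> * (p * (stepsize s - ?h) * (?m / ?b))
      \<le> \<kappa> * (\<bar>p\<bar> * \<bar>?h - stepsize s\<bar> * \<bar>?m / ?b\<bar>)"
    by (simp add: abs_mult abs_minus_commute)
  have "p * lookahead_step g s i = - (?h * p * g (Suc s) i / ?b')
      + \<kappa> * (p * (stepsize s - ?h) * (?m / ?b))
      + ?h * p * (\<kappa> * ?m) * (1 / ?b - 1 / ?a) + ?h * p * (\<kappa> * ?m) * (1 / ?a - 1 / ?b')"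
  proof -
    have "X * (S * B - h * B') * m = X * (S - h) * (m * B) + h * X * m * (B - A) + h * X * m * (A - B')"
      for X S B h B' m A :: real by (simp add: algebra_simps)
    from this[of "\<kappa> * p" "stepsize s" "1 / ?b" ?h "1 / ?b'" ?m "1 / ?a"] show ?thesis
      unfolding lookahead_step_def distrib_left by (simp add: mult_ac)
  qed
  also have "\<dots> \<le> (- (7/8 * (?h * p\<^sup>2 / ?a)) - ?h * p * (g (Suc s) i - p) / ?a
        + 8 * C0 / (1 - \<beta>1) * W * grad_ratio g (Suc s) i)
      + \<kappa> * (\<bar>p\<bar> * \<bar>?h - stepsize s\<bar> * \<bar>?m / ?b\<bar>)
      + (?h * p\<^sup>2 / (8 * ?a) + 2 * \<kappa>\<^sup>2 * C0 * (c + \<epsilon>0) / sqrt \<beta>2 * mom_ratio g s i)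
      + (?h * p\<^sup>2 / (8 * ?a) + 8 * \<kappa>\<^sup>2 * C0 / \<beta>2 * W * mom_ratio g s i)"
    by (intro add_mono fresh_gradient_term new_momentum_term old_momentum_term tv assms)
  also have "?h * p\<^sup>2 / (8 * ?a) = 1/8 * (?h * p\<^sup>2 / ?a)" by simp
  finally show ?thesis unfolding distrib_right by linarith
qed

end

section \<open>Descent along a run\<close>

text \<open>
  The assumptions of \<open>adam_path\<close> do not constrain the answers \<open>g\<close>, so that its definitions make sense at every sample
  point. The noise bound comes later, in \<open>adam_run\<close>.
\<close>

locale adam_path = adam_parameters +
  fixes d T :: nat and L :: real and f :: "(nat \<Rightarrow> real) \<Rightarrow> real" and fstar :: real
    and x1 :: "nat \<Rightarrow> real" and g :: "nat \<Rightarrow> nat \<Rightarrow> real" and s0 s1 :: real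
  assumes L_pos: "0 < L" and smooth: "L_smooth d L f" and x1: "x1 \<in> space (Rd d)"
    and below: "\<And>y. y \<in> space (Rd d) \<Longrightarrow> fstar \<le> f y"
    and d_pos: "1 \<le> d" and s0: "0 < s0" and s1: "0 \<le> s1"
begin

definition iter :: "nat \<Rightarrow> nat \<Rightarrow> real" where
  "iter s = adam_x d \<beta>1 \<beta>2 \<eta> \<epsilon> x1 g s"

text \<open>
  Index \<open>s\<close> belongs to the query at iterate \<open>s + 1\<close>, as in the sample space, and sums over all
  steps run over \<open>s < T\<close>.
\<close>

definition grad :: "nat \<Rightarrow> nat \<Rightarrow> real" where
  "grad s = gradient d f (iter (Suc s))"

definition spread :: "nat \<Rightarrow> nat \<Rightarrow> real" where
  "spread s i = sqrt (s0\<^sup>2 + s1\<^sup>2 * (grad s i)\<^sup>2)"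

definition weight :: "nat \<Rightarrow> nat \<Rightarrow> real" where
  "weight s i = stepsize (Suc s) / proxy g s i (grad s i) (spread s i)"

text \<open>
  At index \<open>0\<close> both iterates are the initial point, so the look-ahead points start there as well.
\<close>

definition lookahead :: "nat \<Rightarrow> nat \<Rightarrow> real" where
  "lookahead s = (\<lambda>i\<in>{1..d}. iter (Suc s) i + \<kappa> * (iter (Suc s) i - iter s i))"

definition energy :: "nat \<Rightarrow> real" where
  "energy t = (\<Sum>s<t. \<Sum>i=1..d. weight s i * (grad s i)\<^sup>2)"

text \<open>
  As \<open>s\<close> varies, these are martingale increments; \<open>noise_range\<close> bounds them before the query.
\<close>

definition noise_term :: "nat \<Rightarrow> real" where
  "noise_term s = (\<Sum>i=1..d. - weight s i * grad s i * (g (Suc s) i - grad s i))"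

definition noise_range :: "nat \<Rightarrow> real" where
  "noise_range s = (\<Sum>i=1..d. \<bar>weight s i * grad s i\<bar> * spread s i)"

lemma iter_space: "iter s \<in> space (Rd d)"
  unfolding iter_def by (rule adam_x_in_space[OF x1])

lemma lookahead_space: "lookahead s \<in> space (Rd d)"
  by (simp add: lookahead_def space_Rd)

lemma iter_Suc_diff:
  "i \<in> {1..d} \<Longrightarrow> iter (Suc s) i - iter s i = - (stepsize s * adam_m \<beta>1 g s i / denom g s i)"
  by (cases s) (auto simp: iter_def stepsize_def denom_def)

lemma lookahead_0: "lookahead 0 = x1"
proof -
  have "lookahead 0 = restrict x1 {1..d}" unfolding lookahead_def by (rule restrict_ext) (simp add: iter_def)
  also have "\<dots> = x1" using x1 unfolding space_Rd by (rule PiE_restrict)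
  finally show ?thesis .
qed

lemma iter_1: "iter (Suc 0) = x1"
  by (simp add: iter_def)

text \<open>
  The new displacement is counted \<open>1 + \<kappa> = 1 / (1 - \<beta>1)\<close> times, which turns the new momentum into the
  fresh answer plus \<open>\<kappa>\<close> times the old momentum.
\<close>

lemma lookahead_Suc_diff:
  assumes i: "i \<in> {1..d}"
  shows "lookahead (Suc s) i - lookahead s i = lookahead_step g s i"
proof -
  have split: "h' / b' * (\<beta>1 * m + (1 - \<beta>1) * u) + \<kappa> * (h' / b' * (\<beta>1 * m + (1 - \<beta>1) * u))
      = h' * u / b' + \<kappa> * (h' / b' * m)" for h' b' m u :: real
  proof -
    have "h' / b' * (\<beta>1 * m + (1 - \<beta>1) * u) + \<kappa> * (h' / b' * (\<beta>1 * m + (1 - \<beta>1) * u))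
      = h' / b' * ((1 + \<kappa>) * (\<beta>1 * m + (1 - \<beta>1) * u))" by (simp only: algebra_simps)
    also have "(1 + \<kappa>) * (\<beta>1 * m + (1 - \<beta>1) * u) = \<kappa> * m + u"
      using beta1_less_1 by (simp add: field_simps)
    finally show ?thesis by (simp add: algebra_simps)
  qed
  have "lookahead (Suc s) i - lookahead s i = (iter (Suc (Suc s)) i - iter (Suc s) i)
      + \<kappa> * (iter (Suc (Suc s)) i - iter (Suc s) i) - \<kappa> * (iter (Suc s) i - iter s i)"
    using i by (simp add: lookahead_def)
  also have "\<dots> = - (stepsize (Suc s) / denom g (Suc s) i * adam_m \<beta>1 g (Suc s) i
      + \<kappa> * (stepsize (Suc s) / denom g (Suc s) i * adam_m \<beta>1 g (Suc s) i))
      + \<kappa> * (stepsize s / denom g s i * adam_m \<beta>1 g s i)"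
    unfolding iter_Suc_diff[OF i] by (simp del: adam_m.simps)
  also have "\<dots> = lookahead_step g s i"
    unfolding adam_m.simps split lookahead_step_def by (simp add: algebra_simps)
  finally show ?thesis .
qed

lemma spread_pos: "0 < spread s i"
  using s0 by (simp add: spread_def add_pos_nonneg)

lemma weight_pos: "0 < weight s i"
  unfolding weight_def by (intro divide_pos_pos stepsize_pos proxy_pos)

lemma weight_spread_le: "weight s i * spread s i \<le> C0 / (1 - \<beta>1)"
proof -
  let ?a = "proxy g s i (grad s i) (spread s i)"
  have "weight s i * spread s i = stepsize (Suc s) * (spread s i / ?a)" by (simp add: weight_def)
  also have "\<dots> \<le> (\<eta> / (1 - \<beta>1)) * (1 / sqrt (1 - \<beta>2))"
  proof (rule mult_mono[OF stepsize_le])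
    have "spread s i \<le> 1 / sqrt (1 - \<beta>2) * ?a"
      using proxy_ge_noise[of "spread s i" g s i "grad s i"] beta2 by (simp add: field_simps)
    then show "spread s i / ?a \<le> 1 / sqrt (1 - \<beta>2)"
      using proxy_pos[of g s i] by (simp only: pos_divide_le_eq)
    show "0 \<le> spread s i / ?a"
      using proxy_pos[of g s i "grad s i" "spread s i"] spread_pos[of s i] by simp
    show "0 \<le> \<eta> / (1 - \<beta>1)" using eta_pos beta1_less_1 by simp
  qed
  also have "\<dots> = C0 / (1 - \<beta>1)" using beta2 by simp
  finally show ?thesis .
qed

lemma kappa_nonneg: "0 \<le> \<kappa>"
  using beta1 beta1_less_1 by simp

lemma lookahead_gradient_diff:
  "l2norm d (\<lambda>i. gradient d f (lookahead s) i - grad s i) \<le> L * (\<kappa> * l2norm d (\<lambda>i. iter (Suc s) i - iter s i))"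
proof -
  have "l2norm d (\<lambda>i. lookahead s i - iter (Suc s) i) = l2norm d (\<lambda>i. \<kappa> * (iter (Suc s) i - iter s i))"
    by (rule l2norm_cong) (simp add: lookahead_def)
  also have "\<dots> = \<kappa> * l2norm d (\<lambda>i. iter (Suc s) i - iter s i)"
    by (simp only: l2norm_scale abs_of_nonneg[OF kappa_nonneg])
  finally show ?thesis
    using smooth lookahead_space[of s] iter_space[of "Suc s"] unfolding L_smooth_def grad_def by metis
qed

lemma displacement_sum_sq_le:
  "(l2norm d (\<lambda>i. iter (Suc s) i - iter s i))\<^sup>2
    \<le> C0\<^sup>2 / (1 - \<beta>1) * (\<Sum>i=1..d. mom_ratio g s i)"
  unfolding l2norm_sq sum_distrib_left
proof (rule sum_mono)
  fix i assume "i \<in> {1..d}"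
  then show "(iter (Suc s) i - iter s i)\<^sup>2 \<le> C0\<^sup>2 / (1 - \<beta>1) * mom_ratio g s i"
    using displacement_sq_le[of s g i] by (simp only: iter_Suc_diff power2_minus)
qed

lemma displacement_sum_le: "(l2norm d (\<lambda>i. iter (Suc s) i - iter s i))\<^sup>2 \<le> real d * C0\<^sup>2"
proof -
  have "(l2norm d (\<lambda>i. iter (Suc s) i - iter s i))\<^sup>2 \<le> (\<Sum>i=1..d. C0\<^sup>2)"
    unfolding l2norm_sq
  proof (rule sum_mono)
    fix i assume "i \<in> {1..d}"
    then show "(iter (Suc s) i - iter s i)\<^sup>2 \<le> C0\<^sup>2"
      using displacement_le[of s g i] by (simp only: iter_Suc_diff power2_minus)
  qed
  then show ?thesis by simp
qed

lemma shift_sum_sq_le: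
  "(l2norm d (lookahead_step g s))\<^sup>2 \<le> 2 * (C0\<^sup>2 / (1 - \<beta>1)\<^sup>2) * (\<Sum>i=1..d. grad_ratio g (Suc s) i)
    + 2 * (\<kappa>\<^sup>2 * (Sigma_max \<beta>2)\<^sup>2 * (C0\<^sup>2 / (1 - \<beta>1))) * (\<Sum>i=1..d. mom_ratio g s i)"
  unfolding l2norm_sq sum_distrib_left sum.distrib[symmetric]
proof (rule sum_mono)
  fix i assume i: "i \<in> {1..d}"
  define u w where "u = stepsize (Suc s) * g (Suc s) i / denom g (Suc s) i"
    and "w = (stepsize s / denom g s i - stepsize (Suc s) / denom g (Suc s) i) * adam_m \<beta>1 g s i"
  have u: "u\<^sup>2 \<le> C0\<^sup>2 / (1 - \<beta>1)\<^sup>2 * grad_ratio g (Suc s) i"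
  proof -
    have "(stepsize (Suc s))\<^sup>2 \<le> (\<eta> / (1 - \<beta>1))\<^sup>2"
      using stepsize_le stepsize_nonneg by (rule power_mono)
    then have "(stepsize (Suc s))\<^sup>2 * ((g (Suc s) i)\<^sup>2 / (denom g (Suc s) i)\<^sup>2)
        \<le> (\<eta> / (1 - \<beta>1))\<^sup>2 * ((g (Suc s) i)\<^sup>2 / (denom g (Suc s) i)\<^sup>2)"
      by (intro mult_right_mono) auto
    then show ?thesis using beta2
      by (simp add: u_def grad_ratio_def power_mult_distrib power_divide)
  qed
  have "\<bar>w\<bar>\<^sup>2 \<le> (Sigma_max \<beta>2 * \<bar>stepsize s * adam_m \<beta>1 g s i / denom g s i\<bar>)\<^sup>2"
    unfolding w_def by (rule power_mono[OF step_ratio_change_le]) simp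
  also have "\<dots> \<le> (Sigma_max \<beta>2)\<^sup>2 * (C0\<^sup>2 / (1 - \<beta>1) * mom_ratio g s i)"
    unfolding power_mult_distrib power2_abs
    using displacement_sq_le[of s g i] by (intro mult_left_mono) (auto simp: power_mult_distrib)
  finally have w: "\<kappa>\<^sup>2 * w\<^sup>2 \<le> \<kappa>\<^sup>2 * ((Sigma_max \<beta>2)\<^sup>2 * (C0\<^sup>2 / (1 - \<beta>1) * mom_ratio g s i))"
    by (intro mult_left_mono) auto
  have "(lookahead_step g s i)\<^sup>2 = (- u + \<kappa> * w)\<^sup>2" by (simp add: lookahead_step_def u_def w_def)
  also have "\<dots> \<le> 2 * u\<^sup>2 + 2 * (\<kappa> * w)\<^sup>2"
    using zero_le_power2[of "u + \<kappa> * w"] by (simp add: power2_sum power2_diff algebra_simps)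
  also have "(\<kappa> * w)\<^sup>2 = \<kappa>\<^sup>2 * w\<^sup>2" by (rule power_mult_distrib)
  finally have "(lookahead_step g s i)\<^sup>2 \<le> 2 * (C0\<^sup>2 / (1 - \<beta>1)\<^sup>2 * grad_ratio g (Suc s) i)
      + 2 * (\<kappa>\<^sup>2 * ((Sigma_max \<beta>2)\<^sup>2 * (C0\<^sup>2 / (1 - \<beta>1) * mom_ratio g s i)))"
    using u w by linarith
  then show "(lookahead_step g s i)\<^sup>2 \<le> 2 * (C0\<^sup>2 / (1 - \<beta>1)\<^sup>2) * grad_ratio g (Suc s) i
      + 2 * (\<kappa>\<^sup>2 * (Sigma_max \<beta>2)\<^sup>2 * (C0\<^sup>2 / (1 - \<beta>1))) * mom_ratio g s i"
    by (simp only: mult.assoc)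
qed

text \<open>
  The gradient is queried at the iterate and not at the look-ahead point. By smoothness the
  difference is of second order, like the quadratic term of the descent lemma.
\<close>

lemma lookahead_descent:
  "f (lookahead (Suc s)) \<le> f (lookahead s) + inner_d d (grad s) (lookahead_step g s)
    + 2 * L * C0\<^sup>2 / (1 - \<beta>1)\<^sup>2 * (\<Sum>i=1..d. grad_ratio g (Suc s) i)
    + L * (2 * (Sigma_max \<beta>2)\<^sup>2 + 1/2) * \<kappa>\<^sup>2 * C0\<^sup>2 / (1 - \<beta>1) * (\<Sum>i=1..d. mom_ratio g s i)"
proof -
  let ?D = "l2norm d (\<lambda>i. iter (Suc s) i - iter s i)" and ?S = "l2norm d (lookahead_step g s)"
  have sh: "inner_d d v (\<lambda>i. lookahead (Suc s) i - lookahead s i) = inner_d d v (lookahead_step g s)" for v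
    by (rule sum.cong) (simp_all add: lookahead_Suc_diff)
  have nsh: "l2norm d (\<lambda>i. lookahead (Suc s) i - lookahead s i) = ?S"
    by (rule l2norm_cong) (simp add: lookahead_Suc_diff)
  have "f (lookahead (Suc s)) \<le> f (lookahead s) + inner_d d (gradient d f (lookahead s)) (lookahead_step g s) + L / 2 * ?S\<^sup>2"
    using descent_lemma[OF smooth _ lookahead_space[of s] lookahead_space[of "Suc s"]] L_pos
    unfolding sh nsh by simp
  also have "inner_d d (gradient d f (lookahead s)) (lookahead_step g s)
      = inner_d d (grad s) (lookahead_step g s) + inner_d d (\<lambda>i. gradient d f (lookahead s) i - grad s i) (lookahead_step g s)"
    by (simp add: left_diff_distrib sum_subtractf)
  also have "inner_d d (\<lambda>i. gradient d f (lookahead s) i - grad s i) (lookahead_step g s)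
      \<le> (L * (\<kappa> * ?D)) * ?S"
  proof -
    have "inner_d d (\<lambda>i. gradient d f (lookahead s) i - grad s i) (lookahead_step g s)
        \<le> l2norm d (\<lambda>i. gradient d f (lookahead s) i - grad s i) * ?S"
      using inner_d_le[where d = d and u = "\<lambda>i. gradient d f (lookahead s) i - grad s i" and v = "lookahead_step g s"]
      by linarith
    also have "\<dots> \<le> (L * (\<kappa> * ?D)) * ?S"
      by (rule mult_right_mono[OF lookahead_gradient_diff l2norm_nonneg])
    finally show ?thesis .
  qed
  also have "(L * (\<kappa> * ?D)) * ?S \<le> L / 2 * (\<kappa>\<^sup>2 * ?D\<^sup>2) + L / 2 * ?S\<^sup>2"
  proof -
    have "(L * (k * D)) * S \<le> L / 2 * (k\<^sup>2 * D\<^sup>2) + L / 2 * S\<^sup>2" for k D S :: real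
    proof -
      have "L / 2 * (2 * (k * D) * S) \<le> L / 2 * ((k * D)\<^sup>2 + S\<^sup>2)"
        using L_pos by (intro mult_left_mono sum_squares_bound) auto
      then show ?thesis by (simp add: power_mult_distrib algebra_simps)
    qed
    then show ?thesis .
  qed
  finally have 1: "f (lookahead (Suc s)) \<le> f (lookahead s) + inner_d d (grad s) (lookahead_step g s)
      + L / 2 * \<kappa>\<^sup>2 * ?D\<^sup>2 + L * ?S\<^sup>2" by (simp add: mult.assoc)
  have "L / 2 * \<kappa>\<^sup>2 * ?D\<^sup>2 \<le> L / 2 * \<kappa>\<^sup>2 * (C0\<^sup>2 / (1 - \<beta>1) * (\<Sum>i=1..d. mom_ratio g s i))"
    using L_pos by (intro mult_left_mono displacement_sum_sq_le) auto
  moreover have "L * ?S\<^sup>2 \<le> L * (2 * (C0\<^sup>2 / (1 - \<beta>1)\<^sup>2) * (\<Sum>i=1..d. grad_ratio g (Suc s) i)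
    + 2 * (\<kappa>\<^sup>2 * (Sigma_max \<beta>2)\<^sup>2 * (C0\<^sup>2 / (1 - \<beta>1))) * (\<Sum>i=1..d. mom_ratio g s i))"
    using L_pos by (intro mult_left_mono shift_sum_sq_le) auto
  moreover have "L / 2 * k * (c / u * m) + L * (2 * (c / v) * z + 2 * (k * S * (c / u)) * m)
      = 2 * L * c / v * z + L * (2 * S + 1/2) * k * c / u * m" for k c u m v z S :: real
    by (simp add: algebra_simps add_divide_distrib)
  ultimately show ?thesis using 1 by (smt (verit, ccfv_SIG))
qed

definition F :: real where
  "F = adam_F d T L C0 \<epsilon> \<beta>1 \<beta>2 s0 s1 (l2norm d (gradient d f x1))"

definition Lg :: real where
  "Lg = ln (F / \<beta>2 ^ T)"

definition G :: "real \<Rightarrow> real" where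
  "G \<delta> = adam_G d T L C0 \<epsilon>0 \<beta>1 \<beta>2 s0 s1 (f x1 - fstar) F \<delta>"

definition spread_bound :: "real \<Rightarrow> real" where
  "spread_bound D = s0 + s1 * sqrt D"

definition answer_bound :: "real \<Rightarrow> real" where
  "answer_bound D = sqrt (2 * (s0\<^sup>2 + (1 + s1\<^sup>2) * D))"

text \<open>
  The parameter of the exponential moment of the noise. It is so small that the compensator
  \<open>tilt D / 2 * (noise_range s)\<^sup>2\<close> adds up to at most a quarter of the energy, as long as the gradients
  are below the level \<open>D\<close>.
\<close>

definition tilt :: "real \<Rightarrow> real" where
  "tilt D = (1 - \<beta>1) / (2 * real d * C0 * spread_bound D)"

text \<open>
  The stopping rule: once a gradient has exceeded the level, this stays false.
\<close>

definition below_level :: "real \<Rightarrow> nat \<Rightarrow> bool" where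
  "below_level D s \<longleftrightarrow> (\<forall>j\<le>s. (l2norm d (grad j))\<^sup>2 \<le> D)"

definition compensated_noise :: "real \<Rightarrow> nat \<Rightarrow> real" where
  "compensated_noise D s = tilt D * noise_term s - (tilt D)\<^sup>2 / 2 * (noise_range s)\<^sup>2"

definition stopped_noise :: "real \<Rightarrow> nat \<Rightarrow> real" where
  "stopped_noise D s = (if below_level D s then compensated_noise D s else 0)"

definition noise_within :: "nat \<Rightarrow> bool" where
  "noise_within s \<longleftrightarrow> (\<forall>i\<in>{1..d}. \<bar>g (Suc s) i - grad s i\<bar> \<le> spread s i)"

text \<open>
  A crude bound, valid without control of the level, since every coordinate moves by at most \<open>C0\<close> in a step.
  It is used inside the logarithm of \<open>F\<close> only, where polynomial growth is harmless.
\<close>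

lemma gradient_growth: "l2norm d (grad s) \<le> l2norm d (gradient d f x1) + L * (s * (sqrt (real d) * C0))"
proof (induction s)
  case 0
  show ?case by (simp add: grad_def iter_1)
next
  case (Suc s)
  have "l2norm d (grad (Suc s)) = l2norm d (\<lambda>i. grad s i + (grad (Suc s) i - grad s i))" by simp
  also have "\<dots> \<le> l2norm d (grad s) + l2norm d (\<lambda>i. grad (Suc s) i - grad s i)"
    unfolding l2norm_def by (rule L2_set_triangle_ineq)
  also have "l2norm d (\<lambda>i. grad (Suc s) i - grad s i) \<le> L * l2norm d (\<lambda>i. iter (Suc (Suc s)) i - iter (Suc s) i)"
    using smooth iter_space unfolding L_smooth_def grad_def by blast
  also have "\<dots> \<le> L * (sqrt (real d) * C0)"
  proof -
    have "l2norm d (\<lambda>i. iter (Suc (Suc s)) i - iter (Suc s) i) \<le> sqrt (real d * C0\<^sup>2)"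
      using displacement_sum_le by (rule real_le_rsqrt)
    then show ?thesis using L_pos C0 by (intro mult_left_mono) (auto simp: real_sqrt_mult)
  qed
  finally show ?case using Suc by (simp add: algebra_simps)
qed

lemma component_sq_le: "i \<in> {1..d} \<Longrightarrow> (grad s i)\<^sup>2 \<le> (l2norm d (grad s))\<^sup>2"
  using power_mono[OF component_le_l2norm[of i d "grad s"], of 2] by simp

end

locale adam_run = adam_path +
  assumes noise: "\<And>s. s < T \<Longrightarrow> noise_within s"
begin

lemma answer_sq_le:
  assumes "s < T" "i \<in> {1..d}"
  shows "(g (Suc s) i)\<^sup>2 \<le> 2 * (s0\<^sup>2 + (1 + s1\<^sup>2) * (grad s i)\<^sup>2)"
proof -
  have "(g (Suc s) i - grad s i)\<^sup>2 \<le> s0\<^sup>2 + s1\<^sup>2 * (grad s i)\<^sup>2"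
    using noise[OF assms(1)] assms(2) unfolding noise_within_def spread_def by (intro sqrt_ge_absD) blast
  moreover have "(g (Suc s) i)\<^sup>2 \<le> 2 * (grad s i)\<^sup>2 + 2 * (g (Suc s) i - grad s i)\<^sup>2"
    using zero_le_power2[of "g (Suc s) i - 2 * grad s i"] by (simp add: power2_diff algebra_simps)
  ultimately show ?thesis by (simp add: algebra_simps)
qed

lemma sum_answers_le_F:
  assumes t: "t \<le> T" and i: "i \<in> {1..d}"
  shows "1 + (\<Sum>s<t. (g (Suc s) i)\<^sup>2) / \<epsilon>\<^sup>2
    \<le> F"
proof -
  let ?g1 = "l2norm d (gradient d f x1)"
  let ?M = "2 * ?g1\<^sup>2 + 2 * (L\<^sup>2 * ((real T)\<^sup>2 * (real d * C0\<^sup>2)))"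
  let ?M' = "2 * ?g1\<^sup>2 + 2 * (L\<^sup>2 * ((real T)\<^sup>2 * (real d * C0\<^sup>2))) / (1 - \<rho>)"
  have grad_le: "(grad s i)\<^sup>2 \<le> ?M" if "s < T" for s
  proof -
    have "l2norm d (grad s) \<le> ?g1 + L * (T * (sqrt (real d) * C0))"
      using gradient_growth[of s] that L_pos C0
      by (meson add_left_mono less_imp_le mult_left_mono mult_right_mono mult_nonneg_nonneg of_nat_mono
          order_trans real_sqrt_ge_zero of_nat_0_le_iff)
    then have "(l2norm d (grad s))\<^sup>2 \<le> (?g1 + L * (T * (sqrt (real d) * C0)))\<^sup>2"
      by (rule power_mono[OF _ l2norm_nonneg])
    also have "\<dots> \<le> 2 * ?g1\<^sup>2 + 2 * (L * (T * (sqrt (real d) * C0)))\<^sup>2"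
      using zero_le_power2[of "?g1 - L * (T * (sqrt (real d) * C0))"] by (simp add: power2_sum power2_diff)
    also have "(L * (T * (sqrt (real d) * C0)))\<^sup>2 = L\<^sup>2 * ((real T)\<^sup>2 * (real d * C0\<^sup>2))"
      by (simp add: power_mult_distrib)
    finally show ?thesis using component_sq_le[OF i, of s] by linarith
  qed
  have MM: "?M \<le> ?M'"
  proof -
    have "X \<le> X / (1 - \<rho>)" if "0 \<le> X" for X
      using mult_left_mono[of "1 - \<rho>" 1 X] rho that by (simp add: pos_le_divide_eq)
    then show ?thesis by simp
  qed
  have "(\<Sum>s<t. (g (Suc s) i)\<^sup>2) \<le> (\<Sum>s<T. 2 * (s0\<^sup>2 + (1 + s1\<^sup>2) * ?M'))"
  proof -
    have "(\<Sum>s<t. (g (Suc s) i)\<^sup>2) \<le> (\<Sum>s<T. (g (Suc s) i)\<^sup>2)"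
      using t by (intro sum_mono2) auto
    also have "\<dots> \<le> (\<Sum>s<T. 2 * (s0\<^sup>2 + (1 + s1\<^sup>2) * ?M'))"
    proof (rule sum_mono)
      fix s assume "s \<in> {..<T}"
      then have s: "s < T" by simp
      show "(g (Suc s) i)\<^sup>2 \<le> 2 * (s0\<^sup>2 + (1 + s1\<^sup>2) * ?M')"
        using order_trans[OF grad_le[OF s] MM]
        by (intro order_trans[OF answer_sq_le[OF s i]] mult_left_mono add_left_mono) auto
    qed
    finally show ?thesis .
  qed
  then have "(\<Sum>s<t. (g (Suc s) i)\<^sup>2) / \<epsilon>\<^sup>2 \<le> (T * (2 * (s0\<^sup>2 + (1 + s1\<^sup>2) * ?M'))) / \<epsilon>\<^sup>2"
    by (intro divide_right_mono) auto
  also have "1 + (T * (2 * (s0\<^sup>2 + (1 + s1\<^sup>2) * ?M'))) / \<epsilon>\<^sup>2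
      = F"
    unfolding F_def adam_F_def by (simp add: algebra_simps power2_eq_square power3_eq_cube add_divide_distrib)
  finally show ?thesis by simp
qed

lemma sum_grad_ratio_le_Lg:
  assumes t: "t \<le> T" and i: "i \<in> {1..d}"
  shows "(\<Sum>s<t. grad_ratio g (Suc s) i) \<le> Lg"
proof -
  have S: "0 \<le> (\<Sum>s<t. (g (Suc s) i)\<^sup>2) / \<epsilon>\<^sup>2" by (intro divide_nonneg_nonneg sum_nonneg) auto
  have "ln ((1 + (\<Sum>s<t. (g (Suc s) i)\<^sup>2) / \<epsilon>\<^sup>2) / \<beta>2 ^ t) \<le> Lg"
    unfolding Lg_def using sum_answers_le_F[OF t i] S beta2 beta2_pos power_decreasing[OF t, of \<beta>2]
    by (intro ln_mono frac_le divide_pos_pos add_pos_nonneg) auto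
  then show ?thesis using sum_grad_ratio_le[of g i t] by linarith
qed

lemma sum_mom_ratio_le_Lg:
  assumes t: "t \<le> T" and i: "i \<in> {1..d}"
  shows "(\<Sum>s<t. mom_ratio g s i) \<le> (1 - \<beta>1) / (1 - \<rho>) * Lg"
proof -
  have "(\<Sum>s<t. mom_ratio g s i) \<le> (\<Sum>s\<le>t. mom_ratio g s i)"
    using mom_ratio_nonneg by (intro sum_mono2) auto
  also have "\<dots> \<le> (1 - \<beta>1) / (1 - \<rho>) * (\<Sum>s<t. grad_ratio g (Suc s) i)" by (rule sum_mom_ratio_le)
  also have "\<dots> \<le> (1 - \<beta>1) / (1 - \<rho>) * Lg"
    using sum_grad_ratio_le_Lg[OF t i] rho beta1_less_1 by (intro mult_left_mono) auto
  finally show ?thesis .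
qed

text \<open>
  The momentum vanishes at index \<open>0\<close>, so that the jump of the step size from its default value \<open>0\<close>
  does not contribute.
\<close>

lemma stepsize_change_term:
  assumes bnd: "\<And>s. s < t \<Longrightarrow> \<bar>grad s i\<bar> \<le> D" and D: "0 \<le> D"
  shows "(\<Sum>s<t. \<bar>grad s i\<bar> * \<bar>stepsize (Suc s) - stepsize s\<bar> * \<bar>adam_m \<beta>1 g s i / denom g s i\<bar>)
    \<le> 2 * C0 * D / sqrt (1 - \<beta>1)"
proof (cases t)
  case (Suc n)
  let ?r = "\<lambda>s. \<bar>adam_m \<beta>1 g s i / denom g s i\<bar>"
  have r: "?r s \<le> sqrt (1 - \<beta>1) / sqrt (1 - \<beta>2)" for s
    using mom_over_denom_le[of g s i] beta2 by (simp add: pos_le_divide_eq mult.commute)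
  have "(\<Sum>s<t. \<bar>grad s i\<bar> * \<bar>stepsize (Suc s) - stepsize s\<bar> * ?r s)
      = (\<Sum>s<n. \<bar>grad (Suc s) i\<bar> * \<bar>stepsize (Suc (Suc s)) - stepsize (Suc s)\<bar> * ?r (Suc s))"
    unfolding Suc sum.lessThan_Suc_shift by (simp del: adam_m.simps(2))
  also have "\<dots> \<le> (\<Sum>s<n. D * \<bar>stepsize (Suc (Suc s)) - stepsize (Suc s)\<bar> * (sqrt (1 - \<beta>1) / sqrt (1 - \<beta>2)))"
    by (intro sum_mono mult_mono mult_nonneg_nonneg D r bnd) (auto simp: Suc)
  also have "\<dots> = D * (sqrt (1 - \<beta>1) / sqrt (1 - \<beta>2)) * (\<Sum>s<n. \<bar>stepsize (Suc (Suc s)) - stepsize (Suc s)\<bar>)"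
    unfolding sum_distrib_left by (rule sum.cong) simp_all
  also have "\<dots> \<le> D * (sqrt (1 - \<beta>1) / sqrt (1 - \<beta>2)) * (2 * \<eta> / (1 - \<beta>1))"
    using D beta1_less_1 beta2 by (intro mult_left_mono stepsize_variation mult_nonneg_nonneg) auto
  also have "\<dots> = 2 * C0 * D * (sqrt (1 - \<beta>1) / (1 - \<beta>1))" using beta2 by simp
  also have "sqrt (1 - \<beta>1) / (1 - \<beta>1) = 1 / sqrt (1 - \<beta>1)"
    using beta1_less_1 real_div_sqrt[of "1 - \<beta>1"] by (simp add: field_simps)
  finally show ?thesis by simp
qed (use D C0 beta1_less_1 in simp)

lemma Lg_nonneg: "0 \<le> Lg"
  using order_trans[OF sum_nonneg[OF grad_ratio_nonneg] sum_grad_ratio_le_Lg[of 0 1]] d_pos by simp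

lemma answer_bound_sq: "0 \<le> D \<Longrightarrow> (answer_bound D)\<^sup>2 = 2 * (s0\<^sup>2 + (1 + s1\<^sup>2) * D)"
  by (simp add: answer_bound_def)

lemma answer_bound_nonneg: "0 \<le> D \<Longrightarrow> 0 \<le> answer_bound D"
  by (simp add: answer_bound_def)

lemma spread_sq: "(spread s i)\<^sup>2 = s0\<^sup>2 + s1\<^sup>2 * (grad s i)\<^sup>2"
  by (simp add: spread_def)

lemma answer_le_bound:
  assumes "s < T" "i \<in> {1..d}" "(grad s i)\<^sup>2 \<le> D"
  shows "(g (Suc s) i)\<^sup>2 \<le> (answer_bound D)\<^sup>2"
proof -
  have D: "0 \<le> D" using assms(3) order_trans zero_le_power2 by blast
  have "(1 + s1\<^sup>2) * (grad s i)\<^sup>2 \<le> (1 + s1\<^sup>2) * D" using assms(3) by (intro mult_left_mono) auto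
  then show ?thesis using answer_sq_le[OF assms(1,2)] unfolding answer_bound_sq[OF D] by argo
qed

lemma grad_spread_le_bound:
  assumes "(grad s i)\<^sup>2 \<le> D"
  shows "(grad s i)\<^sup>2 + (spread s i)\<^sup>2 \<le> (answer_bound D)\<^sup>2"
proof -
  have D: "0 \<le> D" using assms order_trans zero_le_power2 by blast
  have "(1 + s1\<^sup>2) * (grad s i)\<^sup>2 \<le> (1 + s1\<^sup>2) * D" using assms by (intro mult_left_mono) auto
  then have "(grad s i)\<^sup>2 + (spread s i)\<^sup>2 \<le> s0\<^sup>2 + (1 + s1\<^sup>2) * D"
    unfolding spread_sq by (simp add: algebra_simps)
  moreover have "0 \<le> s0\<^sup>2 + (1 + s1\<^sup>2) * D" using D by simp
  moreover have "x \<le> 2 * y" if "x \<le> y" "0 \<le> y" for x y :: real using that by linarith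
  ultimately show ?thesis unfolding answer_bound_sq[OF D] by blast
qed

lemma v_le_bound:
  assumes t: "s \<le> T" and i: "i \<in> {1..d}" and bnd: "\<And>j. j < s \<Longrightarrow> (grad j i)\<^sup>2 \<le> D"
  shows "adam_v \<beta>2 g s i \<le> (1 - \<beta>2 ^ s) * (answer_bound D)\<^sup>2"
proof (rule adam_v_le)
  fix j assume j: "j \<in> {1..s}"
  then obtain k where k: "j = Suc k" "k < s" by (cases j) auto
  then show "(g j i)\<^sup>2 \<le> (answer_bound D)\<^sup>2"
    using answer_le_bound[of k i D] bnd[of k] t i by simp
qed (use beta2 beta2_pos in auto)

lemma spread_le_bound:
  assumes "(grad s i)\<^sup>2 \<le> D"
  shows "spread s i \<le> spread_bound D"
proof -
  have "s1\<^sup>2 * (grad s i)\<^sup>2 \<le> s1\<^sup>2 * D" using assms by (intro mult_left_mono) auto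
  then have "spread s i \<le> sqrt (s0\<^sup>2 + s1\<^sup>2 * D)" by (simp add: spread_def)
  also have "\<dots> \<le> sqrt (s0\<^sup>2) + sqrt (s1\<^sup>2 * D)"
    using assms order_trans[OF zero_le_power2 assms] by (intro sqrt_add_le_add_sqrt) auto
  also have "\<dots> = spread_bound D"
    using s0 s1 by (simp add: spread_bound_def real_sqrt_mult)
  finally show ?thesis .
qed

lemma spread_bound_pos: "0 \<le> D \<Longrightarrow> 0 < spread_bound D"
  using s0 s1 by (simp add: spread_bound_def add_pos_nonneg)

definition fresh_coeff :: "real \<Rightarrow> real" where
  "fresh_coeff D = 8 * C0 / (1 - \<beta>1) * spread_bound D + 2 * L * C0\<^sup>2 / (1 - \<beta>1)\<^sup>2"

definition momentum_coeff :: "real \<Rightarrow> real" where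
  "momentum_coeff D = 8 * \<kappa>\<^sup>2 * C0 / \<beta>2 * spread_bound D
     + 2 * \<kappa>\<^sup>2 * C0 * (answer_bound D + \<epsilon>0) / sqrt \<beta>2
     + L * (2 * (Sigma_max \<beta>2)\<^sup>2 + 1/2) * \<kappa>\<^sup>2 * C0\<^sup>2 / (1 - \<beta>1)"

lemma coeffs_nonneg:
  assumes "0 \<le> D" shows "0 \<le> fresh_coeff D" "0 \<le> momentum_coeff D"
  using spread_bound_pos[OF assms] answer_bound_nonneg[OF assms] C0 eps0 L_pos beta2_pos beta1_less_1
  by (auto simp: fresh_coeff_def momentum_coeff_def intro!: add_nonneg_nonneg mult_nonneg_nonneg divide_nonneg_nonneg)

lemma lookahead_descent_bounded:
  assumes s: "s < T" and bnd: "\<And>j. j \<le> s \<Longrightarrow> (l2norm d (grad j))\<^sup>2 \<le> D"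
  shows "f (lookahead (Suc s)) \<le> f (lookahead s) - 5/8 * (\<Sum>i=1..d. weight s i * (grad s i)\<^sup>2) + noise_term s
    + fresh_coeff D * (\<Sum>i=1..d. grad_ratio g (Suc s) i)
    + momentum_coeff D * (\<Sum>i=1..d. mom_ratio g s i)
    + \<kappa> * (\<Sum>i=1..d. \<bar>grad s i\<bar> * \<bar>stepsize (Suc s) - stepsize s\<bar> * \<bar>adam_m \<beta>1 g s i / denom g s i\<bar>)"
proof -
  have gi: "(grad j i)\<^sup>2 \<le> D" if "j \<le> s" "i \<in> {1..d}" for i j
    using component_sq_le[OF that(2), of j] bnd[OF that(1)] by linarith
  have D: "0 \<le> D" using bnd[of s] order_trans[OF zero_le_power2] by blast
  let ?W = "spread_bound D" and ?c = "answer_bound D"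
  let ?A = "8 * C0 / (1 - \<beta>1) * ?W" and ?B = "8 * \<kappa>\<^sup>2 * C0 / \<beta>2 * ?W + 2 * \<kappa>\<^sup>2 * C0 * (?c + \<epsilon>0) / sqrt \<beta>2"
  let ?v = "\<lambda>i. \<bar>grad s i\<bar> * \<bar>stepsize (Suc s) - stepsize s\<bar> * \<bar>adam_m \<beta>1 g s i / denom g s i\<bar>"
  have coord: "grad s i * lookahead_step g s i \<le> (- (5/8) * (weight s i * (grad s i)\<^sup>2))
      + (- weight s i * grad s i * (g (Suc s) i - grad s i))
      + ?A * grad_ratio g (Suc s) i + ?B * mom_ratio g s i + \<kappa> * ?v i" if i: "i \<in> {1..d}" for i
  proof -
    let ?w = "spread s i"
    have "adam_v \<beta>2 g s i \<le> (1 - \<beta>2 ^ s) * ?c\<^sup>2"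
      using gi[OF _ i] s by (intro v_le_bound i) auto
    also have "\<dots> \<le> 1 * ?c\<^sup>2" using pow_bounds[of s] by (intro mult_right_mono) auto
    finally have v: "adam_v \<beta>2 g s i \<le> ?c\<^sup>2" by simp
    have nz: "\<bar>g (Suc s) i - grad s i\<bar> \<le> ?w"
      using noise[OF s] i unfolding noise_within_def by blast
    have le: "?w \<le> ?W" by (rule spread_le_bound[OF gi[OF order_refl i]])
    have "grad s i * lookahead_step g s i
      \<le> - (5/8 * (stepsize (Suc s) * (grad s i)\<^sup>2 / proxy g s i (grad s i) ?w))
        - stepsize (Suc s) * grad s i * (g (Suc s) i - grad s i) / proxy g s i (grad s i) ?w
        + 8 * C0 / (1 - \<beta>1) * ?w * grad_ratio g (Suc s) i
        + (8 * \<kappa>\<^sup>2 * C0 / \<beta>2 * ?w + 2 * \<kappa>\<^sup>2 * C0 * (?c + \<epsilon>0) / sqrt \<beta>2) * mom_ratio g s i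
        + \<kappa> * ?v i"
      using spread_pos[of s i]
      by (intro coordinate_descent nz answer_bound_nonneg D v grad_spread_le_bound gi i) auto
    also have "8 * C0 / (1 - \<beta>1) * ?w * grad_ratio g (Suc s) i \<le> ?A * grad_ratio g (Suc s) i"
      using le C0 beta1_less_1 by (intro mult_right_mono mult_left_mono grad_ratio_nonneg) auto
    also have "(8 * \<kappa>\<^sup>2 * C0 / \<beta>2 * ?w + 2 * \<kappa>\<^sup>2 * C0 * (?c + \<epsilon>0) / sqrt \<beta>2) * mom_ratio g s i
        \<le> ?B * mom_ratio g s i"
      using le C0 beta2_pos by (intro mult_right_mono add_right_mono mult_left_mono mom_ratio_nonneg) auto
    finally show ?thesis by (simp add: weight_def)
  qed
  have "inner_d d (grad s) (lookahead_step g s) \<le> (\<Sum>i=1..d. (- (5/8) * (weight s i * (grad s i)\<^sup>2))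
      + (- weight s i * grad s i * (g (Suc s) i - grad s i))
      + ?A * grad_ratio g (Suc s) i + ?B * mom_ratio g s i + \<kappa> * ?v i)"
    using coord by (intro sum_mono)
  also have "\<dots> = - (5/8) * (\<Sum>i=1..d. weight s i * (grad s i)\<^sup>2) + noise_term s
      + ?A * (\<Sum>i=1..d. grad_ratio g (Suc s) i) + ?B * (\<Sum>i=1..d. mom_ratio g s i)
      + \<kappa> * (\<Sum>i=1..d. ?v i)"
    unfolding noise_term_def sum.distrib sum_distrib_left ..
  finally show ?thesis using lookahead_descent[of s]
    unfolding fresh_coeff_def momentum_coeff_def distrib_right by linarith
qed

text \<open>
  The logarithmic bounds hold for each coordinate and sum over the steps, so the order of summation
  is exchanged; every coordinate contributes at most \<open>Lg\<close>, up to constants.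
\<close>

lemma lookahead_value_le:
  assumes t: "t \<le> T" and D: "0 \<le> D" and bnd: "\<And>s. s < t \<Longrightarrow> (l2norm d (grad s))\<^sup>2 \<le> D"
  shows "f (lookahead t) \<le> f x1 - 5/8 * energy t + (\<Sum>s<t. noise_term s)
    + (fresh_coeff D + momentum_coeff D * ((1 - \<beta>1) / (1 - \<rho>))) * (real d * Lg)
    + \<kappa> * (real d * (2 * C0 * sqrt D / sqrt (1 - \<beta>1)))"
proof -
  let ?v = "\<lambda>s i. \<bar>grad s i\<bar> * \<bar>stepsize (Suc s) - stepsize s\<bar> * \<bar>adam_m \<beta>1 g s i / denom g s i\<bar>"
  have main: "f (lookahead t) \<le> f x1 - 5/8 * energy t + (\<Sum>s<t. noise_term s)
      + fresh_coeff D * (\<Sum>s<t. \<Sum>i=1..d. grad_ratio g (Suc s) i)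
      + momentum_coeff D * (\<Sum>s<t. \<Sum>i=1..d. mom_ratio g s i)
      + \<kappa> * (\<Sum>s<t. \<Sum>i=1..d. ?v s i)"
    using t bnd
  proof (induction t)
    case 0
    then show ?case by (simp add: lookahead_0 energy_def)
  next
    case (Suc t)
    have "f (lookahead (Suc t)) \<le> f (lookahead t) - 5/8 * (\<Sum>i=1..d. weight t i * (grad t i)\<^sup>2) + noise_term t
      + fresh_coeff D * (\<Sum>i=1..d. grad_ratio g (Suc t) i)
      + momentum_coeff D * (\<Sum>i=1..d. mom_ratio g t i)
      + \<kappa> * (\<Sum>i=1..d. ?v t i)"
      using Suc.prems by (intro lookahead_descent_bounded) auto
    moreover have "f (lookahead t) \<le> f x1 - 5/8 * energy t + (\<Sum>s<t. noise_term s)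
      + fresh_coeff D * (\<Sum>s<t. \<Sum>i=1..d. grad_ratio g (Suc s) i)
      + momentum_coeff D * (\<Sum>s<t. \<Sum>i=1..d. mom_ratio g s i)
      + \<kappa> * (\<Sum>s<t. \<Sum>i=1..d. ?v s i)"
      using Suc.prems by (intro Suc.IH) auto
    ultimately show ?case unfolding energy_def sum.lessThan_Suc distrib_left by linarith
  qed
  have 1: "(\<Sum>s<t. \<Sum>i=1..d. grad_ratio g (Suc s) i) \<le> real d * Lg"
  proof -
    have "(\<Sum>s<t. \<Sum>i=1..d. grad_ratio g (Suc s) i) = (\<Sum>i=1..d. \<Sum>s<t. grad_ratio g (Suc s) i)"
      by (rule sum.swap)
    also have "\<dots> \<le> (\<Sum>i=1..d. Lg)" by (intro sum_mono sum_grad_ratio_le_Lg t)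
    finally show ?thesis by simp
  qed
  have 2: "(\<Sum>s<t. \<Sum>i=1..d. mom_ratio g s i) \<le> (1 - \<beta>1) / (1 - \<rho>) * (real d * Lg)"
  proof -
    have "(\<Sum>s<t. \<Sum>i=1..d. mom_ratio g s i) = (\<Sum>i=1..d. \<Sum>s<t. mom_ratio g s i)"
      by (rule sum.swap)
    also have "\<dots> \<le> (\<Sum>i=1..d. (1 - \<beta>1) / (1 - \<rho>) * Lg)" by (intro sum_mono sum_mom_ratio_le_Lg t)
    finally show ?thesis by (simp add: mult_ac)
  qed
  have 3: "(\<Sum>s<t. \<Sum>i=1..d. ?v s i) \<le> real d * (2 * C0 * sqrt D / sqrt (1 - \<beta>1))"
  proof -
    have "(\<Sum>s<t. \<Sum>i=1..d. ?v s i) = (\<Sum>i=1..d. \<Sum>s<t. ?v s i)" by (rule sum.swap)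
    also have "\<dots> \<le> (\<Sum>i=1..d. 2 * C0 * sqrt D / sqrt (1 - \<beta>1))"
    proof (rule sum_mono, rule stepsize_change_term)
      fix i s assume "i \<in> {1..d}" "s < t"
      then have "(grad s i)\<^sup>2 \<le> D" using component_sq_le[of i s] bnd[of s] by linarith
      then show "\<bar>grad s i\<bar> \<le> sqrt D" by (intro real_le_rsqrt) simp
    qed (simp add: D)
    finally show ?thesis by simp
  qed
  show ?thesis
    using main mult_left_mono[OF 1 coeffs_nonneg(1)[OF D]] mult_left_mono[OF 2 coeffs_nonneg(2)[OF D]]
      mult_left_mono[OF 3 kappa_nonneg]
    unfolding distrib_right mult.assoc by linarith
qed

end

section \<open>Closing the induction on the gradient norm\<close>

text \<open>
  The formula of \<open>adam_G\<close>, freed from quotients: \<open>iu\<close>, \<open>ir\<close>, \<open>ib\<close>, \<open>isb\<close> stand for the reciprocals of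
  \<open>1 - \<beta>1\<close>, \<open>1 - \<rho>\<close>, \<open>\<beta>2\<close>, \<open>sqrt \<beta>2\<close>, and the two logarithms \<open>M\<close> and \<open>Lam\<close> contain the factor \<open>D\<close>, the dimension.
\<close>

definition G_poly :: "real \<Rightarrow> real \<Rightarrow> real \<Rightarrow> real \<Rightarrow> real \<Rightarrow> real \<Rightarrow> real \<Rightarrow> real \<Rightarrow> real \<Rightarrow> real \<Rightarrow> real
    \<Rightarrow> real \<Rightarrow> real \<Rightarrow> real \<Rightarrow> real \<Rightarrow> real \<Rightarrow> real" where
  "G_poly L C0 b1 s0 s1 e0 D iu ir ib isb q Sg gap M Lam =
    8 * L * gap + 256 * L\<^sup>2 * C0\<^sup>2 * b1\<^sup>2 * D\<^sup>2 * (iu ^ 3 * ir)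
    + 4 * L\<^sup>2 * C0\<^sup>2 * b1\<^sup>2 * D * (iu\<^sup>2 * ir) + 48 * L * C0 * s0 * iu * M
    + 8 * L * C0 * b1\<^sup>2 * (iu\<^sup>2 * ir) * (4 * s0 * ib + (e0 + q * s0) * isb + L * C0 / 2 * (1 + 4 * Sg)) * Lam
    + 8 * (3 * L\<^sup>2 * C0\<^sup>2 * iu\<^sup>2 + 8 * L * s0 * C0 * iu) * Lam
    + 2304 * L\<^sup>2 * C0\<^sup>2 * s1\<^sup>2 * iu\<^sup>2 * M\<^sup>2
    + 256 * (16 * L\<^sup>2 * C0\<^sup>2 * s1\<^sup>2 * iu\<^sup>2
        + 9 * L\<^sup>2 * C0\<^sup>2 * b1 ^ 4 * (1 + s1\<^sup>2) * (ib\<^sup>2 * iu ^ 4 * ir\<^sup>2)) * Lam\<^sup>2"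

lemma adam_G_eq_poly:
  "adam_G d T L C0 \<epsilon>0 \<beta>1 \<beta>2 s0 s1 \<Delta> F \<delta>
    = G_poly L C0 \<beta>1 s0 s1 \<epsilon>0 (real d) (1 / (1 - \<beta>1)) (1 / (1 - \<beta>1 / \<beta>2)) (1 / \<beta>2) (1 / sqrt \<beta>2) (sqrt 2)
        ((Sigma_max \<beta>2)\<^sup>2) \<Delta> (real d * ln (real d * real T / \<delta>)) (real d * ln (F / \<beta>2 ^ T))"
  unfolding adam_G_def G_poly_def
  by (simp only: power_divide power_one power_mult_distrib times_divide_times_eq mult_1 mult_1_right
      times_divide_eq_right times_divide_eq_left divide_divide_eq_left mult.assoc)

text \<open>
  The arithmetic behind the induction; \<open>isu\<close> stands for the reciprocal of \<open>sqrt (1 - \<beta>1)\<close>. The level is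
  \<open>16 G\<close>, with square root \<open>4 Gs\<close>. The summands without \<open>Gs\<close> are dominated by the linear summands
  of \<open>G\<close>. The coefficient of \<open>Gs\<close> is a sum of square roots of the quadratic summands of \<open>G\<close>, up to
  constants, hence at most \<open>10 Gs\<close>. In total this is \<open>11 G\<close>.
\<close>

lemma constants_close:
  fixes L C0 b1 s0 s1 e0 Lam M m D iu ir ib isb isu S1 Sg gap G Gs c q :: real
  assumes nn: "0 \<le> L" "0 \<le> C0" "0 \<le> b1" "0 \<le> s0" "0 \<le> s1" "0 \<le> e0" "0 \<le> Lam" "0 \<le> m" "0 \<le> D"
      "0 \<le> gap" "0 \<le> Sg" "0 \<le> isu" "0 \<le> Gs" "0 \<le> q"
    and ge1: "1 \<le> iu" "1 \<le> ir" "1 \<le> isb" and ib: "isb \<le> ib" and isu: "isu\<^sup>2 = iu"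
    and S1: "s1 \<le> S1" "S1\<^sup>2 = 1 + s1\<^sup>2" and m: "m \<le> M" and q: "q \<le> 3/2"
    and c: "c \<le> q * (s0 + S1 * (4 * Gs))"
    and G: "G = G_poly L C0 b1 s0 s1 e0 D iu ir ib isb q Sg gap M Lam"
    and Gs: "Gs\<^sup>2 = G"
  shows "4 * L * (gap + ((8 * C0 * iu * (s0 + s1 * (4 * Gs)) + 2 * L * C0\<^sup>2 * iu\<^sup>2) * Lam
      + (8 * C0 * ib * (s0 + s1 * (4 * Gs)) + 2 * C0 * (c + e0) * isb + L * (2 * Sg + 1/2) * C0\<^sup>2 * iu)
          * (b1\<^sup>2 * iu * ir) * Lam
      + b1 * iu * (D * (2 * C0 * (4 * Gs) * isu))
      + 2 * C0 * (s0 + s1 * (4 * Gs)) * iu * m))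
    + 2 * L\<^sup>2 * (b1 * iu)\<^sup>2 * (D * C0\<^sup>2) \<le> 16 * G"
proof -
  let ?E = "\<lambda>c. 4 * L * (gap + ((8 * C0 * iu * (s0 + s1 * (4 * Gs)) + 2 * L * C0\<^sup>2 * iu\<^sup>2) * Lam
      + (8 * C0 * ib * (s0 + s1 * (4 * Gs)) + 2 * C0 * (c + e0) * isb + L * (2 * Sg + 1/2) * C0\<^sup>2 * iu)
          * (b1\<^sup>2 * iu * ir) * Lam
      + b1 * iu * (D * (2 * C0 * (4 * Gs) * isu))
      + 2 * C0 * (s0 + s1 * (4 * Gs)) * iu * m))
    + 2 * L\<^sup>2 * (b1 * iu)\<^sup>2 * (D * C0\<^sup>2)"
  have pos: "0 \<le> iu" "0 \<le> ir" "0 \<le> ib" "0 \<le> isb" "0 \<le> S1" "0 \<le> M"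
    using ge1 ib nn S1 m by auto
  define T1 T2 T3 T4 T5 T6 T7 T8 T9 where
    "T1 = 8 * L * gap" and "T2 = 256 * L\<^sup>2 * C0\<^sup>2 * b1\<^sup>2 * D\<^sup>2 * (iu ^ 3 * ir)"
    and "T3 = 4 * L\<^sup>2 * C0\<^sup>2 * b1\<^sup>2 * D * (iu\<^sup>2 * ir)" and "T4 = 48 * L * C0 * s0 * iu * M"
    and "T5 = 8 * L * C0 * b1\<^sup>2 * (iu\<^sup>2 * ir) * (4 * s0 * ib + (e0 + q * s0) * isb + L * C0 / 2 * (1 + 4 * Sg)) * Lam"
    and "T6 = 8 * (3 * L\<^sup>2 * C0\<^sup>2 * iu\<^sup>2 + 8 * L * s0 * C0 * iu) * Lam"
    and "T7 = 2304 * L\<^sup>2 * C0\<^sup>2 * s1\<^sup>2 * iu\<^sup>2 * M\<^sup>2"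
    and "T8 = 256 * (16 * L\<^sup>2 * C0\<^sup>2 * s1\<^sup>2 * iu\<^sup>2) * Lam\<^sup>2"
    and "T9 = 256 * (9 * L\<^sup>2 * C0\<^sup>2 * b1 ^ 4 * (1 + s1\<^sup>2) * (ib\<^sup>2 * iu ^ 4 * ir\<^sup>2)) * Lam\<^sup>2"
  have Geq: "G = T1 + T2 + T3 + T4 + T5 + T6 + T7 + T8 + T9"
    unfolding G G_poly_def T1_def T2_def T3_def T4_def T5_def T6_def T7_def T8_def T9_def
    by (simp add: distrib_left distrib_right)
  have T: "0 \<le> T1" "0 \<le> T2" "0 \<le> T3" "0 \<le> T4" "0 \<le> T5" "0 \<le> T6" "0 \<le> T7" "0 \<le> T8" "0 \<le> T9"
    unfolding T1_def T2_def T3_def T4_def T5_def T6_def T7_def T8_def T9_def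
    using nn pos by (intro mult_nonneg_nonneg add_nonneg_nonneg zero_le_power; simp)+
  have root: "x \<le> Gs" if "x\<^sup>2 \<le> G" for x
    using that nn(13) unfolding Gs[symmetric] by (rule power2_le_imp_le)
  \<comment> \<open>Each of the next four left-hand sides is at most the square root of a summand of \<open>G\<close>.\<close>
  have H1: "64 * (L * C0 * s1 * Lam * iu) \<le> Gs"
  proof (rule root)
    have "(64 * (L * C0 * s1 * Lam * iu))\<^sup>2 = T8" by (simp add: T8_def power_mult_distrib)
    then show "(64 * (L * C0 * s1 * Lam * iu))\<^sup>2 \<le> G" using Geq T by linarith
  qed
  have H2: "48 * (L * C0 * b1\<^sup>2 * S1 * Lam * (ib * iu\<^sup>2 * ir)) \<le> Gs"
  proof (rule root)
    have "(48 * (L * C0 * b1\<^sup>2 * S1 * Lam * (ib * iu\<^sup>2 * ir)))\<^sup>2 = T9"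
      by (simp add: T9_def power_mult_distrib S1(2) flip: power_mult)
    then show "(48 * (L * C0 * b1\<^sup>2 * S1 * Lam * (ib * iu\<^sup>2 * ir)))\<^sup>2 \<le> G" using Geq T by linarith
  qed
  have H3: "16 * (L * C0 * b1 * D * (iu * isu)) \<le> Gs"
  proof (rule root)
    have "(16 * (L * C0 * b1 * D * (iu * isu)))\<^sup>2 = 256 * L\<^sup>2 * C0\<^sup>2 * b1\<^sup>2 * D\<^sup>2 * (iu ^ 3 * 1)"
      by (simp add: power_mult_distrib isu[unfolded power2_eq_square] power3_eq_cube power2_eq_square)
    also have "\<dots> \<le> T2" unfolding T2_def using ge1 pos by (intro mult_left_mono) auto
    finally show "(16 * (L * C0 * b1 * D * (iu * isu)))\<^sup>2 \<le> G" using Geq T by linarith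
  qed
  have H4: "48 * (L * C0 * s1 * iu * M) \<le> Gs"
  proof (rule root)
    have "(48 * (L * C0 * s1 * iu * M))\<^sup>2 = T7" by (simp add: T7_def power_mult_distrib)
    then show "(48 * (L * C0 * s1 * iu * M))\<^sup>2 \<le> G" using Geq T by linarith
  qed
  define A where "A = L * C0 * b1\<^sup>2 * Lam"
  have A: "0 \<le> A" using nn by (simp add: A_def)
  have iu2: "iu \<le> iu\<^sup>2" using ge1 by (simp add: power2_eq_square)
  have x3: "A * s1 * (ib * iu * ir) \<le> A * S1 * (ib * iu\<^sup>2 * ir)"
    using A S1 pos iu2 nn by (intro mult_mono) auto
  have x4: "A * S1 * (isb * iu * ir) \<le> A * S1 * (ib * iu\<^sup>2 * ir)"
    using A pos iu2 nn ib by (intro mult_mono) auto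
  have x5: "L * C0 * s1 * iu * m \<le> L * C0 * s1 * iu * M"
    using nn pos m by (intro mult_left_mono) auto
  have H2': "48 * (A * S1 * (ib * iu\<^sup>2 * ir)) \<le> Gs" using H2 by (simp add: A_def mult_ac)
  have x4': "q * (A * S1 * (isb * iu * ir)) \<le> 3/2 * (A * S1 * (isb * iu * ir))"
    using q A pos by (intro mult_right_mono mult_nonneg_nonneg) auto
  have root_part: "128 * (L * C0 * s1 * Lam * iu) + 128 * (A * s1 * (ib * iu * ir))
      + 32 * (q * (A * S1 * (isb * iu * ir))) + 32 * (L * C0 * b1 * D * (iu * isu))
      + 32 * (L * C0 * s1 * iu * m) \<le> 10 * Gs"
    using H1 H2' H3 H4 x3 x4 x4' x5 nn(13) by linarith
  have l1: "A * s0 * (ib * iu * ir) \<le> A * s0 * (ib * iu\<^sup>2 * ir)"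
    using A pos iu2 nn by (intro mult_left_mono mult_right_mono) auto
  have l2: "A * (e0 + q * s0) * (isb * iu * ir) \<le> A * (e0 + q * s0) * (isb * iu\<^sup>2 * ir)"
    using A pos iu2 nn by (intro mult_left_mono mult_right_mono) auto
  have l3: "L * C0 * s0 * iu * m \<le> L * C0 * s0 * iu * M"
    using nn pos m by (intro mult_left_mono) auto
  have l4: "L\<^sup>2 * C0\<^sup>2 * b1\<^sup>2 * D * (iu\<^sup>2 * 1) \<le> L\<^sup>2 * C0\<^sup>2 * b1\<^sup>2 * D * (iu\<^sup>2 * ir)"
    using nn pos ge1 by (intro mult_left_mono) auto
  have l5: "0 \<le> A * (L * C0 * (1 + 4 * Sg)) * (iu\<^sup>2 * ir)"
    using A pos nn by (intro mult_nonneg_nonneg) auto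
  have T5': "T5 = 32 * (A * s0 * (ib * iu\<^sup>2 * ir)) + 8 * (A * (e0 + q * s0) * (isb * iu\<^sup>2 * ir))
      + 4 * (A * (L * C0 * (1 + 4 * Sg)) * (iu\<^sup>2 * ir))"
    unfolding T5_def A_def by (simp add: algebra_simps)
  have nn6: "0 \<le> L * C0 * s0 * iu * Lam" "0 \<le> L\<^sup>2 * C0\<^sup>2 * iu\<^sup>2 * Lam" "0 \<le> L * gap"
      "0 \<le> L * C0 * s0 * iu * M" "0 \<le> L\<^sup>2 * C0\<^sup>2 * b1\<^sup>2 * D * (iu\<^sup>2 * ir)"
    using nn pos by (auto intro!: mult_nonneg_nonneg)
  have linear_part: "4 * (L * gap) + 32 * (L * C0 * s0 * iu * Lam) + 8 * (L\<^sup>2 * C0\<^sup>2 * iu\<^sup>2 * Lam)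
      + 32 * (A * s0 * (ib * iu * ir)) + 8 * (A * (e0 + q * s0) * (isb * iu * ir))
      + 2 * (A * (L * C0 * (1 + 4 * Sg)) * (iu\<^sup>2 * ir)) + 8 * (L * C0 * s0 * iu * m)
      + 2 * (L\<^sup>2 * C0\<^sup>2 * b1\<^sup>2 * D * (iu\<^sup>2 * 1)) \<le> G"
  proof -
    have "T1 = 8 * (L * gap)" "T4 = 48 * (L * C0 * s0 * iu * M)"
      "T3 = 4 * (L\<^sup>2 * C0\<^sup>2 * b1\<^sup>2 * D * (iu\<^sup>2 * ir))"
      "T6 = 24 * (L\<^sup>2 * C0\<^sup>2 * iu\<^sup>2 * Lam) + 64 * (L * C0 * s0 * iu * Lam)"
      by (simp_all add: T1_def T3_def T4_def T6_def algebra_simps)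
    then show ?thesis using l1 l2 l3 l4 l5 nn6 T T5' Geq by linarith
  qed
  have "2 * C0 * (c + e0) * isb * (b1\<^sup>2 * iu * ir) * Lam
      \<le> 2 * C0 * (q * (s0 + S1 * (4 * Gs)) + e0) * isb * (b1\<^sup>2 * iu * ir) * Lam"
    using c nn pos by (intro mult_right_mono mult_left_mono) auto
  then have "4 * L * (2 * C0 * (c + e0) * isb * (b1\<^sup>2 * iu * ir) * Lam)
      \<le> 4 * L * (2 * C0 * (q * (s0 + S1 * (4 * Gs)) + e0) * isb * (b1\<^sup>2 * iu * ir) * Lam)"
    using nn by (intro mult_left_mono) auto
  then have "?E c \<le> ?E (q * (s0 + S1 * (4 * Gs)))"
    by (simp only: distrib_left distrib_right)
  also have "\<dots> = (4 * (L * gap) + 32 * (L * C0 * s0 * iu * Lam) + 8 * (L\<^sup>2 * C0\<^sup>2 * iu\<^sup>2 * Lam)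
      + 32 * (A * s0 * (ib * iu * ir)) + 8 * (A * (e0 + q * s0) * (isb * iu * ir))
      + 2 * (A * (L * C0 * (1 + 4 * Sg)) * (iu\<^sup>2 * ir)) + 8 * (L * C0 * s0 * iu * m)
      + 2 * (L\<^sup>2 * C0\<^sup>2 * b1\<^sup>2 * D * (iu\<^sup>2 * 1)))
    + (128 * (L * C0 * s1 * Lam * iu) + 128 * (A * s1 * (ib * iu * ir))
      + 32 * (q * (A * S1 * (isb * iu * ir))) + 32 * (L * C0 * b1 * D * (iu * isu))
      + 32 * (L * C0 * s1 * iu * m)) * Gs"
    unfolding A_def by (simp add: algebra_simps power2_eq_square)
  also have "\<dots> \<le> G + 10 * Gs * Gs"
    using linear_part root_part nn(13) by (intro add_mono mult_right_mono) auto
  also have "10 * Gs * Gs = 10 * G" using Gs by (simp add: power2_eq_square)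
  also have "G + 10 * G \<le> 16 * G" using Gs zero_le_power2[of Gs] by linarith
  finally show ?thesis .
qed

context adam_run
begin

text \<open>
  The total loss in the descent inequality, including the noise. It grows with the level only
  like \<open>sqrt D\<close>.
\<close>

definition excess :: "real \<Rightarrow> real \<Rightarrow> real" where
  "excess \<delta> D = (fresh_coeff D + momentum_coeff D * ((1 - \<beta>1) / (1 - \<rho>))) * (real d * Lg)
    + \<kappa> * (real d * (2 * C0 * sqrt D / sqrt (1 - \<beta>1)))
    + 2 * real d * C0 * spread_bound D / (1 - \<beta>1) * ln (1 / \<delta>)"

lemma gap_nonneg: "0 \<le> f x1 - fstar"
  using below[OF x1] by simp

lemma ln_inverse_delta:
  assumes T: "1 \<le> T" and \<delta>: "0 < \<delta>" "\<delta> < 1"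
  shows "0 < ln (1 / \<delta>)" "ln (1 / \<delta>) \<le> ln (real d * real T / \<delta>)"
proof -
  have dT: "1 \<le> real d * real T" using mult_mono[of 1 "real d" 1 "real T"] d_pos T by simp
  show "0 < ln (1 / \<delta>)" using \<delta> by simp
  have "1 / \<delta> \<le> real d * real T / \<delta>" using dT \<delta> by (intro divide_right_mono) auto
  then show "ln (1 / \<delta>) \<le> ln (real d * real T / \<delta>)" using \<delta> by (intro ln_mono) auto
qed

lemma G_nonneg:
  assumes "1 \<le> T" "0 < \<delta>" "\<delta> < 1"
  shows "0 \<le> G \<delta>"
proof -
  have l: "0 \<le> ln (real d * real T / \<delta>)" using ln_inverse_delta[OF assms] by linarith
  have u: "0 \<le> 1 - \<beta>1" "0 \<le> 1 - \<rho>" using beta1_less_1 rho by auto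
  have nn: "0 \<le> L" "0 \<le> C0" "0 \<le> \<epsilon>0" "0 \<le> s0" "0 \<le> \<beta>2" "0 \<le> Sigma_max \<beta>2"
    using L_pos C0 eps0 s0 beta2_pos Sigma_max_bounds(1) by auto
  show ?thesis unfolding G_def adam_G_def Lg_def[symmetric]
    by (intro add_nonneg_nonneg mult_nonneg_nonneg divide_nonneg_nonneg zero_le_power
        l u nn Lg_nonneg gap_nonneg s1 beta1 real_sqrt_ge_zero of_nat_0_le_iff
        zero_le_numeral zero_le_one)
qed

lemma excess_closes:
  assumes T: "1 \<le> T" and \<delta>: "0 < \<delta>" "\<delta> < 1"
  shows "4 * L * (f x1 - fstar + excess \<delta> (16 * G \<delta>)) + 2 * L\<^sup>2 * \<kappa>\<^sup>2 * (real d * C0\<^sup>2) \<le> 16 * G \<delta>"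
proof -
  define iu ir ib isb isu S1 where "iu = 1 / (1 - \<beta>1)" and "ir = 1 / (1 - \<rho>)" and "ib = 1 / \<beta>2"
    and "isb = 1 / sqrt \<beta>2" and "isu = 1 / sqrt (1 - \<beta>1)" and "S1 = sqrt (1 + s1\<^sup>2)"
  define Gs where "Gs = sqrt (G \<delta>)"
  have G0: "0 \<le> G \<delta>" using G_nonneg assms by blast
  have sq: "sqrt (16 * G \<delta>) = 4 * Gs" by (simp add: Gs_def real_sqrt_mult)
  have sb: "\<beta>2 \<le> sqrt \<beta>2" "sqrt \<beta>2 \<le> 1"
    using beta2 beta2_pos by (auto intro!: real_le_rsqrt simp: power2_eq_square mult_left_le)
  have ge1: "1 \<le> iu" "1 \<le> ir" "1 \<le> isb" "isb \<le> ib"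
    using beta1 beta1_less_1 rho beta2_pos sb
    by (auto simp: iu_def ir_def isb_def ib_def pos_le_divide_eq frac_le)
  have c: "answer_bound (16 * G \<delta>) \<le> sqrt 2 * (s0 + S1 * (4 * Gs))"
  proof -
    have "answer_bound (16 * G \<delta>) = sqrt 2 * sqrt (s0\<^sup>2 + (1 + s1\<^sup>2) * (16 * G \<delta>))"
      unfolding answer_bound_def by (rule real_sqrt_mult)
    also have "sqrt (s0\<^sup>2 + (1 + s1\<^sup>2) * (16 * G \<delta>)) \<le> sqrt (s0\<^sup>2) + sqrt ((1 + s1\<^sup>2) * (16 * G \<delta>))"
      using G0 by (intro sqrt_add_le_add_sqrt) auto
    also have "\<dots> = s0 + S1 * (4 * Gs)"
      using s0 sq by (simp only: real_sqrt_mult[of "1 + s1\<^sup>2"] S1_def) simp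
    finally show ?thesis by simp
  qed
  have Geq: "G \<delta> = G_poly L C0 \<beta>1 s0 s1 \<epsilon>0 (real d) iu ir ib isb (sqrt 2) ((Sigma_max \<beta>2)\<^sup>2) (f x1 - fstar)
      (real d * ln (real d * real T / \<delta>)) (real d * Lg)"
    unfolding G_def Lg_def iu_def ir_def ib_def isb_def by (rule adam_G_eq_poly)
  have exc: "excess \<delta> (16 * G \<delta>) = (8 * C0 * iu * (s0 + s1 * (4 * Gs)) + 2 * L * C0\<^sup>2 * iu\<^sup>2) * (real d * Lg)
      + (8 * C0 * ib * (s0 + s1 * (4 * Gs)) + 2 * C0 * (answer_bound (16 * G \<delta>) + \<epsilon>0) * isb
          + L * (2 * (Sigma_max \<beta>2)\<^sup>2 + 1/2) * C0\<^sup>2 * iu) * (\<beta>1\<^sup>2 * iu * ir) * (real d * Lg)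
      + \<beta>1 * iu * (real d * (2 * C0 * (4 * Gs) * isu))
      + 2 * C0 * (s0 + s1 * (4 * Gs)) * iu * (real d * ln (1 / \<delta>))"
  proof -
    have k: "\<kappa> = \<beta>1 * iu" by (simp add: iu_def)
    have k2: "\<kappa>\<^sup>2 * ((1 - \<beta>1) / (1 - \<rho>)) = \<beta>1\<^sup>2 * iu * ir"
      using beta1_less_1 by (simp add: iu_def ir_def power2_eq_square)
    have fr: "fresh_coeff (16 * G \<delta>) = 8 * C0 * iu * (s0 + s1 * (4 * Gs)) + 2 * L * C0\<^sup>2 * iu\<^sup>2"
      unfolding fresh_coeff_def spread_bound_def sq by (simp add: iu_def power_divide)
    have mo: "momentum_coeff (16 * G \<delta>) = (8 * C0 * ib * (s0 + s1 * (4 * Gs))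
        + 2 * C0 * (answer_bound (16 * G \<delta>) + \<epsilon>0) * isb
        + L * (2 * (Sigma_max \<beta>2)\<^sup>2 + 1/2) * C0\<^sup>2 * iu) * \<kappa>\<^sup>2"
    proof -
      have "8 * k * c / b * W + 2 * k * c * a / sb + L * S * k * c2 / u
          = (8 * c * (1 / b) * W + 2 * c * a * (1 / sb) + L * S * c2 * (1 / u)) * k"
        for k c b W a sb S c2 u :: real by (simp add: algebra_simps)
      then show ?thesis unfolding momentum_coeff_def spread_bound_def sq ib_def isb_def iu_def .
    qed
    have "excess \<delta> (16 * G \<delta>) = fresh_coeff (16 * G \<delta>) * (real d * Lg)
        + momentum_coeff (16 * G \<delta>) * ((1 - \<beta>1) / (1 - \<rho>)) * (real d * Lg)
        + \<beta>1 * iu * (real d * (2 * C0 * (4 * Gs) * isu))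
        + 2 * C0 * (s0 + s1 * (4 * Gs)) * iu * (real d * ln (1 / \<delta>))"
      unfolding excess_def sq spread_bound_def distrib_right[of _ _ "real d * Lg"]
      by (simp add: iu_def isu_def)
    then show ?thesis unfolding fr mo mult.assoc[of _ "\<kappa>\<^sup>2"] k2 .
  qed
  have kk: "\<kappa>\<^sup>2 = (\<beta>1 * iu)\<^sup>2" by (simp add: iu_def)
  have isu2: "isu\<^sup>2 = iu" using beta1_less_1 by (simp add: isu_def iu_def power_divide)
  have q: "sqrt 2 \<le> 3 / 2" by (intro real_le_lsqrt) (auto simp: power2_eq_square)
  have S1: "s1 \<le> S1" "S1\<^sup>2 = 1 + s1\<^sup>2" by (auto simp: S1_def intro: real_le_rsqrt)
  have ln: "real d * ln (1 / \<delta>) \<le> real d * ln (real d * real T / \<delta>)" "0 \<le> real d * ln (1 / \<delta>)"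
    using ln_inverse_delta[OF assms] by (auto intro!: mult_left_mono mult_nonneg_nonneg)
  have G2: "Gs\<^sup>2 = G \<delta>" using G0 by (simp add: Gs_def)
  show ?thesis unfolding exc kk
    by (rule constants_close[where M = "real d * ln (real d * real T / \<delta>)", OF _ _ _ _ _ _ _ _ _ _ _ _ _ _ ge1(1-4) isu2 S1 ln(1) q c Geq G2])
       (use L_pos C0 beta1 s0 s1 eps0 Lg_nonneg ln gap_nonneg G0 beta1_less_1 in
         \<open>auto simp: isu_def Gs_def\<close>)
qed

text \<open>
  The coordinates of one answer need not be independent, so their ranges add up, and Cauchy-Schwarz costs
  a factor \<open>d\<close>.
\<close>

lemma noise_range_sq_le:
  assumes bnd: "(l2norm d (grad s))\<^sup>2 \<le> D"
  shows "(noise_range s)\<^sup>2 \<le> real d * (C0 / (1 - \<beta>1) * spread_bound D) * (\<Sum>i=1..d. weight s i * (grad s i)\<^sup>2)"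
proof -
  let ?r = "\<lambda>i. \<bar>weight s i * grad s i\<bar> * spread s i"
  have "(noise_range s)\<^sup>2 \<le> real d * (\<Sum>i=1..d. (?r i)\<^sup>2)"
    using sum_squared_le_sum_of_squares[of ?r "{1..d}"] by (simp add: noise_range_def mult.commute)
  also have "(\<Sum>i=1..d. (?r i)\<^sup>2) \<le> (\<Sum>i=1..d. C0 / (1 - \<beta>1) * spread_bound D * (weight s i * (grad s i)\<^sup>2))"
  proof (rule sum_mono)
    fix i assume i: "i \<in> {1..d}"
    then have gi: "(grad s i)\<^sup>2 \<le> D" using component_sq_le[of i s] bnd by linarith
    have "(?r i)\<^sup>2 = (weight s i * spread s i) * spread s i * (weight s i * (grad s i)\<^sup>2)"
      by (simp add: power_mult_distrib power2_eq_square)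
    also have "\<dots> \<le> C0 / (1 - \<beta>1) * spread_bound D * (weight s i * (grad s i)\<^sup>2)"
      using weight_pos[of s i] spread_pos[of s i] C0 beta1_less_1
      by (intro mult_right_mono[OF mult_mono[OF weight_spread_le spread_le_bound[OF gi]]]) auto
    finally show "(?r i)\<^sup>2 \<le> C0 / (1 - \<beta>1) * spread_bound D * (weight s i * (grad s i)\<^sup>2)" .
  qed
  then have "real d * (\<Sum>i=1..d. (?r i)\<^sup>2)
      \<le> real d * (\<Sum>i=1..d. C0 / (1 - \<beta>1) * spread_bound D * (weight s i * (grad s i)\<^sup>2))"
    by (rule mult_left_mono) simp
  finally show ?thesis by (simp only: sum_distrib_left mult.assoc)
qed

lemma tilt_pos: "0 \<le> D \<Longrightarrow> 0 < tilt D"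
  using spread_bound_pos[of D] d_pos C0 beta1_less_1 by (simp add: tilt_def)

lemma sum_noise_le:
  assumes D: "0 \<le> D" and bnd: "\<And>s. s < t \<Longrightarrow> (l2norm d (grad s))\<^sup>2 \<le> D"
    and conc: "(\<Sum>s<t. compensated_noise D s) \<le> l"
  shows "(\<Sum>s<t. noise_term s) \<le> 1/4 * energy t + 2 * real d * C0 * spread_bound D / (1 - \<beta>1) * l"
proof -
  let ?k = "tilt D" and ?c = "real d * (C0 / (1 - \<beta>1) * spread_bound D)"
  have k: "0 < ?k" by (rule tilt_pos[OF D])
  have kc: "?k / 2 * ?c = 1/4"
    using spread_bound_pos[OF D] d_pos C0 beta1_less_1 by (simp add: tilt_def)
  have ik: "1 / ?k = 2 * real d * C0 * spread_bound D / (1 - \<beta>1)" by (simp add: tilt_def)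
  have "?k * (\<Sum>s<t. noise_term s) - ?k * (?k / 2 * (\<Sum>s<t. (noise_range s)\<^sup>2)) \<le> l"
    using conc by (simp add: compensated_noise_def sum_subtractf sum_distrib_left power2_eq_square mult.assoc)
  then have "?k * ((\<Sum>s<t. noise_term s) - ?k / 2 * (\<Sum>s<t. (noise_range s)\<^sup>2)) \<le> l"
    by (simp only: right_diff_distrib)
  then have "(\<Sum>s<t. noise_term s) - ?k / 2 * (\<Sum>s<t. (noise_range s)\<^sup>2) \<le> l / ?k"
    using k by (simp add: pos_le_divide_eq mult.commute)
  moreover have "?k / 2 * (\<Sum>s<t. (noise_range s)\<^sup>2) \<le> ?k / 2 * (?c * energy t)"
  proof -
    have "(\<Sum>s<t. (noise_range s)\<^sup>2) \<le> (\<Sum>s<t. ?c * (\<Sum>i=1..d. weight s i * (grad s i)\<^sup>2))"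
      using bnd by (intro sum_mono noise_range_sq_le) auto
    also have "\<dots> = ?c * energy t" unfolding energy_def sum_distrib_left[symmetric] ..
    finally show ?thesis using k by (intro mult_left_mono) auto
  qed
  moreover have "?k / 2 * (?c * energy t) = 1/4 * energy t"
    unfolding mult.assoc[symmetric] kc[unfolded mult.assoc[symmetric]] ..
  moreover have "l / ?k = 2 * real d * C0 * spread_bound D / (1 - \<beta>1) * l"
    unfolding ik[symmetric] by simp
  ultimately show ?thesis by linarith
qed

lemma energy_nonneg: "0 \<le> energy t"
  unfolding energy_def using weight_pos
  by (intro sum_nonneg mult_nonneg_nonneg) (auto intro: less_imp_le)

lemma lookahead_value_excess:
  assumes t: "t \<le> T" and D: "0 \<le> D" and bnd: "\<And>s. s < t \<Longrightarrow> (l2norm d (grad s))\<^sup>2 \<le> D"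
    and conc: "(\<Sum>s<t. compensated_noise D s) \<le> ln (1 / \<delta>)"
  shows "f (lookahead t) + 3/8 * energy t \<le> f x1 + excess \<delta> D"
  using lookahead_value_le[OF t D bnd] sum_noise_le[OF D bnd conc] unfolding excess_def by linarith

text \<open>
  The value of \<open>f\<close> at the look-ahead point bounds the gradient there, and the iterate is close to it.
\<close>

lemma next_gradient_le:
  assumes T: "1 \<le> T" and \<delta>: "0 < \<delta>" "\<delta> < 1" and D: "D = 16 * G \<delta>"
    and t: "t \<le> T" and bnd: "\<And>s. s < t \<Longrightarrow> (l2norm d (grad s))\<^sup>2 \<le> D"
    and conc: "(\<Sum>s<t. compensated_noise D s) \<le> ln (1 / \<delta>)"
  shows "(l2norm d (grad t))\<^sup>2 \<le> D"
proof -
  let ?n = "l2norm d (\<lambda>i. gradient d f (lookahead t) i - grad t i)"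
  have D0: "0 \<le> D" using G_nonneg[OF T \<delta>] D by simp
  have val: "f (lookahead t) - fstar \<le> f x1 - fstar + excess \<delta> D"
    using lookahead_value_excess[OF t D0 bnd conc] energy_nonneg[of t] by linarith
  have n2: "?n\<^sup>2 \<le> L\<^sup>2 * \<kappa>\<^sup>2 * (real d * C0\<^sup>2)"
  proof -
    have "?n\<^sup>2 \<le> (L * (\<kappa> * l2norm d (\<lambda>i. iter (Suc t) i - iter t i)))\<^sup>2"
      by (rule power_mono[OF lookahead_gradient_diff l2norm_nonneg])
    also have "\<dots> = L\<^sup>2 * \<kappa>\<^sup>2 * (l2norm d (\<lambda>i. iter (Suc t) i - iter t i))\<^sup>2"
      by (simp only: power_mult_distrib mult.assoc)
    also have "\<dots> \<le> L\<^sup>2 * \<kappa>\<^sup>2 * (real d * C0\<^sup>2)"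
      by (intro mult_left_mono displacement_sum_le) auto
    finally show ?thesis .
  qed
  have "(l2norm d (grad t))\<^sup>2 \<le> 2 * (l2norm d (gradient d f (lookahead t)))\<^sup>2 + 2 * ?n\<^sup>2"
    unfolding l2norm_sq sum_distrib_left sum.distrib[symmetric]
  proof (rule sum_mono)
    fix i
    have "x\<^sup>2 \<le> 2 * y\<^sup>2 + 2 * (y - x)\<^sup>2" for x y :: real
      using zero_le_power2[of "2 * y - x"] by (simp add: power2_diff algebra_simps)
    then show "(grad t i)\<^sup>2 \<le> 2 * (gradient d f (lookahead t) i)\<^sup>2 + 2 * (gradient d f (lookahead t) i - grad t i)\<^sup>2" .
  qed
  also have "\<dots> \<le> 2 * (2 * L * (f (lookahead t) - fstar)) + 2 * (L\<^sup>2 * \<kappa>\<^sup>2 * (real d * C0\<^sup>2))"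
    using n2 gradient_sq_le_gap[OF smooth L_pos lookahead_space below] by (intro add_mono mult_left_mono) auto
  also have "\<dots> \<le> 4 * L * (f x1 - fstar + excess \<delta> D) + 2 * L\<^sup>2 * \<kappa>\<^sup>2 * (real d * C0\<^sup>2)"
    using mult_left_mono[OF val, of "4 * L"] L_pos by (simp add: mult.assoc)
  also have "\<dots> \<le> D" unfolding D by (rule excess_closes[OF T \<delta>])
  finally show ?thesis .
qed

text \<open>
  At the first time with a gradient above the level, the stopped sum agrees with the sum
  of all earlier terms. So the concentration hypothesis at the final time applies at that time too, and
  the new gradient is below the level after all.
\<close>

lemma gradients_stay_below:
  assumes T: "1 \<le> T" and \<delta>: "0 < \<delta>" "\<delta> < 1" and D: "D = 16 * G \<delta>"
    and conc: "(\<Sum>s<T. stopped_noise D s)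
      \<le> ln (1 / \<delta>)"
  shows "t < T \<Longrightarrow> below_level D t"
proof (induction t rule: less_induct)
  case (less t)
  let ?c = "compensated_noise D"
  have prev: "below_level D s" if "s < t" for s using less that by auto
  show ?case
  proof (rule ccontr)
    assume not: "\<not> below_level D t"
    then obtain j where j: "j \<le> t" "\<not> (l2norm d (grad j))\<^sup>2 \<le> D"
      unfolding below_level_def by blast
    have "\<not> below_level D s" if "t \<le> s" for s
      using le_trans[OF j(1) that] j(2) unfolding below_level_def by blast
    then have "(\<Sum>s<T. stopped_noise D s) = (\<Sum>s<t. ?c s)"
      using prev less.prems by (intro sum.mono_neutral_cong_right) (auto simp: not_less stopped_noise_def)
    then have stopped: "(\<Sum>s<t. ?c s) \<le> ln (1 / \<delta>)" using conc by (simp only:)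
    have before: "(l2norm d (grad s))\<^sup>2 \<le> D" if "s < t" for s
      using prev[OF that] unfolding below_level_def by blast
    have "(l2norm d (grad t))\<^sup>2 \<le> D"
      by (rule next_gradient_le[OF T \<delta> D less_imp_le[OF less.prems] before stopped])
    then have "below_level D t" using before unfolding below_level_def le_less by blast
    then show False using not by simp
  qed
qed

text \<open>
  The bias correction \<open>sqrt (1 - \<beta>2 ^ s)\<close> of the step size cancels against the one in the bound for the proxy.
\<close>

lemma weight_ge:
  assumes s: "s < T" and i: "i \<in> {1..d}" and bnd: "\<And>j. j \<le> s \<Longrightarrow> (grad j i)\<^sup>2 \<le> D"
  shows "1 \<le> weight s i * ((\<epsilon>0 + answer_bound D / sqrt (1 - \<beta>2)) / C0)"
proof -
  let ?c = "answer_bound D" and ?a = "proxy g s i (grad s i) (spread s i)" and ?r = "sqrt (1 - \<beta>2 ^ Suc s)"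
  have D: "0 \<le> D" using bnd[of s] order_trans[OF zero_le_power2] by blast
  have c: "0 \<le> ?c" by (rule answer_bound_nonneg[OF D])
  have "adam_v \<beta>2 g s i \<le> (1 - \<beta>2 ^ s) * ?c\<^sup>2"
    using s bnd by (intro v_le_bound i) auto
  then have "\<beta>2 * adam_v \<beta>2 g s i + (1 - \<beta>2) * ((grad s i)\<^sup>2 + (spread s i)\<^sup>2)
      \<le> \<beta>2 * ((1 - \<beta>2 ^ s) * ?c\<^sup>2) + (1 - \<beta>2) * ?c\<^sup>2"
    using grad_spread_le_bound[OF bnd[of s]] beta2 beta2_pos by (intro add_mono mult_left_mono) auto
  also have "\<dots> = (1 - \<beta>2 ^ Suc s) * ?c\<^sup>2" by (simp add: algebra_simps)
  finally have "sqrt (\<beta>2 * adam_v \<beta>2 g s i + (1 - \<beta>2) * ((grad s i)\<^sup>2 + (spread s i)\<^sup>2))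
      \<le> sqrt ((1 - \<beta>2 ^ Suc s) * ?c\<^sup>2)" by (rule real_sqrt_le_mono)
  also have "\<dots> = ?r * ?c" using c by (simp only: real_sqrt_mult real_sqrt_unique)
  finally have "sqrt (\<beta>2 * adam_v \<beta>2 g s i + (1 - \<beta>2) * ((grad s i)\<^sup>2 + (spread s i)\<^sup>2)) \<le> ?r * ?c" .
  then have a: "?a \<le> ?r * (?c + \<epsilon>)"
    unfolding proxy_def adam_eps_def by (simp add: distrib_left mult_ac del: power_Suc)
  have w: "0 < sqrt (1 - \<beta>2)" using beta2 by simp
  have "(x + y / w) / c = (y + x * w) / (c * w)" if "0 < w" for x y w c :: real
    using that by (simp add: field_simps)
  from this[OF w] have "\<eta> * ((\<epsilon>0 + ?c / sqrt (1 - \<beta>2)) / C0) = ?c + \<epsilon>"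
    using order.strict_implies_not_eq[OF eta_pos] by (simp only: times_divide_eq_right) simp
  then have "?a \<le> (?r * \<eta>) * ((\<epsilon>0 + ?c / sqrt (1 - \<beta>2)) / C0)"
    using a by (simp only: mult.assoc)
  also have "\<dots> \<le> stepsize (Suc s) * ((\<epsilon>0 + ?c / sqrt (1 - \<beta>2)) / C0)"
  proof (rule mult_right_mono)
    show "?r * \<eta> \<le> stepsize (Suc s)" using stepsize_ge[of "Suc s"] by (simp only: mult.commute[of ?r])
    show "0 \<le> (\<epsilon>0 + ?c / sqrt (1 - \<beta>2)) / C0" using c eps0 C0 w by simp
  qed
  finally show ?thesis using proxy_pos[of g s i "grad s i" "spread s i"]
    unfolding weight_def by (simp only: times_divide_eq_left pos_le_divide_eq mult_1)
qed

lemma gradient_sum_le: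
  assumes T: "1 \<le> T" and \<delta>: "0 < \<delta>" "\<delta> < 1" and D: "D = 16 * G \<delta>"
    and conc: "(\<Sum>s<T. stopped_noise D s)
      \<le> ln (1 / \<delta>)"
  shows "(\<Sum>s<T. (l2norm d (grad s))\<^sup>2)
    \<le> 32/3 * G \<delta> / L * ((\<epsilon>0 + answer_bound D / sqrt (1 - \<beta>2)) / C0)"
proof -
  let ?A = "(\<epsilon>0 + answer_bound D / sqrt (1 - \<beta>2)) / C0"
  have fstar_le_lookahead: "fstar \<le> f (lookahead T)" by (rule below[OF lookahead_space])
  have below: "below_level D s" if "s < T" for s
    using gradients_stay_below[OF T \<delta> D conc that] .
  have D0: "0 \<le> D" using G_nonneg[OF T \<delta>] D by simp
  have bnd: "(l2norm d (grad s))\<^sup>2 \<le> D" if "s < T" for s using below[OF that] by (simp add: below_level_def)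
  have A: "0 \<le> ?A" using answer_bound_nonneg[OF D0] eps0 C0 beta2 by simp
  have "(\<Sum>s<T. (l2norm d (grad s))\<^sup>2) \<le> (\<Sum>s<T. \<Sum>i=1..d. ?A * (weight s i * (grad s i)\<^sup>2))"
    unfolding l2norm_sq
  proof (intro sum_mono)
    fix s i assume s: "s \<in> {..<T}" and i: "i \<in> {1..d}"
    have "(grad j i)\<^sup>2 \<le> D" if "j \<le> s" for j
      using component_sq_le[OF i, of j] bnd[of j] that s by simp
    then have "1 \<le> weight s i * ?A" using s by (intro weight_ge i) auto
    then have "1 * (grad s i)\<^sup>2 \<le> (weight s i * ?A) * (grad s i)\<^sup>2" by (intro mult_right_mono) auto
    then show "(grad s i)\<^sup>2 \<le> ?A * (weight s i * (grad s i)\<^sup>2)" by (simp only: mult_ac mult_1)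
  qed
  also have "\<dots> = ?A * energy T" unfolding energy_def sum_distrib_left ..
  also have "\<dots> \<le> ?A * (32/3 * G \<delta> / L)"
  proof (rule mult_left_mono[OF _ A])
    have "(\<Sum>s<T. compensated_noise D s) \<le> ln (1 / \<delta>)"
      using conc below by (simp add: stopped_noise_def)
    then have "f (lookahead T) + 3/8 * energy T \<le> f x1 + excess \<delta> D"
      using bnd by (intro lookahead_value_excess D0) auto
    then have "3/8 * energy T \<le> f x1 - fstar + excess \<delta> D"
      using fstar_le_lookahead by linarith
    then have "L * (3/8 * energy T) \<le> L * (f x1 - fstar + excess \<delta> D)" using L_pos by (intro mult_left_mono) auto
    moreover have "4 * L * (f x1 - fstar + excess \<delta> D) \<le> 16 * G \<delta>"
    proof -
      have "0 \<le> 2 * L\<^sup>2 * \<kappa>\<^sup>2 * (real d * C0\<^sup>2)" by (intro mult_nonneg_nonneg) auto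
      then show ?thesis using excess_closes[OF T \<delta>] unfolding D by linarith
    qed
    moreover have "L * (3/8 * energy T) = 3/8 * (L * energy T)"
        "4 * L * (f x1 - fstar + excess \<delta> D) = 4 * (L * (f x1 - fstar + excess \<delta> D))"
      by simp_all
    ultimately have "L * energy T \<le> 32/3 * G \<delta>" by linarith
    then show "energy T \<le> 32/3 * G \<delta> / L" using L_pos by (simp add: pos_le_divide_eq mult.commute)
  qed
  finally show ?thesis by (simp only: mult.commute)
qed

end

lemma (in adam_run) average_gradient_le:
  assumes T: "1 \<le> T" and \<delta>: "0 < \<delta>" "\<delta> < 1"
    and conc: "(\<Sum>s<T. stopped_noise (16 * G \<delta>) s)
      \<le> ln (1 / \<delta>)"
    and N: "s0\<^sup>2 \<le> N" and C: "64 / L \<le> C"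
  shows "1 / real T * (\<Sum>s=1..T. (l2norm d (gradient d f (adam_x d \<beta>1 \<beta>2 \<eta> \<epsilon> x1 g s)))\<^sup>2)
    \<le> C * (G \<delta> / (real T * C0)) * (\<epsilon>0 + sqrt ((N + (1 + s1\<^sup>2) * G \<delta>) / (1 - \<beta>2)))"
proof -
  let ?R = "\<epsilon>0 + sqrt ((N + (1 + s1\<^sup>2) * G \<delta>) / (1 - \<beta>2))"
  have G0: "0 \<le> G \<delta>" by (rule G_nonneg[OF T \<delta>])
  have N0: "0 \<le> N" using N order_trans[OF zero_le_power2] by blast
  have "answer_bound (16 * G \<delta>) \<le> 6 * sqrt (N + (1 + s1\<^sup>2) * G \<delta>)"
  proof -
    have "2 * (s0\<^sup>2 + (1 + s1\<^sup>2) * (16 * G \<delta>)) \<le> 36 * (N + (1 + s1\<^sup>2) * G \<delta>)"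
    proof -
      have "2 * (a + 16 * X) \<le> 36 * (M + X)" if "0 \<le> X" "a \<le> M" "0 \<le> M" for a X M :: real
        using that by simp
      from this[OF _ N N0, of "(1 + s1\<^sup>2) * G \<delta>"] show ?thesis
        using G0 unfolding mult.left_commute[of "1 + s1\<^sup>2" 16 "G \<delta>"] by simp
    qed
    then have "answer_bound (16 * G \<delta>) \<le> sqrt (36 * (N + (1 + s1\<^sup>2) * G \<delta>))"
      unfolding answer_bound_def by (rule real_sqrt_le_mono)
    then show ?thesis by (simp only: real_sqrt_mult) simp
  qed
  then have "answer_bound (16 * G \<delta>) / sqrt (1 - \<beta>2) \<le> 6 * sqrt (N + (1 + s1\<^sup>2) * G \<delta>) / sqrt (1 - \<beta>2)"
    using beta2 by (intro divide_right_mono) auto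
  then have "\<epsilon>0 + answer_bound (16 * G \<delta>) / sqrt (1 - \<beta>2) \<le> 6 * ?R"
    using eps0 by (simp add: real_sqrt_divide)
  then have A: "(\<epsilon>0 + answer_bound (16 * G \<delta>) / sqrt (1 - \<beta>2)) / C0 \<le> 6 * ?R / C0"
    using C0 by (intro divide_right_mono) auto
  have R0: "0 \<le> ?R" using eps0 beta2 N0 G0 by (auto intro!: add_nonneg_nonneg mult_nonneg_nonneg)
  have "(\<Sum>s=1..T. (l2norm d (gradient d f (adam_x d \<beta>1 \<beta>2 \<eta> \<epsilon> x1 g s)))\<^sup>2) = (\<Sum>s<T. (l2norm d (grad s))\<^sup>2)"
    by (rule sum.reindex_bij_witness[of _ Suc "\<lambda>s. s - 1"]) (auto simp: grad_def iter_def)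
  also have "\<dots> \<le> 32/3 * G \<delta> / L * ((\<epsilon>0 + answer_bound (16 * G \<delta>) / sqrt (1 - \<beta>2)) / C0)"
    by (rule gradient_sum_le[OF T \<delta> refl conc])
  also have "\<dots> \<le> 32/3 * G \<delta> / L * (6 * ?R / C0)"
    using A G0 L_pos by (intro mult_left_mono) auto
  finally have "1 / real T * (\<Sum>s=1..T. (l2norm d (gradient d f (adam_x d \<beta>1 \<beta>2 \<eta> \<epsilon> x1 g s)))\<^sup>2)
      \<le> 1 / real T * (32/3 * G \<delta> / L * (6 * ?R / C0))"
    by (intro mult_left_mono) auto
  also have "\<dots> = 64 / L * (G \<delta> / (real T * C0) * ?R)"
  proof -
    have eq: "1 / t * (32/3 * g / l * (6 * r / c)) = 64 / l * (g / (t * c) * r)"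
      if "t \<noteq> 0" "l \<noteq> 0" "c \<noteq> 0" for t g l r c :: real using that by (simp add: field_simps)
    show ?thesis by (rule eq) (use T L_pos C0 in auto)
  qed
  also have "\<dots> \<le> C * (G \<delta> / (real T * C0) * ?R)"
    using C G0 C0 R0 by (intro mult_right_mono mult_nonneg_nonneg divide_nonneg_nonneg) auto
  finally show ?thesis by (simp only: mult.assoc)
qed

section \<open>Concentration\<close>

text \<open>
  A product of factors with conditional means at most 1 is a supermartingale.
\<close>

lemma (in Ionescu_Tulcea) nn_integral_prod_C_le_1:
  fixes \<phi> :: "nat \<Rightarrow> (nat \<Rightarrow> 'a) \<Rightarrow> ennreal"
  assumes meas: "\<And>k n. k < n \<Longrightarrow> \<phi> k \<in> borel_measurable (PiM {0..<n} M)"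
    and adapted: "\<And>k n \<omega> x. k < n \<Longrightarrow> \<phi> k (fun_upd \<omega> n x) = \<phi> k \<omega>"
    and step: "\<And>n \<omega>. \<omega> \<in> space (PiM {0..<n} M) \<Longrightarrow> (\<integral>\<^sup>+x. \<phi> n (fun_upd \<omega> n x) \<partial>P n \<omega>) \<le> 1"
  shows "(\<integral>\<^sup>+\<omega>. (\<Prod>k<n. \<phi> k \<omega>) \<partial>C 0 n (\<lambda>_. undefined)) \<le> 1"
proof (induction n)
  case 0
  have "(\<lambda>_. undefined) \<in> space (PiM {0..<0} M)" by (simp add: space_PiM)
  then show ?case by (simp add: nn_integral_return)
next
  case (Suc n)
  let ?u = "\<lambda>_::nat. undefined :: 'a"
  have u: "?u \<in> space (PiM {0..<0} M)" by (simp add: space_PiM)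
  have prodm: "(\<lambda>\<omega>. \<Prod>k<Suc n. \<phi> k \<omega>) \<in> borel_measurable (PiM {0..<Suc n} M)"
    using meas[of _ "Suc n"] by (intro borel_measurable_prod_ennreal) auto
  have spC: "space (C 0 n ?u) = space (PiM {0..<n} M)" using space_C[OF u, of n] by simp
  have "(\<integral>\<^sup>+\<omega>. (\<Prod>k<Suc n. \<phi> k \<omega>) \<partial>C 0 (Suc n) ?u)
      = (\<integral>\<^sup>+\<omega>. (\<integral>\<^sup>+\<omega>'. (\<Prod>k<Suc n. \<phi> k \<omega>') \<partial>eP n \<omega>) \<partial>C 0 n ?u)"
  proof -
    have "eP n \<in> C 0 n ?u \<rightarrow>\<^sub>M subprob_algebra (PiM {0..<Suc n} M)"
      using measurable_eP[of n]
      unfolding measurable_cong_sets[OF sets_C[OF u, of n, unfolded add_0] refl] .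
    from nn_integral_bind[OF prodm this] show ?thesis unfolding C.simps add_0 .
  qed
  also have "\<dots> \<le> (\<integral>\<^sup>+\<omega>. (\<Prod>k<n. \<phi> k \<omega>) \<partial>C 0 n ?u)"
  proof (rule nn_integral_mono)
    fix \<omega> assume "\<omega> \<in> space (C 0 n ?u)"
    then have w: "\<omega> \<in> space (PiM {0..<n} M)" using spC by simp
    have upd: "(\<lambda>x. fun_upd \<omega> n x) \<in> P n \<omega> \<rightarrow>\<^sub>M PiM {0..<Suc n} M"
    proof -
      have "(\<lambda>x. fun_upd \<omega> n x) \<in> M n \<rightarrow>\<^sub>M PiM {0..<Suc n} M"
        using w by (intro measurable_fun_upd[where J = "{0..<n}"]) auto
      then show ?thesis unfolding measurable_cong_sets[OF sets_P[OF w] refl] .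
    qed
    have "(\<integral>\<^sup>+\<omega>'. (\<Prod>k<Suc n. \<phi> k \<omega>') \<partial>eP n \<omega>) = (\<integral>\<^sup>+x. (\<Prod>k<Suc n. \<phi> k (fun_upd \<omega> n x)) \<partial>P n \<omega>)"
      by (rule nn_integral_eP[OF w prodm])
    also have "\<dots> = (\<integral>\<^sup>+x. (\<Prod>k<n. \<phi> k \<omega>) * \<phi> n (fun_upd \<omega> n x) \<partial>P n \<omega>)"
      by (intro nn_integral_cong) (simp add: adapted mult.commute)
    also have "\<dots> = (\<Prod>k<n. \<phi> k \<omega>) * (\<integral>\<^sup>+x. \<phi> n (fun_upd \<omega> n x) \<partial>P n \<omega>)"
      using measurable_compose[OF upd meas[of n "Suc n"]] by (intro nn_integral_cmult) auto
    also have "\<dots> \<le> (\<Prod>k<n. \<phi> k \<omega>) * 1" by (intro mult_left_mono step w) auto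
    finally show "(\<integral>\<^sup>+\<omega>'. (\<Prod>k<Suc n. \<phi> k \<omega>') \<partial>eP n \<omega>) \<le> (\<Prod>k<n. \<phi> k \<omega>)" by simp
  qed
  finally show ?case using Suc by (rule order_trans)
qed

text \<open>
  Hoeffding's lemma for a linear combination of the coordinates. The integrand is infinite where the noise
  is too large. That is a null set here, but with this value a finite integrand certifies the noise bound.
\<close>

lemma bounded_noise_exp_le_1:
  fixes c p W :: "nat \<Rightarrow> real"
  assumes N: "prob_space N"
    and mean: "\<And>i. i \<in> {1..d} \<Longrightarrow> has_bochner_integral N (\<lambda>x. x i) (p i)"
    and bnd: "\<And>i. i \<in> {1..d} \<Longrightarrow> AE x in N. \<bar>x i - p i\<bar> \<le> W i"
  shows "(\<integral>\<^sup>+x. (if \<forall>i\<in>{1..d}. \<bar>x i - p i\<bar> \<le> W i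
      then ennreal (exp ((\<Sum>i=1..d. c i * (x i - p i)) - (\<Sum>i=1..d. \<bar>c i\<bar> * W i)\<^sup>2 / 2)) else \<infinity>) \<partial>N) \<le> 1"
proof -
  interpret prob_space N by (rule N)
  let ?X = "\<lambda>x. \<Sum>i=1..d. c i * (x i - p i)" and ?R = "\<Sum>i=1..d. \<bar>c i\<bar> * W i"
  have all: "AE x in N. \<forall>i\<in>{1..d}. \<bar>x i - p i\<bar> \<le> W i"
    using bnd by (intro AE_finite_allI) auto
  have int: "integrable N (\<lambda>x. x i)" "expectation (\<lambda>x. x i) = p i" if "i \<in> {1..d}" for i
    using mean[OF that] by (auto simp: has_bochner_integral_iff)
  have int0: "integrable N (\<lambda>x. c i * (x i - p i))" "expectation (\<lambda>x. c i * (x i - p i)) = 0"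
    if "i \<in> {1..d}" for i
  proof -
    show "integrable N (\<lambda>x. c i * (x i - p i))"
      by (intro integrable_mult_right Bochner_Integration.integrable_diff int(1)[OF that]) simp
    have "expectation (\<lambda>x. x i - p i) = expectation (\<lambda>x. x i) - expectation (\<lambda>x. p i)"
      by (intro Bochner_Integration.integral_diff int(1)[OF that]) simp
    then show "expectation (\<lambda>x. c i * (x i - p i)) = 0"
      using int(2)[OF that] by (simp add: prob_space)
  qed
  have Xm: "?X \<in> borel_measurable N"
    by (intro borel_measurable_sum borel_measurable_integrable int0)
  have "expectation ?X = (\<Sum>i=1..d. expectation (\<lambda>x. c i * (x i - p i)))"
    by (intro Bochner_Integration.integral_sum int0)
  also have "\<dots> = 0" by (intro sum.neutral ballI int0)
  finally have EX: "expectation ?X = 0" .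
  have XR: "AE x in N. ?X x \<in> {- ?R..?R}"
    using all
  proof eventually_elim
    case (elim x)
    have "\<bar>?X x\<bar> \<le> (\<Sum>i=1..d. \<bar>c i * (x i - p i)\<bar>)" by (rule sum_abs)
    also have "\<dots> \<le> ?R"
    proof (rule sum_mono)
      fix i assume "i \<in> {1..d}"
      then show "\<bar>c i * (x i - p i)\<bar> \<le> \<bar>c i\<bar> * W i"
        unfolding abs_mult using elim by (intro mult_left_mono) auto
    qed
    finally have "\<bar>?X x\<bar> \<le> ?R" .
    then show ?case unfolding atLeastAtMost_iff by linarith
  qed
  have bounded: "interval_bounded_random_variable N ?X (- ?R) ?R"
    by (intro interval_bounded_random_variable.intro interval_bounded_random_variable_axioms.intro N Xm XR)
  have "AE x in N. (if \<forall>i\<in>{1..d}. \<bar>x i - p i\<bar> \<le> W i then ennreal (exp (?X x - ?R\<^sup>2 / 2)) else \<infinity>)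
      = ennreal (exp (- (?R\<^sup>2 / 2))) * ennreal (exp (1 * ?X x))"
    using all
  proof eventually_elim
    case (elim x)
    have "exp (?X x - ?R\<^sup>2 / 2) = exp (- (?R\<^sup>2 / 2)) * exp (1 * ?X x)"
      by (simp only: mult_exp_exp) (simp only: mult_1 uminus_add_conv_diff)
    then show ?case unfolding if_P[OF elim] by (simp only: ennreal_mult exp_ge_zero)
  qed
  then have "(\<integral>\<^sup>+x. (if \<forall>i\<in>{1..d}. \<bar>x i - p i\<bar> \<le> W i then ennreal (exp (?X x - ?R\<^sup>2 / 2)) else \<infinity>) \<partial>N)
      = (\<integral>\<^sup>+x. ennreal (exp (- (?R\<^sup>2 / 2))) * ennreal (exp (1 * ?X x)) \<partial>N)"
    by (rule nn_integral_cong_AE)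
  also have "\<dots> = ennreal (exp (- (?R\<^sup>2 / 2))) * (\<integral>\<^sup>+x. ennreal (exp (1 * ?X x)) \<partial>N)"
    using Xm by (intro nn_integral_cmult) auto
  also have "\<dots> \<le> ennreal (exp (- (?R\<^sup>2 / 2))) * ennreal (exp (1\<^sup>2 * (?R - - ?R)\<^sup>2 / 8))"
    by (rule mult_left_mono[OF interval_bounded_random_variable.Hoeffdings_lemma_nn_integral_0[OF bounded _ EX]])
       simp_all
  also have "\<dots> = ennreal (exp (- (?R\<^sup>2 / 2)) * exp (?R\<^sup>2 / 2))"
    by (simp add: power2_eq_square flip: ennreal_mult)
  also have "\<dots> = 1" by (simp add: exp_minus)
  finally show ?thesis .
qed

lemma adam_v_cong: "(\<And>j. 1 \<le> j \<Longrightarrow> j \<le> s \<Longrightarrow> g j = g' j) \<Longrightarrow> adam_v \<beta> g s i = adam_v \<beta> g' s i"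
  by (induction s) auto

lemma adam_m_cong: "(\<And>j. 1 \<le> j \<Longrightarrow> j \<le> s \<Longrightarrow> g j = g' j) \<Longrightarrow> adam_m \<beta> g s i = adam_m \<beta> g' s i"
  by (induction s) auto

lemma adam_x_cong:
  "(\<And>j. 1 \<le> j \<Longrightarrow> j < s \<Longrightarrow> g j = g' j) \<Longrightarrow>
    adam_x d \<beta>1 \<beta>2 \<eta> \<epsilon> x1 g s = adam_x d \<beta>1 \<beta>2 \<eta> \<epsilon> x1 g' s"
proof (induction s)
  case (Suc s)
  have "adam_x d \<beta>1 \<beta>2 \<eta> \<epsilon> x1 g s = adam_x d \<beta>1 \<beta>2 \<eta> \<epsilon> x1 g' s"
    using Suc by auto
  moreover have "adam_v \<beta>2 g s i = adam_v \<beta>2 g' s i" "adam_m \<beta>1 g s i = adam_m \<beta>1 g' s i" for i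
    using Suc.prems by (auto intro!: adam_v_cong adam_m_cong)
  ultimately show ?case by (simp only: adam_x.simps)
qed simp

lemma answers_upd: "1 \<le> s \<Longrightarrow> s \<le> n \<Longrightarrow> answers (fun_upd \<omega> n x) s = answers \<omega> s"
  by (auto simp: answers_def)

lemma answers_upd_last: "answers (fun_upd \<omega> n x) (Suc n) = x"
  by (simp add: answers_def)

text \<open>
  The gradient is the mean of the kernel of answers, and means of kernels are measurable.
\<close>

lemma measurable_gradient_component:
  assumes K: "gradient_oracle d K" and unb: "unbiased_oracle d f K" and i: "i \<in> {1..d}"
  shows "(\<lambda>x. gradient d f x i) \<in> borel_measurable (Rd d)"
proof -
  have comp: "(\<lambda>v. v i) \<in> borel_measurable (Rd d)"
    unfolding Rd_def by (rule measurable_component_singleton) (use i in auto)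
  have "(\<lambda>x. integral\<^sup>L (K x) (\<lambda>v. v i)) \<in> borel_measurable (Rd d)"
    using measurable_compose[OF measurable_prob_algebraD[OF K[unfolded gradient_oracle_def]]
        integral_measurable_subprob_algebra[OF comp]] .
  moreover have "integral\<^sup>L (K x) (\<lambda>v. v i) = gradient d f x i" if "x \<in> space (Rd d)" for x
    using unb[unfolded unbiased_oracle_def, rule_format, OF that i] by (rule has_bochner_integral_integral_eq)
  ultimately show ?thesis by (simp only: measurable_cong[of "Rd d" "\<lambda>x. integral\<^sup>L (K x) (\<lambda>v. v i)" "\<lambda>x. gradient d f x i"])
qed

context adam_path
begin

text \<open>
  The value infinity makes one expectation bound control two things: where the product of the factors is
  below \<open>1 / \<delta>\<close>, the noise bound holds at every step, and the exponents add up to less than \<open>ln (1 / \<delta>)\<close>.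
\<close>

definition supermartingale_factor :: "real \<Rightarrow> nat \<Rightarrow> ennreal" where
  "supermartingale_factor D s = (if noise_within s
     then ennreal (exp (stopped_noise D s))
     else \<infinity>)"

lemma prod_supermartingale_factor:
  assumes "\<And>s. s < n \<Longrightarrow> noise_within s"
  shows "(\<Prod>s<n. supermartingale_factor D s) = ennreal (exp (\<Sum>s<n. stopped_noise D s))"
  using assms
proof (induction n)
  case (Suc n)
  then show ?case by (simp add: supermartingale_factor_def exp_add ennreal_mult)
qed simp

lemma supermartingale_factor_ne_0: "supermartingale_factor D s \<noteq> 0"
  by (simp add: supermartingale_factor_def)

lemma noise_within_if_prod_finite:
  assumes "(\<Prod>s<n. supermartingale_factor D s) \<noteq> \<infinity>" "s < n"
  shows "noise_within s"
proof (rule ccontr)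
  assume "\<not> noise_within s"
  then have "supermartingale_factor D s = \<infinity>" by (simp add: supermartingale_factor_def)
  moreover have "(\<Prod>s<n. supermartingale_factor D s)
      = supermartingale_factor D s * (\<Prod>k\<in>{..<n} - {s}. supermartingale_factor D k)"
    using assms(2) by (intro prod.remove) auto
  moreover have "(\<Prod>k\<in>{..<n} - {s}. supermartingale_factor D k) \<noteq> 0"
    using supermartingale_factor_ne_0 by simp
  ultimately show False using assms(1) by (simp add: ennreal_top_mult)
qed

end

locale adam_random = adam_parameters +
  fixes d T :: nat and L :: real and f :: "(nat \<Rightarrow> real) \<Rightarrow> real" and fstar :: real
    and x1 :: "nat \<Rightarrow> real" and s0 s1 :: real and K :: "(nat \<Rightarrow> real) \<Rightarrow> (nat \<Rightarrow> real) measure"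
  assumes L_pos: "0 < L" and smooth: "L_smooth d L f" and x1: "x1 \<in> space (Rd d)"
    and below: "\<And>y. y \<in> space (Rd d) \<Longrightarrow> fstar \<le> f y"
    and d_pos: "1 \<le> d" and s0: "0 < s0" and s1: "0 \<le> s1"
    and kernel: "gradient_oracle d K" and unbiased: "unbiased_oracle d f K"
    and kernel_noise: "\<And>x i. x \<in> space (Rd d) \<Longrightarrow> i \<in> {1..d} \<Longrightarrow>
      AE g in K x. \<bar>g i - gradient d f x i\<bar> \<le> sqrt (s0\<^sup>2 + s1\<^sup>2 * (gradient d f x i)\<^sup>2)"

sublocale adam_random \<subseteq> path: adam_path \<beta>1 \<beta>2 C0 \<epsilon>0 d T L f fstar x1 "answers \<omega>" s0 s1 for \<omega>
  by unfold_locales (fact L_pos smooth x1 below d_pos s0 s1)+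

context adam_random
begin

abbreviation "answer_space n \<equiv> PiM {0..<n} (\<lambda>_. Rd d)"
abbreviation "kern \<equiv> adam_kernel d \<beta>1 \<beta>2 \<eta> \<epsilon> x1 K"

lemma measurable_grad:
  assumes k: "k < n" and i: "i \<in> {1..d}"
  shows "(\<lambda>\<omega>. path.grad \<omega> k i) \<in> borel_measurable (answer_space n)"
proof -
  have "(\<lambda>\<omega>. adam_x d \<beta>1 \<beta>2 \<eta> \<epsilon> x1 (answers \<omega>) (Suc k)) \<in> answer_space n \<rightarrow>\<^sub>M Rd d"
    by (rule measurable_adam_x) (use k x1 in auto)
  from measurable_compose[OF this measurable_gradient_component[OF kernel unbiased i]]
  show ?thesis unfolding path.grad_def path.iter_def .
qed

lemma measurable_run:
  assumes k: "k < n" and i: "i \<in> {1..d}"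
  shows "(\<lambda>\<omega>. path.spread \<omega> k i) \<in> borel_measurable (answer_space n)"
    and "(\<lambda>\<omega>. path.weight \<omega> k i) \<in> borel_measurable (answer_space n)"
    and "(\<lambda>\<omega>. answers \<omega> (Suc k) i) \<in> borel_measurable (answer_space n)"
proof -
  note [measurable] = measurable_grad[OF k i]
  have [measurable]: "(\<lambda>\<omega>. adam_v \<beta>2 (answers \<omega>) k i) \<in> borel_measurable (answer_space n)"
    by (rule measurable_adam_v) (use k i in auto)
  show [measurable]: "(\<lambda>\<omega>. path.spread \<omega> k i) \<in> borel_measurable (answer_space n)"
    unfolding path.spread_def by measurable
  show "(\<lambda>\<omega>. path.weight \<omega> k i) \<in> borel_measurable (answer_space n)"
    unfolding path.weight_def proxy_def by measurable
  show "(\<lambda>\<omega>. answers \<omega> (Suc k) i) \<in> borel_measurable (answer_space n)"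
    by (rule measurable_answers) (use k i in auto)
qed

lemma measurable_below_level:
  assumes k: "k < n"
  shows "Measurable.pred (answer_space n) (\<lambda>\<omega>. path.below_level \<omega> D k)"
proof -
  have "Measurable.pred (answer_space n) (\<lambda>\<omega>. (l2norm d (path.grad \<omega> j))\<^sup>2 \<le> D)" if "j \<le> k" for j
  proof -
    have [measurable]: "(\<lambda>\<omega>. \<Sum>i=1..d. (path.grad \<omega> j i)\<^sup>2) \<in> borel_measurable (answer_space n)"
      by (intro borel_measurable_sum borel_measurable_power measurable_grad) (use that k in auto)
    show ?thesis unfolding l2norm_sq by measurable
  qed
  then have "Measurable.pred (answer_space n) (\<lambda>\<omega>. \<forall>j\<in>{..k}. (l2norm d (path.grad \<omega> j))\<^sup>2 \<le> D)"
    by (intro pred_intros_finite) auto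
  then show ?thesis unfolding path.below_level_def atMost_iff[symmetric] Ball_def[symmetric] .
qed

lemma measurable_factor:
  assumes k: "k < n"
  shows "(\<lambda>\<omega>. path.supermartingale_factor \<omega> D k) \<in> borel_measurable (answer_space n)"
proof -
  note [measurable] = measurable_below_level[OF k]
  have "Measurable.pred (answer_space n)
      (\<lambda>\<omega>. \<bar>answers \<omega> (Suc k) i - path.grad \<omega> k i\<bar> \<le> path.spread \<omega> k i)" if i: "i \<in> {1..d}" for i
  proof -
    have "{\<omega> \<in> space (answer_space n). \<bar>answers \<omega> (Suc k) i - path.grad \<omega> k i\<bar> \<le> path.spread \<omega> k i}
        \<in> sets (answer_space n)"
      by (intro borel_measurable_le borel_measurable_abs borel_measurable_diff
          measurable_run[OF k i] measurable_grad[OF k i])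
    then show ?thesis by (simp only: pred_def)
  qed
  then have [measurable]: "Measurable.pred (answer_space n) (\<lambda>\<omega>. path.noise_within \<omega> k)"
    unfolding path.noise_within_def by (intro pred_intros_finite) auto
  have [measurable]: "(\<lambda>\<omega>. path.noise_term \<omega> k) \<in> borel_measurable (answer_space n)"
    "(\<lambda>\<omega>. path.noise_range \<omega> k) \<in> borel_measurable (answer_space n)"
    unfolding path.noise_term_def path.noise_range_def
    by (intro borel_measurable_sum borel_measurable_times borel_measurable_diff borel_measurable_uminus
        borel_measurable_abs measurable_run measurable_grad k; assumption)+
  show ?thesis unfolding path.supermartingale_factor_def path.stopped_noise_def path.compensated_noise_def by measurable
qed

text \<open>
  The next lemmas make explicit which quantities are determined by the answers before index \<open>n\<close>: changing
  the answer at \<open>n\<close> leaves them alone.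
\<close>

lemma grad_upd: "k \<le> n \<Longrightarrow> path.grad (fun_upd \<omega> n x) k = path.grad \<omega> k"
proof -
  assume "k \<le> n"
  then have "adam_x d \<beta>1 \<beta>2 \<eta> \<epsilon> x1 (answers (fun_upd \<omega> n x)) (Suc k)
      = adam_x d \<beta>1 \<beta>2 \<eta> \<epsilon> x1 (answers \<omega>) (Suc k)"
    by (intro adam_x_cong answers_upd) auto
  then show ?thesis unfolding path.grad_def path.iter_def by (rule arg_cong)
qed

lemma past_upd:
  assumes k: "k \<le> n"
  shows "path.spread (fun_upd \<omega> n x) k = path.spread \<omega> k"
    and "path.weight (fun_upd \<omega> n x) k = path.weight \<omega> k"
    and "path.noise_range (fun_upd \<omega> n x) k = path.noise_range \<omega> k"
    and "path.below_level (fun_upd \<omega> n x) D k = path.below_level \<omega> D k"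
proof -
  show sp: "path.spread (fun_upd \<omega> n x) k = path.spread \<omega> k"
    by (rule ext) (simp only: path.spread_def grad_upd[OF k])
  have "adam_v \<beta>2 (answers (fun_upd \<omega> n x)) k i = adam_v \<beta>2 (answers \<omega>) k i" for i
    using k by (intro adam_v_cong answers_upd) auto
  then show w: "path.weight (fun_upd \<omega> n x) k = path.weight \<omega> k"
    by (intro ext) (simp only: path.weight_def proxy_def grad_upd[OF k] sp)
  show "path.noise_range (fun_upd \<omega> n x) k = path.noise_range \<omega> k"
    by (simp only: path.noise_range_def grad_upd[OF k] sp w)
  have "path.grad (fun_upd \<omega> n x) j = path.grad \<omega> j" if "j \<le> k" for j
    using grad_upd that k by simp
  then show "path.below_level (fun_upd \<omega> n x) D k = path.below_level \<omega> D k"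
    by (simp add: path.below_level_def)
qed

lemma factor_upd:
  assumes k: "k < n"
  shows "path.supermartingale_factor (fun_upd \<omega> n x) D k = path.supermartingale_factor \<omega> D k"
proof -
  have k': "k \<le> n" using k by simp
  have a: "answers (fun_upd \<omega> n x) (Suc k) = answers \<omega> (Suc k)" using k by (intro answers_upd) auto
  have "path.noise_term (fun_upd \<omega> n x) k = path.noise_term \<omega> k"
    by (simp only: path.noise_term_def grad_upd[OF k'] past_upd[OF k'] a)
  moreover have "path.noise_within (fun_upd \<omega> n x) k = path.noise_within \<omega> k"
    by (simp only: path.noise_within_def grad_upd[OF k'] past_upd[OF k'] a)
  ultimately show ?thesis by (simp only: path.supermartingale_factor_def
      path.stopped_noise_def path.compensated_noise_def past_upd[OF k'])
qed

text \<open>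
  Given the past, the exponent is linear in the fresh answer, with coefficients \<open>c\<close> that are zero
  after stopping.
\<close>

lemma factor_step:
  "(\<integral>\<^sup>+x. path.supermartingale_factor (fun_upd \<omega> n x) D n \<partial>kern n \<omega>) \<le> 1"
proof -
  let ?x = "adam_x d \<beta>1 \<beta>2 \<eta> \<epsilon> x1 (answers \<omega>) (Suc n)"
  let ?p = "path.grad \<omega> n" and ?W = "path.spread \<omega> n" and ?w = "path.weight \<omega> n"
  define c where "c i = (if path.below_level \<omega> D n then - (path.tilt D * ?w i * ?p i) else 0)" for i
  have x: "?x \<in> space (Rd d)" by (rule adam_x_in_space[OF x1])
  have kx: "kern n \<omega> = K ?x" by (simp add: adam_kernel_def)
  have gp: "?p = gradient d f ?x" by (simp add: path.grad_def path.iter_def)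
  have prob: "prob_space (K ?x)"
    using measurable_space[OF kernel[unfolded gradient_oracle_def] x] by (simp add: space_prob_algebra)
  have factor: "path.supermartingale_factor (fun_upd \<omega> n x) D n
      = (if \<forall>i\<in>{1..d}. \<bar>x i - ?p i\<bar> \<le> ?W i
         then ennreal (exp ((\<Sum>i=1..d. c i * (x i - ?p i)) - (\<Sum>i=1..d. \<bar>c i\<bar> * ?W i)\<^sup>2 / 2)) else \<infinity>)" for x
  proof -
    have within: "path.noise_within (fun_upd \<omega> n x) n \<longleftrightarrow> (\<forall>i\<in>{1..d}. \<bar>x i - ?p i\<bar> \<le> ?W i)"
      by (simp only: path.noise_within_def grad_upd[OF order_refl] past_upd[OF order_refl] answers_upd_last)
    have expo: "(if path.below_level \<omega> D n
        then path.tilt D * path.noise_term (fun_upd \<omega> n x) n - (path.tilt D)\<^sup>2 / 2 * (path.noise_range \<omega> n)\<^sup>2 else 0)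
      = (\<Sum>i=1..d. c i * (x i - ?p i)) - (\<Sum>i=1..d. \<bar>c i\<bar> * ?W i)\<^sup>2 / 2"
    proof (cases "path.below_level \<omega> D n")
      case True
      have "path.tilt D * path.noise_term (fun_upd \<omega> n x) n = (\<Sum>i=1..d. c i * (x i - ?p i))"
        unfolding path.noise_term_def grad_upd[OF order_refl] past_upd[OF order_refl] answers_upd_last
          sum_distrib_left
        using True by (intro sum.cong) (auto simp: c_def)
      moreover have "(\<Sum>i=1..d. \<bar>c i\<bar> * ?W i) = \<bar>path.tilt D\<bar> * path.noise_range \<omega> n"
        unfolding path.noise_range_def sum_distrib_left
        using True by (intro sum.cong) (auto simp: c_def abs_mult)
      ultimately show ?thesis using True by (simp add: power_mult_distrib)
    qed (simp add: c_def)
    show ?thesis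
      by (simp only: path.supermartingale_factor_def path.stopped_noise_def path.compensated_noise_def
          within past_upd[OF order_refl] expo)
  qed
  show ?thesis unfolding factor kx
  proof (rule bounded_noise_exp_le_1[OF prob])
    fix i assume i: "i \<in> {1..d}"
    show "has_bochner_integral (K ?x) (\<lambda>x. x i) (?p i)"
      unfolding gp using unbiased[unfolded unbiased_oracle_def, rule_format, OF x i] .
    show "AE x in K ?x. \<bar>x i - ?p i\<bar> \<le> ?W i"
      unfolding gp path.spread_def by (rule kernel_noise[OF x i])
  qed
qed

definition run_law :: "(nat \<Rightarrow> nat \<Rightarrow> real) measure" where
  "run_law = adam_law d \<beta>1 \<beta>2 \<eta> \<epsilon> x1 K T"

lemma prob_space_run_law: "prob_space run_law"
  and sets_run_law: "sets run_law = sets (answer_space T)"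
  unfolding run_law_def using prob_space_adam_law[OF kernel x1] by auto

lemma nn_integral_prod_factor_le_1:
  "(\<integral>\<^sup>+\<omega>. (\<Prod>k<T. path.supermartingale_factor \<omega> D k) \<partial>run_law) \<le> 1"
proof -
  interpret Ionescu_Tulcea kern "\<lambda>_. Rd d"
    by (rule Ionescu_Tulcea_adam_kernel[OF kernel x1])
  show ?thesis unfolding run_law_def adam_law_def
    by (rule nn_integral_prod_C_le_1) (erule measurable_factor, erule factor_upd, rule factor_step)
qed

definition good_runs :: "real \<Rightarrow> real \<Rightarrow> (nat \<Rightarrow> nat \<Rightarrow> real) set" where
  "good_runs D \<delta> = {\<omega> \<in> space run_law. \<delta> * (\<Prod>k<T. path.supermartingale_factor \<omega> D k) < 1}"

lemma measurable_prod_factor: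
  "(\<lambda>\<omega>. \<Prod>k<T. path.supermartingale_factor \<omega> D k) \<in> borel_measurable run_law"
proof -
  have "(\<lambda>\<omega>. \<Prod>k<T. path.supermartingale_factor \<omega> D k) \<in> borel_measurable (answer_space T)"
    by (intro borel_measurable_prod_ennreal measurable_factor) auto
  then show ?thesis unfolding measurable_cong_sets[OF sets_run_law refl] .
qed

lemma good_runs_sets: "good_runs D \<delta> \<in> sets run_law"
proof -
  have "(\<lambda>\<omega>. ennreal \<delta> * (\<Prod>k<T. path.supermartingale_factor \<omega> D k)) \<in> borel_measurable run_law"
    by (intro borel_measurable_times_ennreal borel_measurable_const measurable_prod_factor)
  then show ?thesis unfolding good_runs_def by (intro borel_measurable_less borel_measurable_const)
qed

text \<open>
  Markov's inequality for the product of the factors.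
\<close>

lemma prob_good_runs:
  assumes \<delta>: "0 < \<delta>"
  shows "1 - \<delta> \<le> measure run_law (good_runs D \<delta>)"
proof -
  interpret prob_space run_law by (rule prob_space_run_law)
  let ?Z = "\<lambda>\<omega>. \<Prod>k<T. path.supermartingale_factor \<omega> D k"
  let ?B = "{\<omega> \<in> space run_law. 1 \<le> ennreal \<delta> * ?Z \<omega>}"
  have compl: "space run_law - good_runs D \<delta> = ?B" unfolding good_runs_def by (auto simp: not_less)
  have "emeasure run_law ?B \<le> ennreal \<delta> * (\<integral>\<^sup>+\<omega>. ?Z \<omega> \<partial>run_law)"
  proof -
    have "emeasure run_law ({\<omega> \<in> space run_law. 1 \<le> ennreal \<delta> * ?Z \<omega>})
        \<le> ennreal \<delta> * (\<integral>\<^sup>+\<omega>. ?Z \<omega> * indicator (space run_law) \<omega> \<partial>run_law)"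
      using nn_integral_Markov_inequality[of ?Z "space run_law" run_law "ennreal \<delta>"]
        measurable_prod_factor by (simp add: Int_def conj_commute)
    also have "(\<integral>\<^sup>+\<omega>. ?Z \<omega> * indicator (space run_law) \<omega> \<partial>run_law) = (\<integral>\<^sup>+\<omega>. ?Z \<omega> \<partial>run_law)"
      by (intro nn_integral_cong) simp
    finally show ?thesis .
  qed
  also have "\<dots> \<le> ennreal \<delta> * 1" by (intro mult_left_mono nn_integral_prod_factor_le_1) simp
  finally have "emeasure run_law (space run_law - good_runs D \<delta>) \<le> ennreal \<delta>" by (simp add: compl)
  then have "prob (space run_law - good_runs D \<delta>) \<le> \<delta>"
    using \<delta> by (simp add: emeasure_eq_measure)
  then show ?thesis using prob_compl[OF good_runs_sets[of D \<delta>]] by simp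
qed

lemma good_run:
  assumes \<delta>: "0 < \<delta>" and \<omega>: "\<omega> \<in> good_runs D \<delta>"
  shows "adam_run \<beta>1 \<beta>2 C0 \<epsilon>0 d T L f fstar x1 (answers \<omega>) s0 s1"
    and "(\<Sum>s<T. path.stopped_noise \<omega> D s) \<le> ln (1 / \<delta>)"
proof -
  let ?Z = "\<Prod>k<T. path.supermartingale_factor \<omega> D k"
  let ?S = "\<Sum>s<T. path.stopped_noise \<omega> D s"
  have Z: "ennreal \<delta> * ?Z < 1" using \<omega> by (simp add: good_runs_def)
  have "?Z \<noteq> \<infinity>"
  proof
    assume "?Z = \<infinity>"
    then have "ennreal \<delta> * ?Z = \<infinity>" using \<delta> by (simp add: ennreal_mult_top)
    then show False using Z by simp
  qed
  then have within: "path.noise_within \<omega> s" if "s < T" for s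
    using path.noise_within_if_prod_finite[OF _ that] by blast
  show "adam_run \<beta>1 \<beta>2 C0 \<epsilon>0 d T L f fstar x1 (answers \<omega>) s0 s1"
    by (rule adam_run.intro[OF path.adam_path_axioms]) (rule adam_run_axioms.intro, rule within)
  have "?Z = ennreal (exp ?S)" by (rule path.prod_supermartingale_factor[OF within])
  then have "ennreal (\<delta> * exp ?S) < ennreal 1" using Z \<delta> by (simp add: ennreal_mult)
  then have "\<delta> * exp ?S < 1" by (simp only: ennreal_less_iff[OF mult_nonneg_nonneg[OF less_imp_le[OF \<delta>] exp_ge_zero]])
  then have "exp ?S < 1 / \<delta>" using \<delta> by (simp add: pos_less_divide_eq mult.commute)
  then have "ln (exp ?S) < ln (1 / \<delta>)" by (rule ln_strict_mono) simp
  then show "?S \<le> ln (1 / \<delta>)" by simp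
qed

end

section \<open>The sizes of the explicit quantities\<close>

lemma Sigma_max_sq_le:
  assumes "0 < \<beta>2" "\<beta>2 < 1"
  shows "1 + 4 * (Sigma_max \<beta>2)\<^sup>2 \<le> 9 * (1 / \<beta>2)"
proof -
  have "0 \<le> sqrt ((1 + \<beta>2) / \<beta>2)" using assms by simp
  moreover have "sqrt ((1 + \<beta>2) / \<beta>2) \<le> sqrt (2 * (1 / \<beta>2))"
    using assms by (intro real_sqrt_le_mono) (simp add: divide_right_mono)
  moreover have "1 \<le> sqrt (2 * (1 / \<beta>2))" using assms by (intro real_le_rsqrt) (simp add: field_simps)
  ultimately have "\<bar>Sigma_max \<beta>2\<bar> \<le> sqrt (2 * (1 / \<beta>2))" unfolding Sigma_max_def by linarith
  then have "(Sigma_max \<beta>2)\<^sup>2 \<le> (sqrt (2 * (1 / \<beta>2)))\<^sup>2" by (metis abs_ge_zero power2_abs power_mono)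
  moreover have "1 \<le> 1 / \<beta>2" using assms by simp
  moreover have "(sqrt (2 * (1 / \<beta>2)))\<^sup>2 = 2 * (1 / \<beta>2)" using assms by simp
  ultimately show ?thesis by linarith
qed

lemma F_coarse:
  assumes L: "0 < L" and beta: "0 \<le> \<beta>1" "\<beta>1 < \<beta>2" "\<beta>2 < 1" and e: "0 < \<epsilon>0"
    and \<epsilon>: "\<epsilon> = \<epsilon>0 * sqrt (1 - \<beta>2)" and C: "4 + 4 * L\<^sup>2 \<le> C"
  shows "adam_F d T L C0 \<epsilon> \<beta>1 \<beta>2 s0 s1 g1 \<le> C * (1 + (s0\<^sup>2 * real T
      + (1 + s1\<^sup>2) * (g1\<^sup>2 * real T + real d * C0\<^sup>2 / (1 - \<beta>1 / \<beta>2) * real T ^ 3)) / (\<epsilon>0\<^sup>2 * (1 - \<beta>2)))"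
    and "1 \<le> adam_F d T L C0 \<epsilon> \<beta>1 \<beta>2 s0 s1 g1"
proof -
  define q where "q = 1 - \<beta>1 / \<beta>2"
  have q: "0 < q" using beta by (simp add: q_def)
  define a b c E where "a = s0\<^sup>2 * real T" and "b = (1 + s1\<^sup>2) * (g1\<^sup>2 * real T)"
    and "c = (1 + s1\<^sup>2) * (real d * C0\<^sup>2 / q * real T ^ 3)" and "E = \<epsilon>0\<^sup>2 * (1 - \<beta>2)"
  have nn: "0 \<le> a" "0 \<le> b" "0 \<le> c" using q by (auto simp: a_def b_def c_def)
  have E: "0 < E" "\<epsilon>\<^sup>2 = E" using e beta by (auto simp: E_def \<epsilon> power_mult_distrib)
  have F: "adam_F d T L C0 \<epsilon> \<beta>1 \<beta>2 s0 s1 g1 = 1 + (2 * a + 4 * b + 4 * L\<^sup>2 * c) / E"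
    unfolding adam_F_def E(2) q_def[symmetric] a_def b_def c_def
    by (simp add: algebra_simps add_divide_distrib)
  have "0 \<le> 4 * L\<^sup>2 * c" "0 \<le> 4 * L\<^sup>2 * (a + b)" using nn by auto
  then show "1 \<le> adam_F d T L C0 \<epsilon> \<beta>1 \<beta>2 s0 s1 g1" unfolding F using nn E by simp
  have le: "2 * a + 4 * b + 4 * L\<^sup>2 * c \<le> (4 + 4 * L\<^sup>2) * (a + (b + c))"
    using nn \<open>0 \<le> 4 * L\<^sup>2 * (a + b)\<close> by (simp add: algebra_simps)
  also have "\<dots> \<le> C * (a + (b + c))" using C nn by (intro mult_right_mono) auto
  finally have "(2 * a + 4 * b + 4 * L\<^sup>2 * c) / E \<le> C * (a + (b + c)) / E"
    using E by (intro divide_right_mono) auto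
  moreover have "1 \<le> C" using C zero_le_power2[of L] by linarith
  ultimately have "1 + (2 * a + 4 * b + 4 * L\<^sup>2 * c) / E \<le> C * (1 + (a + (b + c)) / E)"
    by (simp add: distrib_left)
  then show "adam_F d T L C0 \<epsilon> \<beta>1 \<beta>2 s0 s1 g1 \<le> C * (1 + (s0\<^sup>2 * real T
      + (1 + s1\<^sup>2) * (g1\<^sup>2 * real T + real d * C0\<^sup>2 / (1 - \<beta>1 / \<beta>2) * real T ^ 3)) / (\<epsilon>0\<^sup>2 * (1 - \<beta>2)))"
    unfolding F E_def[symmetric] q_def[symmetric] by (simp only: a_def b_def c_def distrib_left[of "1 + s1\<^sup>2"])
qed

text \<open>
  Each summand of \<open>G\<close> is compared with one of the three summands on the right. The two
  that contain neither \<open>gap\<close> nor a logarithm use that \<open>l\<close> is bounded away from zero.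
\<close>

lemma G_poly_coarse:
  fixes L C0 b1 s0 s1 e0 iu ir ib isb Sg gap D M Lg l q :: real
  assumes nn: "0 \<le> L" "0 \<le> C0" "0 \<le> b1" "b1 \<le> 1" "0 \<le> s0" "0 \<le> s1" "0 \<le> e0" "0 \<le> gap" "0 \<le> D" "0 \<le> M" "0 \<le> Lg" "0 \<le> Sg"
    and ge1: "1 \<le> iu" "1 \<le> ir" "1 \<le> ib" "0 \<le> isb" "isb \<le> ib" and q: "0 \<le> q" "q \<le> 3/2"
    and Sg: "1 + 4 * Sg \<le> 9 * ib" and l: "1/2 \<le> l" "M \<le> l" "Lg \<le> l"
  shows "G_poly L C0 b1 s0 s1 e0 D iu ir ib isb q Sg gap (D * M) (D * Lg)
    \<le> 10000 * (L + L\<^sup>2) * (gap + C0 * (C0 + e0 + s0) * (ib * iu\<^sup>2 * ir) * D * l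
        + C0\<^sup>2 * (1 + s1\<^sup>2) * (ib\<^sup>2 * iu ^ 4 * ir\<^sup>2) * D\<^sup>2 * l\<^sup>2)"
proof -
  let ?A = "C0 * (C0 + e0 + s0) * (ib * iu\<^sup>2 * ir)" and ?Q = "ib\<^sup>2 * iu ^ 4 * ir\<^sup>2"
  let ?B = "C0\<^sup>2 * (1 + s1\<^sup>2) * ?Q"
  define a b where "a = ?A * D * l"
    and "b = ?B * D\<^sup>2 * l\<^sup>2"
  have l0: "0 \<le> l" "1 \<le> 2 * l" using l by auto
  have l2: "1 \<le> 4 * l\<^sup>2" using power_mono[OF l0(2), of 2] by (simp add: power_mult_distrib)
  have pos: "0 \<le> iu" "0 \<le> ir" "0 \<le> ib" using ge1 by auto
  have iu2: "1 \<le> iu\<^sup>2" "iu \<le> iu\<^sup>2" "iu ^ 3 \<le> iu ^ 4" "iu\<^sup>2 \<le> iu ^ 4"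
    using ge1 one_le_power[of iu 2] self_le_power[of iu 2] power_increasing[of 3 4 iu] power_increasing[of 2 4 iu]
    by auto
  have b2: "b1\<^sup>2 \<le> 1" "b1 ^ 4 \<le> 1" using nn by (auto intro: power_le_one)
  have ib2: "1 \<le> ib\<^sup>2" and ir2: "1 \<le> ir\<^sup>2" "ir \<le> ir\<^sup>2"
    using ge1 one_le_power[of ib 2] one_le_power[of ir 2] self_le_power[of ir 2] by auto
  have iuir: "iu\<^sup>2 \<le> ib * iu\<^sup>2 * ir" "iu \<le> ib * iu\<^sup>2 * ir" "iu\<^sup>2 * ir \<le> ib * iu\<^sup>2 * ir"
  proof -
    have "1 * iu\<^sup>2 * 1 \<le> ib * iu\<^sup>2 * ir" using ge1 pos by (intro mult_mono) auto
    then show "iu\<^sup>2 \<le> ib * iu\<^sup>2 * ir" by simp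
    then show "iu \<le> ib * iu\<^sup>2 * ir" using iu2 by linarith
    have "1 * (iu\<^sup>2 * ir) \<le> ib * (iu\<^sup>2 * ir)" using ge1 pos by (intro mult_right_mono) auto
    then show "iu\<^sup>2 * ir \<le> ib * iu\<^sup>2 * ir" by (simp only: mult_1 mult.assoc)
  qed
  have quad: "iu ^ 3 * ir \<le> ?Q" "iu\<^sup>2 \<le> ?Q"
  proof -
    have "1 * iu ^ 3 * ir \<le> ?Q" using ib2 iu2 ir2 pos by (intro mult_mono) auto
    then show "iu ^ 3 * ir \<le> ?Q" by simp
    have "1 * iu\<^sup>2 * 1 \<le> ?Q" using ib2 iu2 ir2 pos by (intro mult_mono) auto
    then show "iu\<^sup>2 \<le> ?Q" by simp
  qed
  have CC: "C0\<^sup>2 \<le> C0 * (C0 + e0 + s0)" "C0 * s0 \<le> C0 * (C0 + e0 + s0)"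
    "C0 * e0 \<le> C0 * (C0 + e0 + s0)"
    using nn by (simp_all add: power2_eq_square distrib_left)
  have a0: "0 \<le> a" "0 \<le> b" using nn pos l0 by (auto simp: a_def b_def)
  have k2: "256 * L\<^sup>2 * C0\<^sup>2 * b1\<^sup>2 * D\<^sup>2 * (iu ^ 3 * ir) \<le> 1024 * (L\<^sup>2 * b)"
  proof -
    have "1 * 1 \<le> (1 + s1\<^sup>2) * (4 * l\<^sup>2)" using l2 by (intro mult_mono) auto
    then have "(C0\<^sup>2 * D\<^sup>2 * (iu ^ 3 * ir)) * (1 * 1)
        \<le> (C0\<^sup>2 * D\<^sup>2 * ?Q) * ((1 + s1\<^sup>2) * (4 * l\<^sup>2))"
      using pos by (intro mult_mono[OF mult_left_mono[OF quad(1)]]) auto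
    then have 1: "C0\<^sup>2 * D\<^sup>2 * (iu ^ 3 * ir) \<le> 4 * b" by (simp add: b_def mult_ac)
    have "b1\<^sup>2 * (256 * L\<^sup>2 * (C0\<^sup>2 * D\<^sup>2 * (iu ^ 3 * ir))) \<le> 1 * (256 * L\<^sup>2 * (4 * b))"
      by (rule mult_mono[OF b2(1) mult_left_mono[OF 1]]) (use pos in auto)
    then show ?thesis by (simp add: mult_ac)
  qed
  have lin: "X * D * m \<le> c * a" if "X \<le> c * ?A" "0 \<le> X" "m \<le> l" "0 \<le> m" for X c m
  proof -
    have "X * D * m \<le> c * ?A * D * l"
      using that nn by (intro mult_mono mult_nonneg_nonneg order_trans[OF that(2,1)]) auto
    then show ?thesis by (simp add: a_def mult_ac)
  qed
  have "X * y \<le> ?A"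
    if "X \<le> C0 * (C0 + e0 + s0)" "y \<le> ib * iu\<^sup>2 * ir" "0 \<le> X" "0 \<le> y" for X y
    by (rule mult_mono[OF that(1,2) order_trans[OF that(3,1)] that(4)])
  from this[OF CC(1)] this[OF CC(2)] this[OF CC(3)]
  have base: "C0\<^sup>2 * iu\<^sup>2 \<le> ?A"
      "C0\<^sup>2 * (iu\<^sup>2 * ir) \<le> ?A"
      "C0 * s0 * iu \<le> ?A"
      "C0 * s0 * (ib * (iu\<^sup>2 * ir)) \<le> ?A"
      "C0 * e0 * (ib * (iu\<^sup>2 * ir)) \<le> ?A"
      "C0\<^sup>2 * (ib * (iu\<^sup>2 * ir)) \<le> ?A"
    using iuir nn pos by (simp_all add: mult.assoc)
  have k3: "4 * L\<^sup>2 * C0\<^sup>2 * b1\<^sup>2 * D * (iu\<^sup>2 * ir) \<le> 8 * (L\<^sup>2 * a)"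
  proof -
    have "(C0\<^sup>2 * (iu\<^sup>2 * ir)) * D * (1/2) \<le> 1 * a"
      using base(2) l nn pos by (intro lin) auto
    then have 1: "C0\<^sup>2 * (iu\<^sup>2 * ir) * D \<le> 2 * a" by simp
    have "b1\<^sup>2 * (4 * L\<^sup>2 * (C0\<^sup>2 * (iu\<^sup>2 * ir) * D)) \<le> 1 * (4 * L\<^sup>2 * (2 * a))"
      by (rule mult_mono[OF b2(1) mult_left_mono[OF 1]]) (use pos nn in auto)
    then show ?thesis by (simp add: mult_ac)
  qed
  have k4: "48 * L * C0 * s0 * iu * (D * M) \<le> 48 * (L * a)"
  proof -
    have "C0 * s0 * iu * D * M \<le> 1 * a" using base(3) l nn pos by (intro lin) auto
    then have "48 * L * (C0 * s0 * iu * D * M) \<le> 48 * L * (1 * a)" using nn by (intro mult_left_mono) auto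
    then show ?thesis by (simp add: mult_ac)
  qed
  have k5: "8 * L * C0 * b1\<^sup>2 * (iu\<^sup>2 * ir) * (4 * s0 * ib + (e0 + q * s0) * isb + L * C0 / 2 * (1 + 4 * Sg)) * (D * Lg)
      \<le> 56 * (L * a) + 36 * (L\<^sup>2 * a)"
  proof -
    let ?Y = "4 * s0 * ib + (e0 + q * s0) * isb + L * C0 / 2 * (1 + 4 * Sg)"
    have "(e0 + q * s0) * isb \<le> (e0 + 3/2 * s0) * ib"
      using q ge1 nn by (intro mult_mono add_left_mono mult_right_mono) auto
    moreover have "L * C0 / 2 * (1 + 4 * Sg) \<le> L * C0 / 2 * (9 * ib)" using Sg nn by (intro mult_left_mono) auto
    ultimately have Y: "?Y \<le> (11/2 * s0 + e0 + 9/2 * L * C0) * ib" by (simp add: algebra_simps)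
    have Y0: "0 \<le> ?Y" using nn pos ge1 q by (intro add_nonneg_nonneg mult_nonneg_nonneg) auto
    have "C0 * (iu\<^sup>2 * ir) * ?Y \<le> C0 * (iu\<^sup>2 * ir) * ((11/2 * s0 + e0 + 9/2 * L * C0) * ib)"
      using nn pos by (intro mult_left_mono[OF Y]) auto
    also have "\<dots> = 11/2 * (C0 * s0 * (ib * (iu\<^sup>2 * ir))) + C0 * e0 * (ib * (iu\<^sup>2 * ir))
        + 9/2 * L * (C0\<^sup>2 * (ib * (iu\<^sup>2 * ir)))"
      by (simp add: algebra_simps power2_eq_square)
    also have "\<dots> \<le> 11/2 * ?A + ?A
        + 9/2 * L * ?A"
      using nn by (intro add_mono mult_left_mono base(4,5,6)) auto
    also have "\<dots> \<le> (7 + 9/2 * L) * ?A"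
    proof -
      have "0 \<le> ?A" using nn pos by auto
      then show ?thesis by (simp only: distrib_right)
    qed
    finally have 1: "C0 * (iu\<^sup>2 * ir) * ?Y * D * Lg \<le> (7 + 9/2 * L) * a"
      using l nn pos Y0 by (intro lin) auto
    have "b1\<^sup>2 * (8 * L * (C0 * (iu\<^sup>2 * ir) * ?Y * D * Lg)) \<le> 1 * (8 * L * ((7 + 9/2 * L) * a))"
      by (rule mult_mono[OF b2(1) mult_left_mono[OF 1]]) (use nn pos Y0 in \<open>auto intro!: mult_nonneg_nonneg\<close>)
    also have "\<dots> = 56 * (L * a) + 36 * (L\<^sup>2 * a)" by (simp add: algebra_simps power2_eq_square)
    finally show ?thesis by (simp only: mult_ac)
  qed
  have k6: "8 * (3 * L\<^sup>2 * C0\<^sup>2 * iu\<^sup>2 + 8 * L * s0 * C0 * iu) * (D * Lg) \<le> 24 * (L\<^sup>2 * a) + 64 * (L * a)"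
  proof -
    have "C0\<^sup>2 * iu\<^sup>2 * D * Lg \<le> 1 * a"
      by (rule lin) (use base(1) l nn pos in auto)
    moreover have "C0 * s0 * iu * D * Lg \<le> 1 * a"
      by (rule lin) (use base(3) l nn pos in auto)
    ultimately have "24 * L\<^sup>2 * (C0\<^sup>2 * iu\<^sup>2 * D * Lg) \<le> 24 * L\<^sup>2 * (1 * a)"
      "64 * L * (C0 * s0 * iu * D * Lg) \<le> 64 * L * (1 * a)"
      using nn by (auto intro!: mult_left_mono)
    then show ?thesis by (simp add: algebra_simps)
  qed
  have sq: "X * (D * m)\<^sup>2 \<le> b" if "X \<le> ?B" "0 \<le> X" "m \<le> l" "0 \<le> m" for X m
  proof -
    have "X * D\<^sup>2 * m\<^sup>2 \<le> ?B * D\<^sup>2 * l\<^sup>2"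
      using that nn by (intro mult_mono mult_nonneg_nonneg power_mono order_trans[OF that(2,1)]) auto
    then show ?thesis by (simp add: b_def power_mult_distrib mult.assoc)
  qed
  have sb: "C0\<^sup>2 * s1\<^sup>2 * iu\<^sup>2 \<le> ?B"
    using quad pos by (intro mult_mono mult_nonneg_nonneg) auto
  have k7: "2304 * L\<^sup>2 * C0\<^sup>2 * s1\<^sup>2 * iu\<^sup>2 * (D * M)\<^sup>2 \<le> 2304 * (L\<^sup>2 * b)"
  proof -
    have "C0\<^sup>2 * s1\<^sup>2 * iu\<^sup>2 * (D * M)\<^sup>2 \<le> b" using sb l nn pos by (intro sq) auto
    then have "2304 * L\<^sup>2 * (C0\<^sup>2 * s1\<^sup>2 * iu\<^sup>2 * (D * M)\<^sup>2) \<le> 2304 * L\<^sup>2 * b" by (intro mult_left_mono) auto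
    then show ?thesis by (simp only: mult.assoc)
  qed
  have k8: "256 * (16 * L\<^sup>2 * C0\<^sup>2 * s1\<^sup>2 * iu\<^sup>2
            + 9 * L\<^sup>2 * C0\<^sup>2 * b1 ^ 4 * (1 + s1\<^sup>2) * ?Q) * (D * Lg)\<^sup>2
      \<le> 4096 * (L\<^sup>2 * b) + 2304 * (L\<^sup>2 * b)"
  proof -
    have "C0\<^sup>2 * s1\<^sup>2 * iu\<^sup>2 * (D * Lg)\<^sup>2 \<le> b" using sb l nn pos by (intro sq) auto
    then have 1: "4096 * L\<^sup>2 * (C0\<^sup>2 * s1\<^sup>2 * iu\<^sup>2 * (D * Lg)\<^sup>2) \<le> 4096 * L\<^sup>2 * b" by (intro mult_left_mono) auto
    have "b1 ^ 4 * (?B) \<le> 1 * (?B)"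
      using b2 pos by (intro mult_right_mono) auto
    then have "b1 ^ 4 * (?B) * (D * Lg)\<^sup>2 \<le> b"
      using l nn pos by (intro sq) auto
    then have 2: "2304 * L\<^sup>2 * (b1 ^ 4 * (?B) * (D * Lg)\<^sup>2) \<le> 2304 * L\<^sup>2 * b"
      by (intro mult_left_mono) auto
    have "256 * (16 * L2 * c * s * u + 9 * L2 * c * b4 * t * w) * m = 4096 * L2 * (c * s * u * m) + 2304 * L2 * (b4 * (c * t * w) * m)"
      for L2 c s u b4 t w m :: real by (simp add: algebra_simps)
    then show ?thesis using 1 2 by (simp only: mult.assoc)
  qed
  have "8 * (L * gap) + 168 * (L * a) + 68 * (L\<^sup>2 * a) + 9728 * (L\<^sup>2 * b) \<le> 10000 * (L + L\<^sup>2) * (gap + a + b)"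
  proof -
    have "0 \<le> L * gap" "0 \<le> L * a" "0 \<le> L * b" "0 \<le> L\<^sup>2 * gap" "0 \<le> L\<^sup>2 * a" "0 \<le> L\<^sup>2 * b"
      using nn a0 by auto
    then show ?thesis by (simp only: distrib_left distrib_right mult.assoc)
  qed
  then show ?thesis using k2 k3 k4 k5 k6 k7 k8 unfolding G_poly_def a_def[symmetric] b_def[symmetric]
    by (simp only: mult.assoc[of 8 L gap])
qed

lemma G_coarse:
  assumes L: "0 < L" and beta: "0 \<le> \<beta>1" "\<beta>1 < \<beta>2" "\<beta>2 < 1" and C0: "0 < C0" and e: "0 < \<epsilon>0"
    and s: "0 \<le> s0" "0 \<le> s1" and d: "1 \<le> d" and T: "1 \<le> T" and \<delta>: "0 < \<delta>" "\<delta> < 1"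
    and F: "1 \<le> F" and gap: "0 \<le> \<Delta>" and lg: "lg = ln ((F + real d * real T) / (\<delta> * \<beta>2 ^ T))"
    and C: "10000 * (L + L\<^sup>2) \<le> C"
  shows "adam_G d T L C0 \<epsilon>0 \<beta>1 \<beta>2 s0 s1 \<Delta> F \<delta>
    \<le> C * (\<Delta> + C0 * (C0 + \<epsilon>0 + s0) / (\<beta>2 * (1 - \<beta>1)\<^sup>2 * (1 - \<beta>1 / \<beta>2)) * real d * lg
       + C0\<^sup>2 * (1 + s1\<^sup>2) / (\<beta>2\<^sup>2 * (1 - \<beta>1) ^ 4 * (1 - \<beta>1 / \<beta>2)\<^sup>2) * (real d)\<^sup>2 * lg\<^sup>2)"
    (is "_ \<le> C * ?B")
proof -
  have b2: "0 < \<beta>2" "\<beta>1 < 1" using beta by auto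
  have rho: "0 < 1 - \<beta>1 / \<beta>2" "1 - \<beta>1 / \<beta>2 \<le> 1" using beta b2 by auto
  have sb: "\<beta>2 \<le> sqrt \<beta>2" using beta b2 by (intro real_le_rsqrt) (simp add: power2_eq_square mult_left_le)
  have dT: "1 \<le> real d * real T" using mult_mono[of 1 "real d" 1 "real T"] d T by simp
  have pT: "0 < \<beta>2 ^ T" "\<beta>2 ^ T \<le> 1" using beta b2 by (auto intro: power_le_one)
  have dp: "0 < \<delta> * \<beta>2 ^ T" "\<delta> * \<beta>2 ^ T \<le> \<beta>2 ^ T" "\<delta> * \<beta>2 ^ T \<le> \<delta>"
    using \<delta> pT by (auto simp: mult_left_le mult_left_le_one_le)
  have l1: "ln (real d * real T / \<delta>) \<le> lg" unfolding lg
    using dT F \<delta> dp by (intro ln_mono frac_le divide_pos_pos) auto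
  have l2: "ln (F / \<beta>2 ^ T) \<le> lg" unfolding lg
    using dT F pT dp by (intro ln_mono frac_le divide_pos_pos) auto
  \<comment> \<open>The argument of the logarithm is at least 2, since F and the product of d and T are at least 1.\<close>
  have l3: "1 / 2 \<le> lg"
  proof -
    have "2 / 1 \<le> (F + real d * real T) / (\<delta> * \<beta>2 ^ T)"
      using dT F dp pT by (intro frac_le) auto
    then have "ln 2 \<le> lg" unfolding lg by (intro ln_mono) auto
    then show ?thesis using ln2_ge_two_thirds by simp
  qed
  have ln0: "0 \<le> ln (real d * real T / \<delta>)" "0 \<le> ln (F / \<beta>2 ^ T)"
    using dT F \<delta> pT by (auto intro!: ln_ge_zero simp: pos_le_divide_eq)
  have q: "sqrt 2 \<le> 3 / 2" by (intro real_le_lsqrt) (auto simp: power2_eq_square)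
  have B: "?B = \<Delta> + C0 * (C0 + \<epsilon>0 + s0) * (1 / \<beta>2 * (1 / (1 - \<beta>1))\<^sup>2 * (1 / (1 - \<beta>1 / \<beta>2))) * real d * lg
        + C0\<^sup>2 * (1 + s1\<^sup>2) * ((1 / \<beta>2)\<^sup>2 * (1 / (1 - \<beta>1)) ^ 4 * (1 / (1 - \<beta>1 / \<beta>2))\<^sup>2) * (real d)\<^sup>2 * lg\<^sup>2"
    by (simp only: power_divide power_one times_divide_times_eq mult_1 mult_1_right times_divide_eq_right
        divide_divide_eq_left)
  have "adam_G d T L C0 \<epsilon>0 \<beta>1 \<beta>2 s0 s1 \<Delta> F \<delta> \<le> 10000 * (L + L\<^sup>2) * ?B"
    unfolding adam_G_eq_poly B
    by (rule G_poly_coarse[OF _ _ _ _ _ _ _ _ _ _ _ _ _ _ _ _ _ _ q Sigma_max_sq_le l3 l1 l2])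
       (use L C0 beta b2 rho sb s e gap ln0 d in \<open>auto simp: pos_le_divide_eq frac_le\<close>)
  also have "\<dots> \<le> C * ?B"
  proof (rule mult_right_mono[OF C])
    show "0 \<le> ?B" using gap C0 e s b2 rho l3 by (intro add_nonneg_nonneg mult_nonneg_nonneg divide_nonneg_nonneg) auto
  qed
  finally show ?thesis .
qed

section \<open>The convergence theorem\<close>

lemma abs_le_linfnorm: "i \<in> {1..d} \<Longrightarrow> \<bar>v i\<bar> \<le> linfnorm d v"
  unfolding linfnorm_def by (intro Max_ge) auto

lemma linfnorm_attained:
  assumes "1 \<le> d" obtains i where "i \<in> {1..d}" "linfnorm d v = \<bar>v i\<bar>"
proof -
  have "Max ((\<lambda>i. \<bar>v i\<bar>) ` {1..d}) \<in> (\<lambda>i. \<bar>v i\<bar>) ` {1..d}" using assms by (intro Max_in) auto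
  then show ?thesis using that unfolding linfnorm_def by auto
qed

lemma linfnorm_sq_le_l2norm_sq:
  assumes "1 \<le> d" shows "(linfnorm d v)\<^sup>2 \<le> (l2norm d v)\<^sup>2"
proof -
  obtain i where i: "i \<in> {1..d}" "linfnorm d v = \<bar>v i\<bar>" by (rule linfnorm_attained[OF assms])
  show ?thesis unfolding i(2) by (rule power_mono[OF component_le_l2norm[OF i(1)]]) simp
qed

lemma affine_noise_linfnorm:
  assumes noise: "affine_variance_noise d f \<sigma>0 \<sigma>1 K" and x: "x \<in> space (Rd d)" and i: "i \<in> {1..d}"
  shows "AE g in K x. \<bar>g i - gradient d f x i\<bar>
    \<le> sqrt ((linfnorm d \<sigma>0)\<^sup>2 + (linfnorm d \<sigma>1)\<^sup>2 * (gradient d f x i)\<^sup>2)"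
proof -
  have sq: "(\<sigma> i)\<^sup>2 \<le> (linfnorm d \<sigma>)\<^sup>2" for \<sigma>
    using power_mono[OF abs_le_linfnorm[OF i], of \<sigma> 2] by simp
  have "AE g in K x. (g i - gradient d f x i)\<^sup>2 \<le> (\<sigma>0 i)\<^sup>2 + (\<sigma>1 i)\<^sup>2 * (gradient d f x i)\<^sup>2"
    using noise x i unfolding affine_variance_noise_def by blast
  then show ?thesis
  proof eventually_elim
    case (elim g)
    also have "(\<sigma>0 i)\<^sup>2 + (\<sigma>1 i)\<^sup>2 * (gradient d f x i)\<^sup>2
        \<le> (linfnorm d \<sigma>0)\<^sup>2 + (linfnorm d \<sigma>1)\<^sup>2 * (gradient d f x i)\<^sup>2"
      by (intro add_mono mult_right_mono sq) simp
    finally show ?case by (intro real_le_rsqrt) simp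
  qed
qed

lemma (in adam_random) average_gradient_prob:
  assumes T: "1 \<le> T" and \<delta>: "0 < \<delta>" "\<delta> < 1" and N: "s0\<^sup>2 \<le> N" and C: "64 / L \<le> C"
    and G: "G = adam_G d T L C0 \<epsilon>0 \<beta>1 \<beta>2 s0 s1 (f x1 - fstar)
      (adam_F d T L C0 \<epsilon> \<beta>1 \<beta>2 s0 s1 (l2norm d (gradient d f x1))) \<delta>"
  shows "1 - \<delta> \<le> measure run_law {\<omega>\<in>space run_law.
    1 / real T * (\<Sum>s=1..T. (l2norm d (gradient d f (adam_x d \<beta>1 \<beta>2 \<eta> \<epsilon> x1 (answers \<omega>) s)))\<^sup>2)
    \<le> C * (G / (real T * C0)) * (\<epsilon>0 + sqrt ((N + (1 + s1\<^sup>2) * G) / (1 - \<beta>2)))}"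
proof -
  interpret prob_space run_law by (rule prob_space_run_law)
  have GG: "path.G \<delta> = G" unfolding path.G_def path.F_def G ..
  let ?A = "\<lambda>\<omega>. 1 / real T * (\<Sum>s=1..T. (l2norm d (gradient d f (adam_x d \<beta>1 \<beta>2 \<eta> \<epsilon> x1 (answers \<omega>) s)))\<^sup>2)"
  let ?B = "C * (G / (real T * C0)) * (\<epsilon>0 + sqrt ((N + (1 + s1\<^sup>2) * G) / (1 - \<beta>2)))"
  have "1 - \<delta> \<le> measure run_law (good_runs (16 * G) \<delta>)" by (rule prob_good_runs[OF \<delta>(1)])
  also have "\<dots> \<le> measure run_law {\<omega>\<in>space run_law. ?A \<omega> \<le> ?B}"
  proof (rule finite_measure_mono)
    show "good_runs (16 * G) \<delta> \<subseteq> {\<omega>\<in>space run_law. ?A \<omega> \<le> ?B}"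
    proof
      fix \<omega> assume \<omega>: "\<omega> \<in> good_runs (16 * G) \<delta>"
      interpret run: adam_run \<beta>1 \<beta>2 C0 \<epsilon>0 d T L f fstar x1 "answers \<omega>" s0 s1
        by (rule good_run(1)[OF \<delta>(1) \<omega>])
      have "?A \<omega> \<le> ?B"
        using run.average_gradient_le[OF T \<delta> _ N C] good_run(2)[OF \<delta>(1) \<omega>] unfolding GG by blast
      moreover have "\<omega> \<in> space run_law" using \<omega> unfolding good_runs_def by blast
      ultimately show "\<omega> \<in> {\<omega>\<in>space run_law. ?A \<omega> \<le> ?B}" by blast
    qed
    have "(\<lambda>\<omega>. gradient d f (adam_x d \<beta>1 \<beta>2 \<eta> \<epsilon> x1 (answers \<omega>) s) i) \<in> borel_measurable (answer_space T)"
      if s: "s \<in> {1..T}" and i: "i \<in> {1..d}" for s i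
    proof -
      have k: "s = Suc (s - 1)" "s - 1 < T" using s by auto
      show ?thesis using measurable_grad[OF k(2) i] unfolding path.grad_def path.iter_def k(1)[symmetric] .
    qed
    then have "?A \<in> borel_measurable (answer_space T)"
      unfolding l2norm_sq
      by (intro borel_measurable_times borel_measurable_const borel_measurable_sum borel_measurable_power)
    then have "?A \<in> borel_measurable run_law" unfolding measurable_cong_sets[OF sets_run_law refl] .
    then show "{\<omega>\<in>space run_law. ?A \<omega> \<le> ?B} \<in> sets run_law"
      by (intro borel_measurable_le borel_measurable_const)
  qed
  finally show ?thesis .
qed

theorem theorem1:
  fixes L :: real
  assumes "L > 0"
  shows "\<exists>C>0. \<forall>(d::nat) (T::nat) (f :: (nat \<Rightarrow> real) \<Rightarrow> real) (fstar::real)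
      (\<sigma>0 :: nat \<Rightarrow> real) (\<sigma>1 :: nat \<Rightarrow> real) (K :: (nat \<Rightarrow> real) \<Rightarrow> (nat \<Rightarrow> real) measure)
      (x1 :: nat \<Rightarrow> real) (\<beta>1::real) (\<beta>2::real) (\<eta>::real) (\<epsilon>::real) (C0::real) (\<epsilon>0::real) (\<delta>::real).
      d \<ge> 1 \<and> T \<ge> 1 \<and>
      L_smooth d L f \<and> (\<forall>x\<in>space (Rd d). fstar \<le> f x) \<and>
      (\<forall>i\<in>{1..d}. \<sigma>0 i > 0 \<and> \<sigma>1 i > 0) \<and>
      gradient_oracle d K \<and> unbiased_oracle d f K \<and> affine_variance_noise d f \<sigma>0 \<sigma>1 K \<and>
      x1 \<in> space (Rd d) \<and>
      0 \<le> \<beta>1 \<and> \<beta>1 < \<beta>2 \<and> \<beta>2 < 1 \<and> C0 > 0 \<and> \<epsilon>0 > 0 \<and>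
      \<eta> = C0 * sqrt (1 - \<beta>2) \<and> \<epsilon> = \<epsilon>0 * sqrt (1 - \<beta>2) \<and>
      0 < \<delta> \<and> \<delta> < 1
      \<longrightarrow>
      (let s0 = linfnorm d \<sigma>0; s1 = linfnorm d \<sigma>1; g1 = l2norm d (gradient d f x1);
           F = adam_F d T L C0 \<epsilon> \<beta>1 \<beta>2 s0 s1 g1;
           G = adam_G d T L C0 \<epsilon>0 \<beta>1 \<beta>2 s0 s1 (f x1 - fstar) F \<delta>;
           P = adam_law d \<beta>1 \<beta>2 \<eta> \<epsilon> x1 K T;
           x = (\<lambda>\<omega> s. adam_x d \<beta>1 \<beta>2 \<eta> \<epsilon> x1 (answers \<omega>) s);
           lg = ln ((F + real d * real T) / (\<delta> * \<beta>2 ^ T))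
       in
         measure P {\<omega>\<in>space P.
            1 / real T * (\<Sum>s=1..T. (l2norm d (gradient d f (x \<omega> s)))\<^sup>2)
            \<le> C * (G / (real T * C0))
              * (\<epsilon>0 + sqrt (((l2norm d \<sigma>0)\<^sup>2 + (1 + s1\<^sup>2) * G) / (1 - \<beta>2)))} \<ge> 1 - \<delta>
         \<and> F \<le> C * (1 + (s0\<^sup>2 * real T
                  + (1 + s1\<^sup>2) * (g1\<^sup>2 * real T + real d * C0\<^sup>2 / (1 - \<beta>1 / \<beta>2) * real T ^ 3))
                / (\<epsilon>0\<^sup>2 * (1 - \<beta>2)))
         \<and> G \<le> C * (f x1 - fstar
               + C0 * (C0 + \<epsilon>0 + s0) / (\<beta>2 * (1 - \<beta>1)\<^sup>2 * (1 - \<beta>1 / \<beta>2)) * real d * lg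
               + C0\<^sup>2 * (1 + s1\<^sup>2) / (\<beta>2\<^sup>2 * (1 - \<beta>1) ^ 4 * (1 - \<beta>1 / \<beta>2)\<^sup>2)
                 * (real d)\<^sup>2 * lg\<^sup>2))"
proof -
  \<comment> \<open>One summand for each of the three claims.\<close>
  define C where "C = 64 / L + (4 + 4 * L\<^sup>2) + 10000 * (L + L\<^sup>2)"
  have parts: "0 < 64 / L" "0 < 4 + 4 * L\<^sup>2" "0 < 10000 * (L + L\<^sup>2)"
    using assms by (auto intro!: add_pos_nonneg)
  have C: "0 < C" "64 / L \<le> C" "4 + 4 * L\<^sup>2 \<le> C" "10000 * (L + L\<^sup>2) \<le> C"
    using parts unfolding C_def by linarith+
  show ?thesis
  proof (rule exI[of _ C], intro conjI allI impI, goal_cases)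
    case 1
    show ?case by (rule C(1))
  next
    case (2 d T f fstar \<sigma>0 \<sigma>1 K x1 \<beta>1 \<beta>2 \<eta> \<epsilon> C0 \<epsilon>0 \<delta>)
    then have d: "1 \<le> d" and T: "1 \<le> T" and smooth: "L_smooth d L f"
      and below: "\<And>x. x \<in> space (Rd d) \<Longrightarrow> fstar \<le> f x"
      and pos: "\<And>i. i \<in> {1..d} \<Longrightarrow> 0 < \<sigma>0 i \<and> 0 < \<sigma>1 i"
      and kernel: "gradient_oracle d K" and unbiased: "unbiased_oracle d f K"
      and noise: "affine_variance_noise d f \<sigma>0 \<sigma>1 K" and x1: "x1 \<in> space (Rd d)"
      and beta: "0 \<le> \<beta>1" "\<beta>1 < \<beta>2" "\<beta>2 < 1" and C0: "0 < C0" and e0: "0 < \<epsilon>0"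
      and \<eta>: "\<eta> = C0 * sqrt (1 - \<beta>2)" and \<epsilon>: "\<epsilon> = \<epsilon>0 * sqrt (1 - \<beta>2)" and \<delta>: "0 < \<delta>" "\<delta> < 1"
      by blast+
    define s0 s1 where "s0 = linfnorm d \<sigma>0" and "s1 = linfnorm d \<sigma>1"
    obtain i where i: "i \<in> {1..d}" using d by auto
    have s: "0 < s0" "0 \<le> s1"
      using abs_le_linfnorm[OF i, of \<sigma>0] abs_le_linfnorm[OF i, of \<sigma>1] pos[OF i]
      unfolding s0_def s1_def by linarith+
    interpret adam_random \<beta>1 \<beta>2 C0 \<epsilon>0 d T L f fstar x1 s0 s1 K
    proof unfold_locales
      fix x i assume "x \<in> space (Rd d)" "i \<in> {1..d}"
      then show "AE g in K x. \<bar>g i - gradient d f x i\<bar> \<le> sqrt (s0\<^sup>2 + s1\<^sup>2 * (gradient d f x i)\<^sup>2)"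
        unfolding s0_def s1_def by (rule affine_noise_linfnorm[OF noise])
    qed (fact assms smooth x1 below d s kernel unbiased beta C0 e0)+
    note F = F_coarse[OF assms beta e0 \<epsilon> C(3), of d T C0 s0 s1 "l2norm d (gradient d f x1)"]
    have gap: "0 \<le> f x1 - fstar" using below[OF x1] by simp
    have N: "s0\<^sup>2 \<le> (l2norm d \<sigma>0)\<^sup>2" unfolding s0_def by (rule linfnorm_sq_le_l2norm_sq[OF d])
    show ?case
      unfolding Let_def s0_def[symmetric] s1_def[symmetric]
      using average_gradient_prob[OF T \<delta> N C(2) refl] F(1)
        G_coarse[OF assms beta C0 e0 less_imp_le[OF s(1)] s(2) d T \<delta> F(2) gap refl C(4)]
      unfolding run_law_def \<eta> \<epsilon> by blast
  qed
qed

end
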